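(* Let $0\le k\le g$ with $N_k>1$, and let $B_0:=(0,\dots,0,N_k)$. The boundary polynomial $\bar H_k$ of $H_k$ equals $$\bar H_k=\sum_{(i,w_i)\in\mathcal{N}(H_k)}\left(\sum_{B\in\mathcal{B}(i,w_i+v_k(F))}f_B\,\Lambda^{B-B_0}\right)x^{w_i}y^i .$$
   Context: Let $\mathbb{K}$ be a perfect field and $F\in\mathbb{K}[[x]][y]$ a square-free Weierstrass polynomial of degree $d$ (monic, with all lower coefficients vanishing at $x=0$), with $\mathrm{char}\,\mathbb{K}=0$ or $>d$. $v_x$ denotes the $x$-valuation (for a polynomial or series in $y$, the minimum of the valuations of its coefficients). The Newton polygon $\mathcal{N}(H)$ of $H=\sum_i a_i(x)y^i=\sum a_{ij}x^jy^i$ is the lower convex hull of the points $(i,v_x(a_i))$; its boundary polynomial is $\bar H=\sum_{(i,j)\in\mathcal{N}(H)}a_{ij}x^jy^i$. A Weierstrass polynomial $H$ over a field $\mathbb{L}$ is degenerated over $\mathbb{L}$ if $\mathcal N(H)$ is straight (one segment or one point) of slope $-m/q$, $q,m$ coprime, $q>0$, and $\bar H=(P(y^q/x^m)\,x^{m\deg P})^N$ with $N\in\mathbb{N}$ and $P\in\mathbb{L}[Z]$ monic irreducible; $(q,m,P,N)$ is then its edge data. Sequence $H_k$: $N_0=d$, $\mathbb{K}_0=\mathbb{K}$, $c_0=-\mathrm{coeff}(F,y^{d-1})/d$, $H_0=F(x,y+c_0(x))$. For $k\ge1$, if $N_{k-1}>1$ and $H_{k-1}$ is degenerated over $\mathbb{K}_{k-1}$,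 let $(q_k,m_k,P_k,N_k)$ be its edge data, $\ell_k=\deg P_k$, $\mathbb{K}_k=\mathbb{K}_{k-1}[Z_k]/(P_k(Z_k))$, $z_k$ the class of $Z_k$, and $(s_k,t_k)$ the unique integers with $q_ks_k-t_km_k=1$, $0\le t_k<q_k$. Then $H_{k-1}(z_k^{t_k}x^{q_k},x^{m_k}(y+z_k^{s_k}))=x^{q_km_k\ell_kN_k}G_kV_k$ with $V_k\in\mathbb{K}_k[[x,y]]^\times$ and $G_k\in\mathbb{K}_k[[x]][y]$ Weierstrass of degree $N_k$; put $c_k=-\mathrm{coeff}(G_k,y^{N_k-1})/N_k$ and $H_k=G_k(x,y+c_k(x))$. $g$ is the smallest index such that $N_g=1$ or $H_g$ is not degenerated over $\mathbb{K}_g$. Let $\pi_0(x,y)=(x,y+c_0(x))$, $\sigma_k(x,y)=(z_k^{t_k}x^{q_k},x^{m_k}(y+z_k^{s_k}+c_k(x)))$, $\pi_k=\pi_{k-1}\circ\sigma_k$, $\pi_k^*H=H\circ\pi_k$. Then $\pi_k(x,y)=(\mu_kx^{e_k},\alpha_kx^{r_k}y+S_k(x))$ with $e_k=q_1\cdots q_k$, $\mu_k,\alpha_k\in\mathbb{K}_k^\times$, $r_k\in\mathbb N$, $S_k\in\mathbb{K}_k[[x]]$. Put $f_k=\ell_1\cdots\ell_k$, $d_k=e_kf_k$ (so $d=N_kd_k$). The $k$-th minimal polynomial $\phi_k$ is the unique monic irreducible polynomial in $\mathbb{K}[[x]][y]$ with $\phi_k(\mu_kx^{e_k},S_k(x))=0$;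 it has degree $d_k$. Put $\phi_{-1}=x$. For $H\in\mathbb{K}[[x]][y]$ let $v_k(H)=v_x(\pi_k^*H)$ ($v_k(0)=\infty$), and for $H\ne0$ let $\lambda_k(H)\in\mathbb{K}_k$ be the trailing coefficient in $y$ (coefficient of the lowest power of $y$) of $\left(\pi_k^*H/x^{v_k(H)}\right)_{|x=0}$; $\lambda_k(0)=0$. Fix $k$. $\Phi=(\phi_{-1},\dots,\phi_k)$, $V=(v_k(\phi_{-1}),\dots,v_k(\phi_k))$, $\Lambda=(\lambda_k(\phi_{-1}),\dots,\lambda_k(\phi_k))$, $\mathcal{B}=\{(b_{-1},\dots,b_k)\in\mathbb{N}^{k+2}: b_{i-1}<q_i\ell_i,\ 1\le i\le k\}$, $\Phi^B=\prod_{i=-1}^k\phi_i^{b_i}$, $\Lambda^B=\prod_{i=-1}^k\lambda_k(\phi_i)^{b_i}$ (also for integer exponent vectors, the entries of $\Lambda$ being nonzero), $\langle\,,\rangle$ the usual scalar product, and $\mathcal{B}(i,w)=\{B\in\mathcal{B}: b_k=i,\ \langle B,V\rangle=w\}$ (with $\mathcal B(i,\infty)=\emptyset$). $F$ has a unique $\Phi$-adic expansion $F=\sum_{B\in\mathcal{B}}f_B\Phi^B$, $f_B\in\mathbb{K}$. Finally $w_i=\min\{\langle B,V\rangle: B\in\mathcal{B},\,b_k=i,\,f_B\ne0\}-v_k(F)$, with $w_i=\infty$ if the minimum is over the empty set. *)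

theory Defs
  imports
    "HOL-Analysis.Analysis"
    "HOL-Algebra.Algebraic_Closure_Type"
    "HOL-Computational_Algebra.Computational_Algebra"
begin

hide_const (open) UnivPoly.coeff UnivPoly.monom Module.smult Polynomials.degree Polynomials.lead_coeff
  Divisibility.irreducible

text \<open>
  Conventions.  The ground field is a type \<open>'k :: field\<close>, and \<open>K[[x]][y]\<close> is \<open>'k fps poly\<close> (outer
  variable \<open>y\<close>).  The extensions \<open>K\<^sub>k = K\<^sub>k\<^sub>-\<^sub>1[Z]/(P\<^sub>k)\<close> are realised, up to isomorphism, as the
  subfields \<open>K\<^sub>k\<^sub>-\<^sub>1[z\<^sub>k]\<close> of the algebraic closure \<open>'k alg_closure\<close>, for an arbitrary choice of
  the root \<open>z\<^sub>k\<close> of \<open>P\<^sub>k\<close>.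
\<close>

definition perfect_field :: "'k::field itself \<Rightarrow> bool" where
  "perfect_field _ \<longleftrightarrow> (\<forall>p :: 'k poly. irreducible p \<longrightarrow> coprime p (pderiv p))"

definition weierstrass :: "'a::comm_ring_1 fps poly \<Rightarrow> bool" where
  "weierstrass H \<longleftrightarrow> lead_coeff H = 1 \<and> (\<forall>i < degree H. fps_nth (coeff H i) 0 = 0)"

definition v_x :: "'a::zero fps \<Rightarrow> enat" where
  "v_x a = (if a = 0 then \<infinity> else enat (subdegree a))"

definition v_x_poly :: "'a::zero fps poly \<Rightarrow> enat" where
  "v_x_poly H = (INF i. v_x (coeff H i))"

definition fps_ac :: "'k::field fps \<Rightarrow> 'k alg_closure fps" where
  "fps_ac a = Abs_fps (\<lambda>n. to_ac (fps_nth a n))"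

abbreviation poly_ac :: "'k::field fps poly \<Rightarrow> 'k alg_closure fps poly" where
  "poly_ac H \<equiv> map_poly fps_ac H"


subsection \<open>Newton polygons\<close>

definition newton_points :: "'a::zero fps poly \<Rightarrow> (real \<times> real) set" where
  "newton_points H = {(real i, real (subdegree (coeff H i))) | i. coeff H i \<noteq> 0}"

definition newton_polygon :: "'a::zero fps poly \<Rightarrow> (real \<times> real) set" where
  "newton_polygon H = {(u, v) \<in> convex hull (newton_points H).
     \<forall>v'. (u, v') \<in> convex hull (newton_points H) \<longrightarrow> v \<le> v'}"

definition boundary_poly :: "'a::comm_ring_1 fps poly \<Rightarrow> 'a fps poly" where
  "boundary_poly H =
     (\<Sum>(i, j) \<in> {(i::nat, j::nat). (real i, real j) \<in> newton_polygon H}.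
        monom (fps_const (fps_nth (coeff H i) j) * fps_X ^ j) i)"


subsection \<open>Degenerated polynomials over a subfield \<open>L\<close>\<close>

definition poly_over :: "'a::zero set \<Rightarrow> 'a poly \<Rightarrow> bool" where
  "poly_over L p \<longleftrightarrow> (\<forall>i. coeff p i \<in> L)"

definition fps_poly_over :: "'a::zero set \<Rightarrow> 'a fps poly \<Rightarrow> bool" where
  "fps_poly_over L H \<longleftrightarrow> (\<forall>i j. fps_nth (coeff H i) j \<in> L)"

definition irreducible_over :: "'a::field set \<Rightarrow> 'a poly \<Rightarrow> bool" where
  "irreducible_over L p \<longleftrightarrow> poly_over L p \<and> degree p > 0 \<and>
     (\<forall>a b. poly_over L a \<and> poly_over L b \<and> p = a * b \<longrightarrow> degree a = 0 \<or> degree b = 0)"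

text \<open>The polynomial \<open>P(y\<^sup>q/x\<^sup>m) x\<^sup>m\<^sup>d\<close> with \<open>d\<close> the degree of \<open>P\<close>.\<close>
definition homogenised :: "nat \<Rightarrow> nat \<Rightarrow> 'a::comm_ring_1 poly \<Rightarrow> 'a fps poly" where
  "homogenised q m P =
     (\<Sum>a \<le> degree P. monom (fps_const (coeff P a) * fps_X ^ (m * (degree P - a))) (q * a))"

text \<open>
  A segment of the Newton polygon of a Weierstrass polynomial has negative slope \<open>-m/q\<close>,
  so \<open>m\<close> may be taken in \<open>\<nat>\<close>.
\<close>
definition edge_data ::
    "'a::field set \<Rightarrow> 'a fps poly \<Rightarrow> nat \<Rightarrow> nat \<Rightarrow> 'a poly \<Rightarrow> nat \<Rightarrow> bool" where
  "edge_data L H q m P N \<longleftrightarrow>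
     q > 0 \<and> coprime q m \<and>
     (\<exists>A B. newton_polygon H = closed_segment A B \<and>
        real q * (snd B - snd A) = - real m * (fst B - fst A)) \<and>
     lead_coeff P = 1 \<and> irreducible_over L P \<and>
     boundary_poly H = homogenised q m P ^ N"

definition degenerated :: "'a::field set \<Rightarrow> 'a fps poly \<Rightarrow> bool" where
  "degenerated L H \<longleftrightarrow> (\<exists>q m P N. edge_data L H q m P N)"


subsection \<open>Substitutions\<close>

text \<open>A pair \<open>(X, Y)\<close> stands for the map \<open>(x, y) \<mapsto> (X(x), Y(x, y))\<close>; here \<open>X(0) = 0\<close> always.\<close>
type_synonym 'a xy_map = "'a fps \<times> 'a fps poly"

definition pullback :: "'a::idom xy_map \<Rightarrow> 'a fps poly \<Rightarrow> 'a fps poly" where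
  "pullback \<tau> H = pcompose (map_poly (\<lambda>a. fps_compose a (fst \<tau>)) H) (snd \<tau>)"

definition xy_comp :: "'a::idom xy_map \<Rightarrow> 'a xy_map \<Rightarrow> 'a xy_map" where
  "xy_comp \<tau> \<tau>' = (fps_compose (fst \<tau>) (fst \<tau>'), pullback \<tau>' (snd \<tau>))"


subsection \<open>The sequence \<open>H\<^sub>k\<close>\<close>

text \<open>
  The component at index \<open>k\<close> of each sequence is the object carrying the index \<open>k\<close>; those other
  than \<open>NN\<close> and \<open>GG\<close> are meaningful for \<open>k \<ge> 1\<close> only, and \<open>GG 0\<close> is \<open>F\<close> itself.
\<close>
record (overloaded) 'k::field tower_data =
  NN :: "nat \<Rightarrow> nat"
  qq :: "nat \<Rightarrow> nat"
  mm :: "nat \<Rightarrow> nat"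
  ss :: "nat \<Rightarrow> int"
  tt :: "nat \<Rightarrow> int"
  PP :: "nat \<Rightarrow> 'k alg_closure poly"
  zz :: "nat \<Rightarrow> 'k alg_closure"
  GG :: "nat \<Rightarrow> 'k alg_closure fps poly"

primrec tower_field :: "'k::field tower_data \<Rightarrow> nat \<Rightarrow> 'k alg_closure set" where
  "tower_field D 0 = range to_ac"
| "tower_field D (Suc k) = {poly p (zz D (Suc k)) | p. poly_over (tower_field D k) p}"

definition tower_c :: "'k::field tower_data \<Rightarrow> nat \<Rightarrow> 'k alg_closure fps" where
  "tower_c D k = - coeff (GG D k) (NN D k - 1) / of_nat (NN D k)"

definition tower_H :: "'k::field tower_data \<Rightarrow> nat \<Rightarrow> 'k alg_closure fps poly" where
  "tower_H D k = pcompose (GG D k) [:tower_c D k, 1:]"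

text \<open>
  The step from \<open>H\<^sub>k\<^sub>-\<^sub>1\<close> to \<open>G\<^sub>k\<close>; the identity defining \<open>G\<^sub>k\<close> is stated in \<open>K[[x]][[y]]\<close>,
  i.e. \<open>V\<close> is a power series in \<open>y\<close> over the power series in \<open>x\<close>.
\<close>
definition tower_step :: "'k::field tower_data \<Rightarrow> nat \<Rightarrow> bool" where
  "tower_step D k \<longleftrightarrow>
     (let L = tower_field D (k - 1); L' = tower_field D k; H = tower_H D (k - 1);
          N = NN D k; q = qq D k; m = mm D k; s = ss D k; t = tt D k;
          P = PP D k; z = zz D k; G = GG D k
      in edge_data L H q m P N \<and>
         poly P z = 0 \<and>
         int q * s - t * int m = 1 \<and> 0 \<le> t \<and> t < int q \<and>
         fps_poly_over L' G \<and> weierstrass G \<and> degree G = N \<and>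
         (\<exists>V :: 'k alg_closure fps fps.
            (\<forall>i j. fps_nth (fps_nth V i) j \<in> L') \<and> V dvd 1 \<and>
            fps_of_poly (pullback (fps_const (z powi t) * fps_X ^ q,
                                   smult (fps_X ^ m) [:fps_const (z powi s), 1:]) H)
              = fps_const (fps_X ^ (q * m * degree P * N)) * fps_of_poly G * V))"

text \<open>\<open>g\<close> is the first index with \<open>N\<^sub>g = 1\<close> or \<open>H\<^sub>g\<close> not degenerated, and \<open>D\<close> is a run up to \<open>g\<close>.\<close>
definition tower :: "'k::field fps poly \<Rightarrow> nat \<Rightarrow> 'k tower_data \<Rightarrow> bool" where
  "tower F g D \<longleftrightarrow>
     NN D 0 = degree F \<and> GG D 0 = poly_ac F \<and>
     (\<forall>k \<in> {1..g}. NN D (k - 1) > 1 \<and> tower_step D k) \<and>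
     (NN D g = 1 \<or> \<not> degenerated (tower_field D g) (tower_H D g))"


subsection \<open>The maps \<open>\<pi>\<^sub>k\<close>, the valuations \<open>v\<^sub>k\<close> and the coefficients \<open>\<lambda>\<^sub>k\<close>\<close>

definition tower_sigma :: "'k::field tower_data \<Rightarrow> nat \<Rightarrow> 'k alg_closure xy_map" where
  "tower_sigma D k =
     (fps_const (zz D k powi tt D k) * fps_X ^ qq D k,
      smult (fps_X ^ mm D k) [:fps_const (zz D k powi ss D k) + tower_c D k, 1:])"

primrec tower_pi :: "'k::field tower_data \<Rightarrow> nat \<Rightarrow> 'k alg_closure xy_map" where
  "tower_pi D 0 = (fps_X, [:tower_c D 0, 1:])"
| "tower_pi D (Suc k) = xy_comp (tower_pi D k) (tower_sigma D (Suc k))"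

definition val_k :: "'k::field tower_data \<Rightarrow> nat \<Rightarrow> 'k fps poly \<Rightarrow> enat" where
  "val_k D k H = v_x_poly (pullback (tower_pi D k) (poly_ac H))"

definition trailing_coeff :: "'a::zero poly \<Rightarrow> 'a" where
  "trailing_coeff p = coeff p (LEAST i. coeff p i \<noteq> 0)"

definition lambda_k :: "'k::field tower_data \<Rightarrow> nat \<Rightarrow> 'k fps poly \<Rightarrow> 'k alg_closure" where
  "lambda_k D k H =
     (if H = 0 then 0
      else trailing_coeff (map_poly (\<lambda>a. fps_nth (fps_shift (the_enat (val_k D k H)) a) 0)
             (pullback (tower_pi D k) (poly_ac H))))"

text \<open>
  As \<open>\<pi>\<^sub>k(x, y) = (\<mu>\<^sub>k x\<^sup>e, \<alpha>\<^sub>k x\<^sup>r y + S\<^sub>k(x))\<close>, the first component of \<open>\<pi>\<^sub>k\<close> is \<open>\<mu>\<^sub>k x\<^sup>e\<close> and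
  the constant term in \<open>y\<close> of the second one is \<open>S\<^sub>k\<close>.
\<close>
definition minimal_poly :: "'k::field tower_data \<Rightarrow> nat \<Rightarrow> 'k fps poly \<Rightarrow> bool" where
  "minimal_poly D k \<phi> \<longleftrightarrow>
     lead_coeff \<phi> = 1 \<and> irreducible \<phi> \<and>
     poly (map_poly (\<lambda>a. fps_compose a (fst (tower_pi D k))) (poly_ac \<phi>))
       (coeff (snd (tower_pi D k)) 0) = 0"


subsection \<open>\<open>\<Phi>\<close>-adic expansions\<close>

text \<open>
  Vectors indexed by \<open>-1, \<dots>, k\<close> are lists of length \<open>k + 2\<close>: position \<open>r\<close> carries the index
  \<open>r - 1\<close>.
\<close>

definition Phi_list :: "(nat \<Rightarrow> 'k::field fps poly) \<Rightarrow> nat \<Rightarrow> 'k fps poly list" where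
  "Phi_list \<phi> k = [:fps_X:] # map \<phi> [0..<k + 1]"

definition V_list :: "'k::field tower_data \<Rightarrow> (nat \<Rightarrow> 'k fps poly) \<Rightarrow> nat \<Rightarrow> enat list" where
  "V_list D \<phi> k = map (val_k D k) (Phi_list \<phi> k)"

definition Lambda_list ::
    "'k::field tower_data \<Rightarrow> (nat \<Rightarrow> 'k fps poly) \<Rightarrow> nat \<Rightarrow> 'k alg_closure list" where
  "Lambda_list D \<phi> k = map (lambda_k D k) (Phi_list \<phi> k)"

definition exponents :: "'k::field tower_data \<Rightarrow> nat \<Rightarrow> nat list set" where
  "exponents D k =
     {B. length B = k + 2 \<and> (\<forall>i \<in> {1..k}. B ! i < qq D i * degree (PP D i))}"

definition scalar :: "nat list \<Rightarrow> enat list \<Rightarrow> enat" where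
  "scalar B V = (\<Sum>r < length B. enat (B ! r) * V ! r)"

definition powi_vec :: "'a::field list \<Rightarrow> int list \<Rightarrow> 'a" where
  "powi_vec L E = (\<Prod>r < length E. (L ! r) powi (E ! r))"

definition diff_vec :: "nat list \<Rightarrow> nat list \<Rightarrow> int list" where
  "diff_vec B C = map2 (\<lambda>b c. int b - int c) B C"

definition exponents_at ::
    "'k::field tower_data \<Rightarrow> (nat \<Rightarrow> 'k fps poly) \<Rightarrow> nat \<Rightarrow> nat \<Rightarrow> enat \<Rightarrow> nat list set" where
  "exponents_at D \<phi> k i w =
     {B \<in> exponents D k. B ! (k + 1) = i \<and> scalar B (V_list D \<phi> k) = w \<and> w \<noteq> \<infinity>}"

text \<open>
  The expansion \<open>F = \<Sum>\<^sub>B f\<^sub>B \<Phi>\<^sup>B\<close> is infinite only in the exponent of \<open>\<phi>\<^sub>-\<^sub>1 = x\<close>: for fixed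
  \<open>C = (b\<^sub>0, \<dots>, b\<^sub>k)\<close> the terms \<open>f\<^sub>B x\<^sup>b\<close> with \<open>B = (b, C)\<close> are collected into a power series, and
  only finitely many \<open>C\<close> occur.
\<close>
definition is_expansion ::
    "'k::field tower_data \<Rightarrow> (nat \<Rightarrow> 'k fps poly) \<Rightarrow> nat \<Rightarrow> 'k fps poly \<Rightarrow> (nat list \<Rightarrow> 'k) \<Rightarrow> bool" where
  "is_expansion D \<phi> k F f \<longleftrightarrow>
     (let \<C> = {tl B | B. B \<in> exponents D k \<and> f B \<noteq> 0}
      in finite \<C> \<and>
         F = (\<Sum>C \<in> \<C>. smult (Abs_fps (\<lambda>b. f (b # C))) (\<Prod>i \<le> k. \<phi> i ^ (C ! i))))"

definition w_exp ::
    "'k::field tower_data \<Rightarrow> (nat \<Rightarrow> 'k fps poly) \<Rightarrow> nat \<Rightarrow> 'k fps poly \<Rightarrow> (nat list \<Rightarrow> 'k) \<Rightarrow> nat \<Rightarrow> ereal"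
  where
  "w_exp D \<phi> k F f i =
     (INF B \<in> {B \<in> exponents D k. B ! (k + 1) = i \<and> f B \<noteq> 0}.
        ereal_of_enat (scalar B (V_list D \<phi> k)))
     - ereal_of_enat (val_k D k F)"

end

theory Submission
  imports Defs
begin

unbundle no vec_syntax

text \<open>
  Let \<open>d\<^sub>k\<close> be the degree of \<open>\<phi>\<^sub>k\<close>. By induction on \<open>k\<close>, the pullback by \<open>\<pi>\<^sub>k\<close> of a nonzero polynomial of
  degree less than \<open>d\<^sub>k\<close> is \<open>x\<^sup>w\<close> times a unit, and that of \<open>\<phi>\<^sub>k\<close> is \<open>x\<^sup>v y\<close> times a unit. Indeed, expand
  in powers of \<open>\<phi>\<^sub>k\<close>; all terms of least valuation after \<open>\<sigma>\<^sub>k\<^sub>+\<^sub>1\<close> lie on one line of slope \<open>-m/q\<close>, and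
  their leading coefficients sum up to a power of \<open>z\<close> times \<open>Q(z)\<close> for a polynomial \<open>Q\<close> over \<open>K\<^sub>k\<close>. If the
  degree is less than \<open>d\<^sub>k\<^sub>+\<^sub>1\<close>, then \<open>deg Q < \<ell>\<close> and \<open>Q(z)\<close> is nonzero because \<open>z\<close> has degree \<open>\<ell>\<close> over
  \<open>K\<^sub>k\<close>; for \<open>\<phi>\<^sub>k\<^sub>+\<^sub>1\<close> itself \<open>Q\<close> is a multiple of the separable polynomial \<open>P\<close>, so \<open>z\<close> is a simple root. That
  \<open>deg \<phi>\<^sub>k\<close> is at most \<open>d\<^sub>k\<close> is a count of generators of \<open>K\<^sub>k[[x]]\<close> over \<open>K[[\<mu>\<^sub>k x\<^sup>e]]\<close>.

  The same argument on \<open>Q(z)\<close> shows that the \<open>\<Lambda>\<^sup>B\<close> with \<open>B\<close> in \<open>\<B>(i, w)\<close> are linearly independent over \<open>K\<close>.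
  Hence the terms with \<open>b\<^sub>k = i\<close> of the expansion of \<open>F\<close> add up, after pullback, to \<open>x\<^sup>w y\<^sup>i\<close> times a unit,
  with constant term the sum of \<open>f\<^sub>B \<Lambda>\<^sup>B\<close>, where \<open>w\<close> is the least weight that occurs. On the other hand the
  pullback of \<open>F\<close> is \<open>x\<^sup>v H\<^sub>k U\<close> with a unit \<open>U\<close>, so the initial forms of both sides agree for every weight
  that supports an edge of the Newton polygon of \<open>H\<^sub>k\<close>. Comparing the coefficients of \<open>y\<close> to the power \<open>N\<^sub>k\<close>
  gives \<open>U(0, 0) = \<Lambda>\<close> to the power \<open>B\<^sub>0\<close>.
\<close>


subsection \<open>Pullbacks\<close>

lemma map_poly_hom_add:
  assumes "h 0 = 0" "\<And>a b. h (a + b) = h a + h b"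
  shows "map_poly h (p + q) = map_poly h p + map_poly h q"
  using assms by (intro poly_eqI) (simp add: coeff_map_poly)

lemma map_poly_hom_sum:
  assumes "h 0 = 0" "\<And>a b. h (a + b) = h a + h b"
  shows "map_poly h (sum f A) = (\<Sum>i\<in>A. map_poly h (f i))"
  by (induction A rule: infinite_finite_induct) (simp_all add: map_poly_hom_add[OF assms])

lemma map_poly_hom_mult:
  fixes h :: "'a::comm_ring_1 \<Rightarrow> 'b::comm_ring_1"
  assumes "h 0 = 0" "\<And>a b. h (a + b) = h a + h b" "\<And>a b. h (a * b) = h a * h b"
  shows "map_poly h (p * q) = map_poly h p * map_poly h q"
proof (induction p)
  case (pCons a p)
  have "map_poly h (smult a q) = smult (h a) (map_poly h q)"
    using assms by (intro poly_eqI) (simp add: coeff_map_poly)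
  then show ?case
    using pCons assms by (simp add: mult_pCons_left map_poly_hom_add map_poly_pCons)
qed simp

lemma pullback_0 [simp]: "pullback \<tau> 0 = 0"
  by (simp add: pullback_def)

lemma pullback_add: "pullback \<tau> (A + B) = pullback \<tau> A + pullback \<tau> B"
  unfolding pullback_def
  by (subst map_poly_hom_add) (auto simp: fps_compose_add_distrib pcompose_add)

lemma pullback_sum: "pullback \<tau> (sum f A) = (\<Sum>i\<in>A. pullback \<tau> (f i))"
  by (induction A rule: infinite_finite_induct) (simp_all add: pullback_add)

lemma pullback_pCons:
  "pullback \<tau> (pCons a A) = [:a oo fst \<tau>:] + snd \<tau> * pullback \<tau> A"
  by (simp add: pullback_def map_poly_pCons pcompose_pCons)

lemma pullback_const [simp]: "pullback \<tau> [:a:] = [:a oo fst \<tau>:]"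
  by (simp add: pullback_pCons)

lemma pullback_1 [simp]: "pullback \<tau> 1 = 1"
  by (simp add: pullback_def pcompose_1)

lemma pullback_mult:
  assumes "fst \<tau> $ 0 = 0"
  shows "pullback \<tau> (A * B) = pullback \<tau> A * pullback \<tau> B"
  unfolding pullback_def using assms
  by (subst map_poly_hom_mult) (auto simp: fps_compose_add_distrib fps_compose_mult_distrib pcompose_mult)

lemma pullback_power:
  assumes "fst \<tau> $ 0 = 0"
  shows "pullback \<tau> (A ^ n) = pullback \<tau> A ^ n"
  by (induction n) (simp_all add: pullback_mult assms)

lemma pullback_smult:
  assumes "fst \<tau> $ 0 = 0"
  shows "pullback \<tau> (smult a A) = smult (a oo fst \<tau>) (pullback \<tau> A)"
  using pullback_mult[OF assms, of "[:a:]" A] by simp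

lemma pullback_comp:
  assumes "fst \<tau> $ 0 = 0" "fst \<rho> $ 0 = 0"
  shows "pullback \<rho> (pullback \<tau> A) = pullback (xy_comp \<tau> \<rho>) A"
proof (induction A)
  case (pCons a A)
  have "a oo fst \<tau> oo fst \<rho> = a oo (fst \<tau> oo fst \<rho>)"
    using assms by (simp add: fps_compose_assoc)
  then show ?case
    using pCons by (simp add: pullback_pCons pullback_add pullback_mult assms xy_comp_def)
qed simp

lemma coeff_pullback_0: "coeff (pullback \<tau> A) 0 =
    poly (map_poly (\<lambda>a. a oo fst \<tau>) A) (coeff (snd \<tau>) 0)"
  by (simp add: pullback_def flip: poly_0_coeff_0 add: poly_pcompose)

lemma fps_compose_monom_nth:
  fixes a :: "'a::field fps"
  assumes "e > 0"
  shows "(a oo (fps_const c * fps_X ^ e)) $ n = (if e dvd n then a $ (n div e) * c ^ (n div e) else 0)"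
proof -
  have *: "((fps_const c * fps_X ^ e) ^ i) $ n = (if n = e * i then c ^ i else 0)" for i
    by (simp add: power_mult_distrib fps_const_power power_mult[symmetric])
  have "(a oo (fps_const c * fps_X ^ e)) $ n = (\<Sum>i\<in>{0..n}. if n = e * i then a $ i * c ^ i else 0)"
    unfolding fps_compose_nth * by (intro sum.cong) auto
  also have "\<dots> = (if e dvd n then a $ (n div e) * c ^ (n div e) else 0)"
  proof (cases "e dvd n")
    case True
    then obtain k where k: "n = e * k" by blast
    have "(\<Sum>i\<in>{0..n}. if n = e * i then a $ i * c ^ i else 0) = (\<Sum>i\<in>{0..n}. if i = k then a $ i * c ^ i else 0)"
      using k assms by (intro sum.cong) auto
    then show ?thesis using k assms by simp
  next
    case False
    then have "n \<noteq> e * i" for i by auto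
    then show ?thesis using False by simp
  qed
  finally show ?thesis .
qed

lemma monom_mult_nth:
  fixes T :: "'a::comm_ring_1 fps poly"
  shows "coeff (monom (fps_X ^ w) i * T) n $ m =
    (if i \<le> n \<and> w \<le> m then coeff T (n - i) $ (m - w) else 0)"
  by (auto simp: coeff_monom_mult fps_X_power_mult_nth)


subsection \<open>Monomials times units\<close>

definition monom_unit :: "'a::comm_ring_1 fps poly \<Rightarrow> nat \<Rightarrow> nat \<Rightarrow> 'a \<Rightarrow> bool" where
  "monom_unit T w i c \<longleftrightarrow> (\<exists>T'. T = monom (fps_X ^ w) i * T' \<and> coeff T' 0 $ 0 = c)"

lemma monom_unit_mult:
  assumes "monom_unit A w i c" "monom_unit B w' i' c'"
  shows "monom_unit (A * B) (w + w') (i + i') (c * c')"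
proof -
  obtain A' B' where "A = monom (fps_X ^ w) i * A'" "coeff A' 0 $ 0 = c"
    "B = monom (fps_X ^ w') i' * B'" "coeff B' 0 $ 0 = c'"
    using assms unfolding monom_unit_def by blast
  then show ?thesis
    unfolding monom_unit_def
    by (intro exI[of _ "A' * B'"]) (auto simp: coeff_mult_0 power_add mult_monom[symmetric] mult_ac)
qed

lemma monom_unit_1: "monom_unit 1 0 0 1"
  unfolding monom_unit_def by (intro exI[of _ 1]) simp

lemma monom_unit_power: "monom_unit A w i c \<Longrightarrow> monom_unit (A ^ n) (n * w) (n * i) (c ^ n)"
proof (induction n)
  case 0
  show ?case using monom_unit_1 by simp
next
  case (Suc n)
  from monom_unit_mult[OF Suc.prems Suc.IH[OF Suc.prems]] show ?case by simp
qed

lemma monom_unit_prod: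
  assumes "finite S" "\<And>j. j \<in> S \<Longrightarrow> monom_unit (A j) (w j) (i j) (c j)"
  shows "monom_unit (\<Prod>j\<in>S. A j) (\<Sum>j\<in>S. w j) (\<Sum>j\<in>S. i j) (\<Prod>j\<in>S. c j)"
  using assms by (induction S) (auto intro: monom_unit_1 monom_unit_mult)

text \<open>A term with \<open>w j > W\<close> keeps a factor x^(w j - W), so it adds nothing to the
  constant term of the common cofactor. The remaining \<open>c j\<close> may cancel.\<close>

lemma monom_unit_sum:
  fixes A :: "'j \<Rightarrow> 'a::comm_ring_1 fps poly"
  assumes "finite S" "\<And>j. j \<in> S \<Longrightarrow> monom_unit (A j) (w j) i (c j)" "\<And>j. j \<in> S \<Longrightarrow> W \<le> w j"
  shows "monom_unit (\<Sum>j\<in>S. A j) W i (\<Sum>j | j \<in> S \<and> w j = W. c j)"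
proof -
  have "\<exists>T. A j = monom (fps_X ^ W) i * T \<and> coeff T 0 $ 0 = (if w j = W then c j else 0)"
    if j: "j \<in> S" for j
  proof -
    obtain T where T: "A j = monom (fps_X ^ w j) i * T" "coeff T 0 $ 0 = c j"
      using assms(2)[OF j] unfolding monom_unit_def by blast
    have "monom (fps_X ^ w j) i = monom (fps_X ^ W :: 'a fps) i * [:fps_X ^ (w j - W):]"
      using assms(3)[OF j] by (simp add: smult_monom power_add[symmetric])
    with T show ?thesis
      by (intro exI[of _ "[:fps_X ^ (w j - W):] * T"]) (use assms(3)[OF j] in \<open>auto simp: mult.assoc\<close>)
  qed
  then obtain T where T: "\<And>j. j \<in> S \<Longrightarrow> A j = monom (fps_X ^ W) i * T j"
    "\<And>j. j \<in> S \<Longrightarrow> coeff (T j) 0 $ 0 = (if w j = W then c j else 0)" by metis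
  show ?thesis
    unfolding monom_unit_def
  proof (intro exI conjI)
    show "(\<Sum>j\<in>S. A j) = monom (fps_X ^ W) i * (\<Sum>j\<in>S. T j)"
      using T by (simp add: sum_distrib_left)
    show "coeff (\<Sum>j\<in>S. T j) 0 $ 0 = (\<Sum>j | j \<in> S \<and> w j = W. c j)"
      using T assms(1) by (simp add: coeff_sum fps_sum_nth sum.If_cases Int_def)
  qed
qed

lemma monom_unit_nonzero:
  fixes T :: "'a::idom fps poly"
  assumes "monom_unit T w i c" "c \<noteq> 0"
  shows "T \<noteq> 0"
  using assms unfolding monom_unit_def by auto

lemma monom_unit_nth:
  assumes "monom_unit T w i c"
  shows "coeff T n $ m \<noteq> 0 \<Longrightarrow> i \<le> n \<and> w \<le> m" "coeff T i $ w = c"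
  using assms unfolding monom_unit_def by (auto simp: monom_mult_nth split: if_splits)

section \<open>Valuation and trailing coefficient of a monomial times a unit\<close>

lemma v_x_poly_eqI:
  fixes T :: "'a::field fps poly"
  assumes "T = smult (fps_X ^ w) T'" "coeff T' i $ 0 \<noteq> 0"
  shows "v_x_poly T = enat w"
proof (rule antisym)
  have "subdegree (coeff T' i) = 0" "coeff T' i \<noteq> 0"
    using assms(2) by (auto simp: subdegree_eq_0_iff)
  then have "v_x (coeff T i) = enat w"
    using assms(1) by (auto simp: v_x_def)
  then show "v_x_poly T \<le> enat w"
    unfolding v_x_poly_def by (metis INF_lower UNIV_I)
  show "enat w \<le> v_x_poly T"
    unfolding v_x_poly_def v_x_def using assms(1)
    by (intro INF_greatest) (auto simp: fps_subdegree_mult_fps_X_power(1))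
qed

lemma monom_unit_v_x_poly:
  assumes "monom_unit T w i (c :: 'a::field)" "c \<noteq> 0"
  shows "v_x_poly T = enat w"
proof -
  obtain T' where T: "T = monom (fps_X ^ w) i * T'" "coeff T' 0 $ 0 = c"
    using assms unfolding monom_unit_def by blast
  have "T = smult (fps_X ^ w) (monom 1 i * T')"
    using T(1) by (simp add: smult_monom flip: mult_smult_left)
  then show ?thesis
    by (rule v_x_poly_eqI[where i = i]) (use T assms in \<open>simp add: coeff_monom_mult\<close>)
qed

text \<open>After division by x^w, setting x = 0 leaves y^i times a polynomial with constant term
  c.\<close>

lemma monom_unit_trailing_coeff:
  assumes "monom_unit T w i (c :: 'a::field)" "c \<noteq> 0"
  shows "trailing_coeff (map_poly (\<lambda>a. fps_shift w a $ 0) T) = c"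
proof -
  obtain T' where T: "T = monom (fps_X ^ w) i * T'" "coeff T' 0 $ 0 = c"
    using assms unfolding monom_unit_def by blast
  have c: "coeff (map_poly (\<lambda>a. fps_shift w a $ 0) T) n = (if i \<le> n then coeff T' (n - i) $ 0 else 0)" for n
    by (simp add: coeff_map_poly T monom_mult_nth)
  have "(LEAST n. coeff (map_poly (\<lambda>a. fps_shift w a $ 0) T) n \<noteq> 0) = i"
    by (rule Least_equality) (use c T assms in \<open>auto split: if_splits\<close>)
  then show ?thesis unfolding trailing_coeff_def using c T(2) by simp
qed

text \<open>The map \<sigma> moves the root z^s of an edge polynomial to y = 0. After such a
  pullback \<open>c0\<close> tells whether the edge polynomial vanishes at the root, and
  \<open>c1\<close> whether the root is simple.\<close>

definition low_coeffs :: "'a::comm_ring_1 fps poly \<Rightarrow> nat \<Rightarrow> 'a \<Rightarrow> 'a \<Rightarrow> bool" where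
  "low_coeffs T w c0 c1 \<longleftrightarrow>
     (\<exists>T'. T = smult (fps_X ^ w) T' \<and> coeff T' 0 $ 0 = c0 \<and> coeff T' 1 $ 0 = c1)"

lemma low_coeffs_sum:
  assumes "finite S" "\<And>j. j \<in> S \<Longrightarrow> low_coeffs (A j) (w j) (c j) (c' j)" "\<And>j. j \<in> S \<Longrightarrow> W \<le> w j"
  shows "low_coeffs (\<Sum>j\<in>S. A j) W (\<Sum>j | j \<in> S \<and> w j = W. c j) (\<Sum>j | j \<in> S \<and> w j = W. c' j)"
proof -
  have "\<exists>T. A j = smult (fps_X ^ W) T \<and> coeff T 0 $ 0 = (if w j = W then c j else 0)
      \<and> coeff T 1 $ 0 = (if w j = W then c' j else 0)"
    if j: "j \<in> S" for j
  proof -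
    obtain T where T: "A j = smult (fps_X ^ w j) T" "coeff T 0 $ 0 = c j" "coeff T 1 $ 0 = c' j"
      using assms(2)[OF j] unfolding low_coeffs_def by blast
    show ?thesis
      by (intro exI[of _ "smult (fps_X ^ (w j - W)) T"])
         (use assms(3)[OF j] T in \<open>auto simp flip: power_add\<close>)
  qed
  then obtain T where T: "\<And>j. j \<in> S \<Longrightarrow> A j = smult (fps_X ^ W) (T j)"
    "\<And>j. j \<in> S \<Longrightarrow> coeff (T j) 0 $ 0 = (if w j = W then c j else 0)"
    "\<And>j. j \<in> S \<Longrightarrow> coeff (T j) 1 $ 0 = (if w j = W then c' j else 0)" by metis
  show ?thesis
    unfolding low_coeffs_def
  proof (intro exI conjI)
    show "(\<Sum>j\<in>S. A j) = smult (fps_X ^ W) (\<Sum>j\<in>S. T j)"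
      using T by (intro poly_eqI) (simp add: coeff_sum sum_distrib_left)
  qed (use T assms(1) in \<open>simp_all add: coeff_sum fps_sum_nth sum.If_cases Int_def\<close>)
qed

lemma coeff_mult_Suc_0:
  "coeff (A * B) (Suc 0) = coeff A 0 * coeff B (Suc 0) + coeff A (Suc 0) * coeff B 0"
  by (simp add: coeff_mult)

lemma low_coeffs_linear_power:
  fixes a :: "'a::idom fps"
  shows "coeff ([:a, 1:] ^ i) 0 $ 0 = (a $ 0) ^ i"
    "coeff ([:a, 1:] ^ i) (Suc 0) $ 0 = of_nat i * (a $ 0) ^ (i - 1)"
proof -
  show 1: "coeff ([:a, 1:] ^ i) 0 $ 0 = (a $ 0) ^ i" for i
    by (induction i) (simp_all add: coeff_mult_0)
  show "coeff ([:a, 1:] ^ i) (Suc 0) $ 0 = of_nat i * (a $ 0) ^ (i - 1)"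
  proof (induction i)
    case (Suc i)
    have "a $ 0 * (of_nat i * (a $ 0) ^ (i - 1)) = of_nat i * (a $ 0) ^ i"
      by (cases i) (auto simp: algebra_simps)
    then show ?case
      using Suc by (simp add: coeff_mult_Suc_0 1[unfolded coeff_0] algebra_simps 1)
  qed simp
qed

text \<open>The monomial x^w y^i becomes u^w x^(q w + m i) (y + b)^i. As q and m are positive, the
  cofactor of T is pulled back to c plus multiples of x, so modulo x only the value and the
  derivative of (y + b(0))^i at y = 0 enter.\<close>

lemma low_coeffs_pullback:
  fixes T :: "'a::field fps poly" and b :: "'a fps" and u :: 'a
  assumes "monom_unit T w i c" "q > 0" "m > 0"
  defines "\<sigma> \<equiv> (fps_const u * fps_X ^ q, smult (fps_X ^ m) [:b, 1:])"
  shows "low_coeffs (pullback \<sigma> T) (q * w + m * i) (c * u ^ w * (b $ 0) ^ i)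
     (c * u ^ w * (of_nat i * (b $ 0) ^ (i - 1)))"
proof -
  obtain T' where T: "T = monom (fps_X ^ w) i * T'" "coeff T' 0 $ 0 = c"
    using assms(1) unfolding monom_unit_def by blast
  have s0: "fst \<sigma> $ 0 = 0" using \<open>q > 0\<close> by (simp add: \<sigma>_def)
  have m: "monom (fps_X ^ w) i = [:fps_X ^ w:] * [:0, 1:] ^ i"
    by (simp add: monom_altdef)
  have "fps_X ^ w oo fst \<sigma> = (fps_const u * fps_X ^ q) ^ w"
    by (subst fps_compose_power[OF s0, symmetric], subst fps_X_fps_compose_startby0[OF s0])
       (simp add: \<sigma>_def)
  then have X: "fps_X ^ w oo fst \<sigma> = fps_const (u ^ w) * fps_X ^ (q * w)"
    by (simp add: power_mult_distrib power_mult)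
  have snd_\<sigma>: "snd \<sigma> = smult (fps_X ^ m) [:b, 1:]" by (simp add: \<sigma>_def)
  have Y: "pullback \<sigma> [:0, 1:] = smult (fps_X ^ m) [:b, 1:]"
    by (simp add: pullback_pCons \<sigma>_def)
  define S where "S = pullback \<sigma> T'"
  obtain a T1 where aT: "T' = pCons a T1" by (cases T') 
  have "S = [:a oo fst \<sigma>:] + smult (fps_X ^ m) ([:b, 1:] * pullback \<sigma> T1)"
    unfolding S_def aT pullback_pCons snd_\<sigma> mult_smult_left ..
  moreover have "a $ 0 = c" using T(2) aT by simp
  ultimately have S: "coeff S 0 $ 0 = c" "coeff S (Suc 0) $ 0 = 0"
    using \<open>m > 0\<close> by (simp_all del: coeff_smult mult_pCons_left add: coeff_smult[abs_def])
  have pT: "pullback \<sigma> T = smult (fps_X ^ (q * w + m * i)) (smult (fps_const (u ^ w)) ([:b, 1:] ^ i * S))"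
  proof -
    have "pullback \<sigma> T = [:fps_X ^ w oo fst \<sigma>:] * pullback \<sigma> [:0, 1:] ^ i * S"
      unfolding T(1) m S_def pullback_mult[OF s0] pullback_power[OF s0] pullback_const ..
    also have "pullback \<sigma> [:0, 1:] ^ i = smult (fps_X ^ (m * i)) ([:b, 1:] ^ i)"
      unfolding Y smult_power[symmetric] power_mult ..
    finally show ?thesis
      unfolding X by (simp add: power_add mult_ac)
  qed
  show ?thesis
    unfolding low_coeffs_def
  proof (intro exI conjI)
    show "pullback \<sigma> T = smult (fps_X ^ (q * w + m * i)) (smult (fps_const (u ^ w)) ([:b, 1:] ^ i * S))"
      by (fact pT)
  qed (simp_all add: coeff_mult_0 coeff_mult_Suc_0 low_coeffs_linear_power S mult_ac)
qed

lemma low_coeffs_0_monom_unit: "low_coeffs T w c c' \<Longrightarrow> monom_unit T w 0 c"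
  unfolding low_coeffs_def monom_unit_def by (auto simp: monom_0)

text \<open>A vanishing constant coefficient in y lets a factor y be split off, and the next
  coefficient becomes the leading one.\<close>

lemma low_coeffs_1_monom_unit:
  fixes T :: "'a::field fps poly"
  assumes "low_coeffs T w c c'" "coeff T 0 = 0"
  shows "monom_unit T w 1 c'"
proof -
  obtain T' where T: "T = smult (fps_X ^ w) T'" "coeff T' 1 $ 0 = c'"
    using assms unfolding low_coeffs_def by blast
  then have "coeff T' 0 = 0" using assms(2) by simp
  then obtain T1 where T1: "T' = pCons 0 T1" by (cases T') auto
  have "monom (fps_X ^ w) 1 * T1 = T"
    unfolding T T1 by (intro poly_eqI) (auto simp: coeff_monom_mult coeff_pCons split: nat.splits)
  then show ?thesis using T(2) T1 unfolding monom_unit_def by (intro exI[of _ T1]) auto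
qed


subsection \<open>Intermediate fields of the algebraic closure\<close>

text \<open>Inverses come for free, because every element is algebraic over the ground field; see
  \<open>ac_subfield_inverse\<close>.\<close>

definition ac_subfield :: "'k::field alg_closure set \<Rightarrow> bool" where
  "ac_subfield L \<longleftrightarrow> range to_ac \<subseteq> L \<and> (\<forall>x\<in>L. \<forall>y\<in>L. x + y \<in> L \<and> x * y \<in> L)"

lemma
  assumes "ac_subfield L"
  shows ac_subfield_to_ac: "to_ac a \<in> L"
    and ac_subfield_add: "x \<in> L \<Longrightarrow> y \<in> L \<Longrightarrow> x + y \<in> L"
    and ac_subfield_mult: "x \<in> L \<Longrightarrow> y \<in> L \<Longrightarrow> x * y \<in> L"
  using assms by (auto simp: ac_subfield_def)

lemma
  assumes "ac_subfield L"
  shows ac_subfield_0: "0 \<in> L" and ac_subfield_1: "1 \<in> L"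
    and ac_subfield_of_nat: "of_nat n \<in> L"
    and ac_subfield_uminus: "x \<in> L \<Longrightarrow> - x \<in> L"
proof -
  show "0 \<in> L" "1 \<in> L" "of_nat n \<in> L"
    using ac_subfield_to_ac[OF assms, of 0] ac_subfield_to_ac[OF assms, of 1]
      ac_subfield_to_ac[OF assms, of "of_nat n"] by simp_all
  show "- x \<in> L" if "x \<in> L"
    using ac_subfield_mult[OF assms ac_subfield_to_ac[OF assms, of "-1"] that] by simp
qed

lemma ac_subfield_sum:
  assumes "ac_subfield L" "\<And>i. i \<in> A \<Longrightarrow> f i \<in> L"
  shows "sum f A \<in> L"
  using assms(2) by (induction A rule: infinite_finite_induct)
    (auto intro: ac_subfield_0 ac_subfield_add assms(1))

lemma ac_subfield_power:
  assumes "ac_subfield L" "x \<in> L"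
  shows "x ^ n \<in> L"
  by (induction n) (auto intro: ac_subfield_1 ac_subfield_mult assms)

lemma ac_subfield_poly:
  assumes "ac_subfield L" "poly_over L p" "x \<in> L"
  shows "poly p x \<in> L"
  unfolding poly_altdef using assms
  by (intro ac_subfield_sum ac_subfield_mult ac_subfield_power) (auto simp: poly_over_def)

text \<open>Let p over the ground field vanish at x. Once powers of the variable are cancelled, its
  constant coefficient a is nonzero, and a + x p'(x) = 0, with p' the remaining part of p, displays
  the inverse of x as a polynomial in x.\<close>

lemma ac_subfield_inverse:
  assumes L: "ac_subfield L" and x: "x \<in> L"
  shows "inverse x \<in> L"
proof (cases "x = 0")
  case True
  then show ?thesis using x by simp
next
  case False
  obtain p where p: "p \<noteq> 0" "poly (map_poly to_ac p) x = 0"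
    by (rule alg_closure_algebraic)
  then show ?thesis
  proof (induction p)
    case (pCons a p)
    have p: "to_ac a + x * poly (map_poly to_ac p) x = 0"
      using pCons.prems by (simp add: map_poly_pCons)
    show ?case
    proof (cases "a = 0")
      case True
      then show ?thesis using p pCons False by auto
    next
      case a: False
      have "x * (- poly (map_poly to_ac p) x * to_ac (inverse a)) = 1"
        using p a False by (simp add: field_simps add_eq_0_iff)
      then have "inverse x = - poly (map_poly to_ac p) x * to_ac (inverse a)"
        by (rule inverse_unique)
      moreover have "poly_over L (map_poly to_ac p)"
        unfolding poly_over_def by (simp add: coeff_map_poly ac_subfield_to_ac[OF L])
      ultimately show ?thesis
        using L x by (auto intro!: ac_subfield_mult ac_subfield_uminus ac_subfield_poly ac_subfield_to_ac
            simp del: mult_minus_left to_ac_inverse)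
    qed
  qed simp
qed

lemma ac_subfield_powi:
  assumes "ac_subfield L" "x \<in> L"
  shows "x powi n \<in> L"
  unfolding power_int_def using assms by (auto intro: ac_subfield_power ac_subfield_inverse)

lemma
  assumes L: "ac_subfield L"
  shows poly_over_0: "poly_over L 0"
    and poly_over_add: "poly_over L p \<Longrightarrow> poly_over L p' \<Longrightarrow> poly_over L (p + p')"
    and poly_over_uminus: "poly_over L p \<Longrightarrow> poly_over L (- p)"
    and poly_over_mult: "poly_over L p \<Longrightarrow> poly_over L p' \<Longrightarrow> poly_over L (p * p')"
    and poly_over_monom: "c \<in> L \<Longrightarrow> poly_over L (monom c n)"
  using L unfolding poly_over_def
  by (auto simp: coeff_mult intro: ac_subfield_0 ac_subfield_add ac_subfield_uminus ac_subfield_mult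
      intro!: ac_subfield_sum)

lemma poly_over_diff:
  assumes "ac_subfield L" "poly_over L p" "poly_over L p'"
  shows "poly_over L (p - p')"
  using poly_over_add[OF assms(1,2) poly_over_uminus[OF assms(1,3)]] by simp

lemma ac_subfield_base: "ac_subfield (range to_ac)"
  unfolding ac_subfield_def by (auto simp flip: to_ac_add to_ac_mult)

lemma ac_subfield_adjoin:
  assumes "ac_subfield L"
  shows "ac_subfield {poly p z | p. poly_over L p}"
  unfolding ac_subfield_def
proof (intro conjI ballI subsetI)
  fix x :: "'a alg_closure" assume "x \<in> range to_ac"
  then show "x \<in> {poly p z | p. poly_over L p}"
    using assms by (auto intro!: exI[of _ "[:x:]"] simp: poly_over_def coeff_pCons
        intro: ac_subfield_to_ac ac_subfield_0 split: nat.splits)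
next
  fix x y assume "x \<in> {poly p z | p. poly_over L p}" "y \<in> {poly p z | p. poly_over L p}"
  then show "x + y \<in> {poly p z | p. poly_over L p}" "x * y \<in> {poly p z | p. poly_over L p}"
    using assms by (auto intro: poly_over_add poly_over_mult simp flip: poly_add poly_mult)
qed

lemma ac_subfield_tower_field: "ac_subfield (tower_field D k)"
  by (induction k) (simp_all add: ac_subfield_base ac_subfield_adjoin)

lemma tower_field_mono:
  "x \<in> tower_field D k \<Longrightarrow> x \<in> tower_field D (Suc k)"
  using ac_subfield_0[OF ac_subfield_tower_field, of D k]
  by (auto intro!: exI[of _ "[:x:]"] simp: poly_over_def coeff_pCons split: nat.splits)

lemma tower_field_zz: "zz D (Suc k) \<in> tower_field D (Suc k)"
  using ac_subfield_0[OF ac_subfield_tower_field, of D k] ac_subfield_1[OF ac_subfield_tower_field, of D k]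
  by (auto intro!: exI[of _ "[:0, 1:]"] simp: poly_over_def coeff_pCons split: nat.splits)

text \<open>Long division, carried out step by step so that quotient and remainder are seen to stay
  over L.\<close>

lemma poly_over_division:
  assumes L: "ac_subfield L" and A: "poly_over L A" and B: "poly_over L B" and nz: "B \<noteq> 0"
  shows "\<exists>Q R. poly_over L Q \<and> poly_over L R \<and> A = B * Q + R \<and> (R = 0 \<or> degree R < degree B)"
proof -
  have "A = 0 \<or> degree A < n \<Longrightarrow> poly_over L A \<Longrightarrow>
    \<exists>Q R. poly_over L Q \<and> poly_over L R \<and> A = B * Q + R \<and> (R = 0 \<or> degree R < degree B)" for n A
  proof (induction n arbitrary: A)
    case 0
    then show ?case using poly_over_0[OF L] by (intro exI[of _ 0]) auto
  next
    case (Suc n)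
    show ?case
    proof (cases "A = 0 \<or> degree A < degree B")
      case True
      then show ?thesis using poly_over_0[OF L] Suc.prems by (intro exI[of _ 0] exI[of _ A]) auto
    next
      case False
      define M where "M = monom (lead_coeff A * inverse (lead_coeff B)) (degree A - degree B)"
      define A' where "A' = A - B * M"
      have M: "poly_over L M"
        unfolding M_def using Suc.prems B L
        by (intro poly_over_monom ac_subfield_mult ac_subfield_inverse) (auto simp: poly_over_def)
      have A': "poly_over L A'"
        unfolding A'_def using Suc.prems B L M by (intro poly_over_diff poly_over_mult)
      have M0: "M \<noteq> 0" "degree M = degree A - degree B"
        using False nz by (simp_all add: M_def degree_monom_eq)
      have dBM: "degree (B * M) = degree A"
        using M0 nz False by (simp add: degree_mult_eq)
      have "lead_coeff (B * M) = lead_coeff A"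
        unfolding lead_coeff_mult using nz M0 by (simp add: M_def)
      then have "coeff A' (degree A) = 0"
        unfolding A'_def using dBM by simp
      moreover have "degree A' \<le> degree A"
        unfolding A'_def using dBM by (intro degree_diff_le) auto
      ultimately have "A' = 0 \<or> degree A' < degree A"
        by (metis le_neq_implies_less leading_coeff_0_iff)
      then have "A' = 0 \<or> degree A' < n"
        using Suc.prems False by auto
      from Suc.IH[OF this A'] obtain Q R where QR: "poly_over L Q" "poly_over L R" "A' = B * Q + R"
        "R = 0 \<or> degree R < degree B" by blast
      then have "A = B * (M + Q) + R" by (simp add: A'_def algebra_simps)
      then show ?thesis using QR M L by (blast intro: poly_over_add)
    qed
  qed
  then show ?thesis using A by blast
qed

text \<open>A nonzero polynomial B over L of least degree with root z divides P. It is not constant,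
  so irreducibility makes the cofactor constant, and no such B can have degree below that of
  P.\<close>

lemma irreducible_over_root_minimal:
  assumes L: "ac_subfield L" and irr: "irreducible_over L P" and root: "poly P z = 0"
    and p: "poly_over L p" "p \<noteq> 0" "degree p < degree P"
  shows "poly p z \<noteq> 0"
proof
  assume "poly p z = 0"
  define S where "S = {p. poly_over L p \<and> p \<noteq> 0 \<and> poly p z = 0}"
  define B where "B = arg_min degree (\<lambda>p. p \<in> S)"
  have "p \<in> S" using p \<open>poly p z = 0\<close> by (simp add: S_def)
  then have B: "B \<in> S" and min: "\<And>p. p \<in> S \<Longrightarrow> degree B \<le> degree p"
    unfolding B_def by (auto intro: arg_min_natI arg_min_nat_le)
  have P: "poly_over L P" using irr by (simp add: irreducible_over_def)
  obtain Q R where QR: "poly_over L Q" "poly_over L R" "P = B * Q + R" "R = 0 \<or> degree R < degree B"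
    using poly_over_division[OF L P, of B] B by (auto simp: S_def)
  have "poly R z = 0" using QR(3) root B by (auto simp: S_def)
  then have "R = 0" using QR min[of R] by (force simp: S_def)
  then have "degree B = 0 \<or> degree Q = 0"
    using irr QR B unfolding irreducible_over_def S_def by auto
  moreover have "degree B \<noteq> 0"
  proof
    assume "degree B = 0"
    then obtain c where "B = [:c:]" by (rule degree_eq_zeroE)
    then show False using B by (auto simp: S_def)
  qed
  moreover have "degree P \<le> degree B" if "degree Q = 0"
    using QR(3) \<open>R = 0\<close> that by (metis add.right_neutral degree_mult_le)
  moreover have "degree B \<le> degree p" using min \<open>p \<in> S\<close> by blast
  ultimately show False using p by linarith
qed

text \<open>
  All monomials \<open>x\<^sup>\<omega> y\<^sup>b\<close> on one line of slope \<open>-m/q\<close> become powers of \<open>z\<close> under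
  \<open>(x, y) \<mapsto> (z\<^sup>t, z\<^sup>s)\<close>, with consecutive exponents.
\<close>
lemma edge_sum:
  fixes z :: "'k::field alg_closure" and \<kappa> :: "nat \<Rightarrow> 'k alg_closure" and q m W :: nat
  assumes L: "ac_subfield L" and z: "z \<noteq> 0" and q: "q > 0" and bez: "int q * s - t * int m = 1"
    and I: "finite I" "I \<noteq> {}" "\<And>b. b \<in> I \<Longrightarrow> q * \<omega> b + m * b = W" "\<And>b. b \<in> I \<Longrightarrow> \<kappa> b \<in> L"
  obtains Q K0 b0 where "poly_over L Q"
    "(\<Sum>b\<in>I. \<kappa> b * z powi (t * int (\<omega> b) + s * int b)) = z powi K0 * poly Q z"
    "(\<Sum>b\<in>I. \<kappa> b * of_nat b * z powi (t * int (\<omega> b) + s * int b)) =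
       z powi K0 * (of_nat b0 * poly Q z + of_nat q * z * poly (pderiv Q) z)"
    "Q = 0 \<longleftrightarrow> (\<forall>b\<in>I. \<kappa> b = 0)"
    "\<And>j. coeff Q j \<noteq> 0 \<Longrightarrow> \<exists>b\<in>I. q * j \<le> b"
proof -
  define b0 where "b0 = Min I"
  define a where "a = (\<lambda>b. (b - b0) div q)"
  define K0 where "K0 = t * int (\<omega> b0) + s * int b0"
  define Q where "Q = (\<Sum>b\<in>I. monom (\<kappa> b) (a b))"
  have b0: "b0 \<in> I" "\<And>b. b \<in> I \<Longrightarrow> b0 \<le> b" using I by (auto simp: b0_def)
  have cop: "coprime (int q) (int m)"
  proof (rule coprimeI)
    fix c assume "c dvd int q" "c dvd int m"
    then have "c dvd int q * s - t * int m" by (intro dvd_diff dvd_mult dvd_mult2)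
    then show "is_unit c" using bez by simp
  qed
  \<comment> \<open>Two points on the line satisfy q (\<omega> b0 - \<omega> b) = m (b - b0). As q
    and m are coprime, b - b0 is a multiple q a of q, and \<omega> drops by m a.\<close>
  have a: "b = b0 + q * a b" and \<omega>: "int (\<omega> b) = int (\<omega> b0) - int m * int (a b)" if b: "b \<in> I" for b
  proof -
    have "int q * int (\<omega> b) + int m * int b = int q * int (\<omega> b0) + int m * int b0"
      using I(3)[OF b] I(3)[OF b0(1)] by (simp flip: of_nat_mult of_nat_add)
    then have eq: "int m * (int b - int b0) = int q * (int (\<omega> b0) - int (\<omega> b))" by (simp add: algebra_simps)
    then have "int q dvd int m * (int b - int b0)" by simp
    then have "int q dvd int (b - b0)" using cop b0(2)[OF b] by (simp add: coprime_dvd_mult_right_iff of_nat_diff)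
    then have "q dvd b - b0" by simp
    then show *: "b = b0 + q * a b" using b0(2)[OF b] by (simp add: a_def)
    have "int b - int b0 = int q * int (a b)" using * by (metis add_diff_cancel_left' of_nat_add of_nat_mult)
    then have "int q * (int m * int (a b)) = int q * (int (\<omega> b0) - int (\<omega> b))" using eq by (simp add: algebra_simps)
    then show "int (\<omega> b) = int (\<omega> b0) - int m * int (a b)" using q by simp
  qed
  \<comment> \<open>Passing from b0 to b changes the exponent by a (q s - t m), which is a by the
    Bezout identity.\<close>
  have ex: "z powi (t * int (\<omega> b) + s * int b) = z powi K0 * z ^ a b" if "b \<in> I" for b
  proof -
    have "t * int (\<omega> b) + s * int b = K0 + int (a b) * (int q * s - t * int m)"
      unfolding \<omega>[OF that] using arg_cong[OF a[OF that], of int] by (simp add: K0_def algebra_simps)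
    then show ?thesis using z bez by (simp add: power_int_add)
  qed
  have cQ: "coeff Q (a b) = \<kappa> b" if "b \<in> I" for b
  proof -
    have "a b' = a b \<longleftrightarrow> b' = b" if "b' \<in> I" for b'
      using a[OF that] a[OF \<open>b \<in> I\<close>] by metis
    then have "coeff Q (a b) = (\<Sum>b'\<in>I. if b' = b then \<kappa> b' else 0)"
      unfolding Q_def coeff_sum by (intro sum.cong) auto
    then show ?thesis using that I(1) by simp
  qed
  show ?thesis
  proof
    show "poly_over L Q"
      unfolding poly_over_def Q_def coeff_sum using L I(4)
      by (auto intro!: ac_subfield_sum intro: ac_subfield_0)
    show "(\<Sum>b\<in>I. \<kappa> b * z powi (t * int (\<omega> b) + s * int b)) = z powi K0 * poly Q z"
      by (simp add: Q_def poly_sum poly_monom sum_distrib_left ex mult_ac)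
    have "z * poly (pderiv Q) z = (\<Sum>b\<in>I. of_nat (a b) * \<kappa> b * z ^ a b)"
    proof -
      have "pderiv Q = (\<Sum>b\<in>I. pderiv (monom (\<kappa> b) (a b)))"
        unfolding Q_def by (induction I rule: infinite_finite_induct) (simp_all add: pderiv_add)
      moreover have "z * poly (pderiv (monom (\<kappa> b) (a b))) z = of_nat (a b) * \<kappa> b * z ^ a b" for b
        by (cases "a b") (simp_all add: pderiv_monom poly_monom mult_ac)
      ultimately show ?thesis by (simp add: poly_sum sum_distrib_left)
    qed
    moreover have "poly Q z = (\<Sum>b\<in>I. \<kappa> b * z ^ a b)"
      by (simp add: Q_def poly_sum poly_monom)
    \<comment> \<open>Writing the factor b as b0 + q a splits the sum into a multiple of Q(z) and a
      multiple of z Q'(z).\<close>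
    moreover have "(\<Sum>b\<in>I. \<kappa> b * of_nat b * z powi (t * int (\<omega> b) + s * int b)) =
       (\<Sum>b\<in>I. z powi K0 * (of_nat b0 * (\<kappa> b * z ^ a b) + of_nat q * (of_nat (a b) * \<kappa> b * z ^ a b)))"
    proof (intro sum.cong refl)
      fix b assume b: "b \<in> I"
      have "of_nat b = (of_nat b0 + of_nat q * of_nat (a b) :: 'k alg_closure)"
        using arg_cong[OF a[OF b], of of_nat] by simp
      then show "\<kappa> b * of_nat b * z powi (t * int (\<omega> b) + s * int b) =
          z powi K0 * (of_nat b0 * (\<kappa> b * z ^ a b) + of_nat q * (of_nat (a b) * \<kappa> b * z ^ a b))"
        unfolding ex[OF b] by (simp add: algebra_simps)
    qed
    ultimately show "(\<Sum>b\<in>I. \<kappa> b * of_nat b * z powi (t * int (\<omega> b) + s * int b)) =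
       z powi K0 * (of_nat b0 * poly Q z + of_nat q * z * poly (pderiv Q) z)"
      by (simp add: mult.assoc sum.distrib flip: sum_distrib_left)
    show "Q = 0 \<longleftrightarrow> (\<forall>b\<in>I. \<kappa> b = 0)"
      using cQ by (auto simp: Q_def)
    show "\<exists>b\<in>I. q * j \<le> b" if "coeff Q j \<noteq> 0" for j
    proof -
      have "(\<Sum>b\<in>I. if a b = j then \<kappa> b else 0) \<noteq> 0"
        using that by (simp add: Q_def coeff_sum)
      then obtain b where b: "b \<in> I" "a b = j"
        by (rule sum.not_neutral_contains_not_neutral) (auto split: if_splits)
      have "q * j \<le> b" using a[OF b(1), unfolded b(2)] by linarith
      then show ?thesis using b(1) by blast
    qed
  qed
qed

text \<open>The bound b < q deg P forces deg Q < deg P for the polynomial Q of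
  \<open>edge_sum\<close>. Since Q(z) = 0, Q vanishes, and the \<open>\<kappa> b\<close> are its
  coefficients.\<close>

lemma edge_sum_eq_0:
  fixes z :: "'k::field alg_closure" and \<kappa> :: "nat \<Rightarrow> 'k alg_closure" and q m W :: nat
  assumes L: "ac_subfield L" and irr: "irreducible_over L P" and root: "poly P z = 0"
    and z: "z \<noteq> 0" and q: "q > 0" and bez: "int q * s - t * int m = 1"
    and I: "finite I" "\<And>b. b \<in> I \<Longrightarrow> q * \<omega> b + m * b = W" "\<And>b. b \<in> I \<Longrightarrow> \<kappa> b \<in> L"
      "\<And>b. b \<in> I \<Longrightarrow> b < q * degree P"
    and eq: "(\<Sum>b\<in>I. \<kappa> b * z powi (t * int (\<omega> b) + s * int b)) = 0"
    and b: "b \<in> I"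
  shows "\<kappa> b = 0"
proof -
  have "I \<noteq> {}" using b by auto
  obtain Q K0 b0 where Q: "poly_over L Q"
    "(\<Sum>b\<in>I. \<kappa> b * z powi (t * int (\<omega> b) + s * int b)) = z powi K0 * poly Q z"
    "(\<Sum>b\<in>I. \<kappa> b * of_nat b * z powi (t * int (\<omega> b) + s * int b)) =
       z powi K0 * (of_nat b0 * poly Q z + of_nat q * z * poly (pderiv Q) z)"
    "Q = 0 \<longleftrightarrow> (\<forall>b\<in>I. \<kappa> b = 0)"
    "\<And>j. coeff Q j \<noteq> 0 \<Longrightarrow> \<exists>b\<in>I. q * j \<le> b"
    by (rule edge_sum[OF L z q bez I(1) \<open>I \<noteq> {}\<close> I(2,3)]) (assumption+, rule that)
  have "poly Q z = 0" using eq Q(2) z by simp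
  moreover have "degree Q < degree P" if "Q \<noteq> 0"
  proof -
    have "lead_coeff Q \<noteq> 0" using that by simp
    from Q(5)[OF this] obtain b' where b': "b' \<in> I" "q * degree Q \<le> b'" by blast
    have "q * degree Q < q * degree P" using b'(2) I(4)[OF b'(1)] by linarith
    then show ?thesis by simp
  qed
  ultimately have "Q = 0" using irreducible_over_root_minimal[OF L irr root Q(1)] by blast
  then show ?thesis using Q(4) b by blast
qed

text \<open>
  The sum over \<open>b\<close> with weight \<open>b\<close> is, up to \<open>z\<^sup>s\<close>, the derivative at \<open>0\<close> of
  \<open>y \<mapsto> \<Sum>\<^sub>b \<kappa>\<^sub>b z\<^sup>t\<^sup>\<omega> (y + z\<^sup>s)\<^sup>b\<close>: a degree-minimal edge polynomial has a simple root.
\<close>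
lemma edge_sum_deriv_nonzero:
  fixes z :: "'k::field alg_closure" and \<kappa> :: "nat \<Rightarrow> 'k alg_closure" and q m W :: nat
  assumes L: "ac_subfield L" and irr: "irreducible_over L P" and root: "poly P z = 0"
    and z: "z \<noteq> 0" and q: "q > 0" and bez: "int q * s - t * int m = 1"
    and I: "finite I" "\<And>b. b \<in> I \<Longrightarrow> q * \<omega> b + m * b = W" "\<And>b. b \<in> I \<Longrightarrow> \<kappa> b \<in> L"
      "\<And>b. b \<in> I \<Longrightarrow> b \<le> q * degree P"
    and char: "of_nat q \<noteq> (0 :: 'k)" "of_nat (degree P) \<noteq> (0 :: 'k)"
    and eq: "(\<Sum>b\<in>I. \<kappa> b * z powi (t * int (\<omega> b) + s * int b)) = 0"
    and b: "b \<in> I" "\<kappa> b \<noteq> 0"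
  shows "(\<Sum>b\<in>I. \<kappa> b * of_nat b * z powi (t * int (\<omega> b) + s * int b)) \<noteq> 0"
proof -
  have "I \<noteq> {}" using b by auto
  obtain Q K0 b0 where Q: "poly_over L Q"
    "(\<Sum>b\<in>I. \<kappa> b * z powi (t * int (\<omega> b) + s * int b)) = z powi K0 * poly Q z"
    "(\<Sum>b\<in>I. \<kappa> b * of_nat b * z powi (t * int (\<omega> b) + s * int b)) =
       z powi K0 * (of_nat b0 * poly Q z + of_nat q * z * poly (pderiv Q) z)"
    "Q = 0 \<longleftrightarrow> (\<forall>b\<in>I. \<kappa> b = 0)"
    "\<And>j. coeff Q j \<noteq> 0 \<Longrightarrow> \<exists>b\<in>I. q * j \<le> b"
    by (rule edge_sum[OF L z q bez I(1) \<open>I \<noteq> {}\<close> I(2,3)]) (assumption+, rule that)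
  have Qz: "poly Q z = 0" using eq Q(2) z by simp
  have "Q \<noteq> 0" using Q(4) b by blast
  then have "lead_coeff Q \<noteq> 0" by simp
  from Q(5)[OF this] obtain b' where b': "b' \<in> I" "q * degree Q \<le> b'" by blast
  have "q * degree Q \<le> q * degree P" using b'(2) I(4)[OF b'(1)] by linarith
  then have "degree Q \<le> degree P" using q by simp
  moreover have "\<not> degree Q < degree P"
    using irreducible_over_root_minimal[OF L irr root Q(1) \<open>Q \<noteq> 0\<close>] Qz by blast
  ultimately have dQ: "degree Q = degree P" by simp
  have dP: "degree P > 0" using irr by (simp add: irreducible_over_def)
  have nat_nz: "of_nat n \<noteq> (0 :: 'k alg_closure)" if "of_nat n \<noteq> (0 :: 'k)" for n
    using that by (metis to_ac_eq_0_iff to_ac_of_nat)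
  \<comment> \<open>Q has degree exactly deg P, which is nonzero in the field. So the derivative of
    Q is a nonzero polynomial of degree below deg P, and minimality applies to it as well.\<close>
  have "coeff (pderiv Q) (degree Q - 1) = of_nat (degree Q) * lead_coeff Q"
    using dQ dP by (simp add: coeff_pderiv)
  then have "pderiv Q \<noteq> 0"
    using nat_nz[OF char(2)] dQ \<open>Q \<noteq> 0\<close> by (metis coeff_0 leading_coeff_0_iff mult_eq_0_iff)
  moreover have "poly_over L (pderiv Q)"
    using Q(1) L unfolding poly_over_def coeff_pderiv by (auto intro!: ac_subfield_mult ac_subfield_of_nat
        simp del: of_nat_Suc)
  moreover have "degree (pderiv Q) < degree P"
    using dQ dP by (intro le_less_trans[OF degree_le[of "degree P - 1"]]) (auto simp: coeff_pderiv coeff_eq_0)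
  ultimately have "poly (pderiv Q) z \<noteq> 0"
    using irreducible_over_root_minimal[OF L irr root] by blast
  then show ?thesis using Q(3) Qz z nat_nz[OF char(1)] by simp
qed


subsection \<open>The degree of a minimal polynomial\<close>

text \<open>Makes Gauss's lemma available over K[[x]], so that irreducible elements of K[[x]][y] are
  prime.\<close>

instance fps :: (field) semiring_gcd_mult_normalize ..

text \<open>Fraction-free Gaussian elimination: a column k with nonzero pivot in equation i is
  removed from the other equations. A solution of the smaller system is scaled by the pivot, and its
  entry at k is chosen to satisfy equation i.\<close>

lemma linear_dependence:
  fixes a :: "'i \<Rightarrow> 'j \<Rightarrow> 'r::idom"
  assumes "finite I" "finite J" "card I < card J"
  shows "\<exists>c. (\<exists>j\<in>J. c j \<noteq> 0) \<and> (\<forall>i\<in>I. (\<Sum>j\<in>J. c j * a i j) = 0)"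
  using assms
proof (induction I arbitrary: J a)
  case empty
  then have "J \<noteq> {}" by auto
  then show ?case by (intro exI[of _ "\<lambda>_. 1"]) auto
next
  case (insert i I)
  show ?case
  proof (cases "\<forall>j\<in>J. a i j = 0")
    case True
    obtain c where "\<exists>j\<in>J. c j \<noteq> 0" "\<forall>i\<in>I. (\<Sum>j\<in>J. c j * a i j) = 0"
      using insert.IH[of J a] insert.prems insert.hyps by auto
    then show ?thesis using True by (intro exI[of _ c]) auto
  next
    case False
    then obtain k where k: "k \<in> J" "a i k \<noteq> 0" by blast
    define K where "K = J - {k}"
    have K: "finite K" "k \<notin> K" "J = insert k K" using k insert.prems by (auto simp: K_def)
    have "card I < card K" using insert.prems insert.hyps k by (simp add: K_def)
    from insert.IH[OF K(1) this, of "\<lambda>i' j. a i k * a i' j - a i j * a i' k"]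
    obtain c where c: "\<exists>j\<in>K. c j \<noteq> 0"
      "\<And>i'. i' \<in> I \<Longrightarrow> (\<Sum>j\<in>K. c j * (a i k * a i' j - a i j * a i' k)) = 0" by blast
    define d where "d = (\<lambda>j. if j = k then - (\<Sum>j\<in>K. c j * a i j) else c j * a i k)"
    have sum: "(\<Sum>j\<in>J. d j * a i' j) = (\<Sum>j\<in>K. c j * (a i k * a i' j - a i j * a i' k))" for i'
    proof -
      have "(\<Sum>j\<in>K. d j * a i' j) = (\<Sum>j\<in>K. c j * a i k * a i' j)"
        using K by (intro sum.cong) (auto simp: d_def)
      then show ?thesis
        using K by (simp add: d_def sum_distrib_right sum_distrib_left right_diff_distrib sum_subtractf mult_ac)
    qed
    show ?thesis
    proof (intro exI[of _ d] conjI ballI)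
      show "\<exists>j\<in>J. d j \<noteq> 0" using c(1) k K by (auto simp: d_def)
      fix i' assume "i' \<in> insert i I"
      then show "(\<Sum>j\<in>J. d j * a i' j) = 0"
        unfolding sum using c(2) by (auto simp: mult_ac)
    qed
  qed
qed

text \<open>Let B be a nonzero annihilator of S of least degree. The pseudo-remainder of \<phi> by B
  annihilates S too, so it is 0 and a \<phi> = B q. The prime \<phi> does not divide q, since
  otherwise B would be a nonzero constant, which h keeps nonzero. So \<phi> divides B.\<close>

lemma degree_le_annihilator:
  fixes \<phi> H :: "'k::field fps poly" and h :: "'k fps \<Rightarrow> 'b::idom"
  assumes hom: "h 0 = 0" "\<And>a b. h (a + b) = h a + h b" "\<And>a b. h (a * b) = h a * h b"
    and inj: "\<And>a. h a = 0 \<Longrightarrow> a = 0"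
    and \<phi>: "irreducible \<phi>" "poly (map_poly h \<phi>) S = 0"
    and H: "H \<noteq> 0" "poly (map_poly h H) S = 0"
  shows "degree \<phi> \<le> degree H"
proof -
  define Z where "Z = {H. H \<noteq> 0 \<and> poly (map_poly h H) S = 0}"
  define B where "B = arg_min degree (\<lambda>p. p \<in> Z)"
  have "H \<in> Z" using H by (simp add: Z_def)
  then have B: "B \<in> Z" and min: "\<And>p. p \<in> Z \<Longrightarrow> degree B \<le> degree p"
    unfolding B_def by (auto intro: arg_min_natI arg_min_nat_le)
  have ev: "poly (map_poly h (p * q)) S = poly (map_poly h p) S * poly (map_poly h q) S"
    "poly (map_poly h (p + q)) S = poly (map_poly h p) S + poly (map_poly h q) S" for p q
    by (simp_all add: map_poly_hom_mult[OF hom] map_poly_hom_add[OF hom(1,2)])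
  have B0: "B \<noteq> 0" "poly (map_poly h B) S = 0" using B by (auto simp: Z_def)
  obtain a q where aq: "a \<noteq> 0" "smult a \<phi> = B * q + pseudo_mod \<phi> B"
    using pseudo_mod(1)[OF B0(1)] by blast
  have "poly (map_poly h (smult a \<phi>)) S = 0"
    using ev(1)[of "[:a:]" \<phi>] \<phi>(2) by simp
  then have "poly (map_poly h (pseudo_mod \<phi> B)) S = 0"
    unfolding aq(2) ev B0(2) by simp
  then have "pseudo_mod \<phi> B = 0"
    using pseudo_mod(2)[OF B0(1), of \<phi>] min[of "pseudo_mod \<phi> B"] by (force simp: Z_def)
  then have eq: "[:a:] * \<phi> = B * q" using aq(2) by simp
  have prime: "prime_elem \<phi>"
    using \<phi>(1) by (rule irreducible_imp_prime_elem)
  have "\<phi> dvd B * q" unfolding eq[symmetric] by (simp add: dvd_smult)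
  then have "\<phi> dvd B \<or> \<phi> dvd q" using prime prime_elem_dvd_mult_iff by blast
  moreover have "\<not> \<phi> dvd q"
  proof
    assume "\<phi> dvd q"
    then obtain r where "q = \<phi> * r" by blast
    then have "\<phi> * [:a:] = \<phi> * (B * r)" using eq by (simp add: mult_ac)
    then have "[:a:] = B * r" using prime by (metis mult_left_cancel prime_elem_not_zeroI)
    then have "degree B = 0"
      using aq(1) B0(1) by (metis degree_mult_eq degree_pCons_0 mult_zero_right pCons_eq_0_iff add_is_0)
    then obtain b where b: "B = [:b:]" by (rule degree_eq_zeroE)
    then show False using B0 hom(1) inj[of b] by (simp add: map_poly_pCons)
  qed
  ultimately have "degree \<phi> \<le> degree B" using dvd_imp_degree_le B0(1) by blast
  then show ?thesis using min \<open>H \<in> Z\<close> by fastforce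
qed

section \<open>Generators over the ground field and annihilating polynomials\<close>

lemma fps_ac_nth [simp]: "fps_ac a $ n = to_ac (a $ n)"
  by (simp add: fps_ac_def)

lemma fps_ac_simps [simp]:
  "fps_ac 0 = 0" "fps_ac 1 = 1" "fps_ac (a + b) = fps_ac a + fps_ac b"
  "fps_ac (a * b) = fps_ac a * fps_ac b" "fps_ac fps_X = fps_X"
  "fps_ac a = 0 \<longleftrightarrow> a = 0"
  by (auto simp: fps_eq_iff fps_mult_nth to_ac_sum fps_X_def)

lemma fps_ac_sum: "fps_ac (sum f A) = (\<Sum>i\<in>A. fps_ac (f i))"
  by (induction A rule: infinite_finite_induct) simp_all

text \<open>An element of the next field is p(z), and reducing p modulo the polynomial of z leaves a
  degree below \<open>l\<close>. So generators of the lower field times the powers z^n with n <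
  \<open>l\<close> generate the upper one.\<close>

lemma tower_field_span:
  assumes "\<And>j. j < k \<Longrightarrow> irreducible_over (tower_field D j) (PP D (Suc j)) \<and> PP D (Suc j) \<noteq> 0
      \<and> poly (PP D (Suc j)) (zz D (Suc j)) = 0"
  shows "\<exists>\<omega>. \<forall>c\<in>tower_field D k. \<exists>\<kappa> :: nat \<Rightarrow> 'k::field.
      c = (\<Sum>a < (\<Prod>j<k. degree (PP D (Suc j))). to_ac (\<kappa> a) * \<omega> a)"
  using assms
proof (induction k)
  case 0
  show ?case
  proof (rule exI[of _ "\<lambda>_. 1"], rule ballI)
    fix c assume "c \<in> tower_field D 0"
    then obtain x where "c = to_ac x" by auto
    then show "\<exists>\<kappa> :: nat \<Rightarrow> 'k. c = (\<Sum>a < (\<Prod>j<0. degree (PP D (Suc j))). to_ac (\<kappa> a) * 1)"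
      by (intro exI[of _ "\<lambda>_. x"]) simp
  qed
next
  case (Suc k)
  define f l z where "f = (\<Prod>j<k. degree (PP D (Suc j)))" "l = degree (PP D (Suc k))" "z = zz D (Suc k)"
  obtain \<omega> where \<omega>: "\<And>c. c \<in> tower_field D k \<Longrightarrow> \<exists>\<kappa> :: nat \<Rightarrow> 'k. c = (\<Sum>a<f. to_ac (\<kappa> a) * \<omega> a)"
    using Suc.IH Suc.prems unfolding f_l_z_def by force
  have P: "irreducible_over (tower_field D k) (PP D (Suc k))" "PP D (Suc k) \<noteq> 0" "poly (PP D (Suc k)) z = 0"
    using Suc.prems[of k] by (auto simp: f_l_z_def)
  have l: "l > 0" using P by (simp add: irreducible_over_def f_l_z_def)
  have "\<exists>\<kappa> :: nat \<Rightarrow> 'k. c = (\<Sum>a<f * l. to_ac (\<kappa> a) * (\<omega> (a div l) * z ^ (a mod l)))"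
    if c: "c \<in> tower_field D (Suc k)" for c
  proof -
    obtain p where p: "poly_over (tower_field D k) p" "c = poly p z"
      using c by (auto simp: f_l_z_def)
    obtain Q R where QR: "poly_over (tower_field D k) R" "p = PP D (Suc k) * Q + R"
        "R = 0 \<or> degree R < l"
      using poly_over_division[OF ac_subfield_tower_field p(1) _ P(2)] P(1)
      by (auto simp: irreducible_over_def f_l_z_def)
    have "coeff R n \<in> tower_field D k" for n using QR(1) by (simp add: poly_over_def)
    then have "\<exists>\<kappa> :: nat \<Rightarrow> 'k. coeff R n = (\<Sum>a<f. to_ac (\<kappa> a) * \<omega> a)" for n
      using \<omega> by blast
    then obtain \<kappa> :: "nat \<Rightarrow> nat \<Rightarrow> 'k" where \<kappa>: "\<And>n. coeff R n = (\<Sum>a<f. to_ac (\<kappa> n a) * \<omega> a)"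
      by metis
    have "c = poly R z" using p(2) QR(2) P(3) by simp
    also have "\<dots> = (\<Sum>n<l. coeff R n * z ^ n)"
    proof (cases "R = 0")
      case False
      then have "{..degree R} \<subseteq> {..<l}" using QR(3) by auto
      then show ?thesis unfolding poly_altdef
        by (intro sum.mono_neutral_left) (auto simp: coeff_eq_0)
    qed simp
    also have "\<dots> = (\<Sum>n<l. \<Sum>a<f. to_ac (\<kappa> n a) * \<omega> a * z ^ n)"
      unfolding \<kappa> sum_distrib_right ..
    also have "\<dots> = (\<Sum>a<f. \<Sum>n<l. to_ac (\<kappa> n a) * \<omega> a * z ^ n)"
      by (rule sum.swap)
    \<comment> \<open>The pair (a, n) is numbered a l + n, so \<open>div\<close> and
      \<open>mod\<close> recover it.\<close>
    also have "\<dots> = (\<Sum>i<f * l. to_ac (\<kappa> (i mod l) (i div l)) * (\<omega> (i div l) * z ^ (i mod l)))"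
      unfolding sum.cartesian_product
    proof (rule sum.reindex_bij_witness[of _ "\<lambda>i. (i div l, i mod l)" "\<lambda>(a, n). a * l + n"], goal_cases)
      case (2 x)
      obtain a n where x: "x = (a, n)" "a < f" "n < l" using 2 by auto
      have "a * l + n < Suc a * l" using x by simp
      also have "\<dots> \<le> f * l" using x by (intro mult_right_mono) auto
      finally show ?case using x by simp
    qed (use l in \<open>auto simp: less_mult_imp_div_less mult_ac\<close>)
    finally show ?thesis by (intro exI)
  qed
  moreover have "(\<Prod>j<Suc k. degree (PP D (Suc j))) = f * l" by (simp add: f_l_z_def)
  ultimately show ?case by (intro exI[of _ "\<lambda>a. \<omega> (a div l) * z ^ (a mod l)"]) auto
qed

text \<open>Via x \<mapsto> \<mu> x^e, the power series over L are generated as a module over K[[x]]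
  by the f e elements \<omega>_a x^b with b < e. The f e + 1 powers of S of exponent at most f e are
  therefore linearly dependent over K[[x]], and a relation is the required H.\<close>

lemma exists_annihilator:
  fixes L :: "'k::field alg_closure set" and \<omega> :: "nat \<Rightarrow> 'k alg_closure"
  assumes L: "ac_subfield L" and span: "\<And>c. c \<in> L \<Longrightarrow> \<exists>\<kappa> :: nat \<Rightarrow> 'k. c = (\<Sum>a<f. to_ac (\<kappa> a) * \<omega> a)"
    and \<mu>: "\<mu> \<in> L" "\<mu> \<noteq> 0" and e: "e > 0" and S: "\<And>n. S $ n \<in> L"
  shows "\<exists>H :: 'k fps poly. H \<noteq> 0 \<and> degree H \<le> f * e \<and>
     poly (map_poly (\<lambda>a. fps_ac a oo (fps_const \<mu> * fps_X ^ e)) H) S = 0"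
proof -
  define u where "u = fps_const \<mu> * fps_X ^ e"
  have u0: "u $ 0 = 0" using e by (simp add: u_def)
  let ?I = "{..<f} \<times> {..<e}"
  have "\<exists>C :: nat \<Rightarrow> nat \<Rightarrow> 'k fps. T = (\<Sum>(a, b)\<in>?I. fps_const (\<omega> a) * fps_X ^ b * (fps_ac (C a b) oo u))"
    if T: "\<And>n. T $ n \<in> L" for T
  proof -
    \<comment> \<open>The substitution turns x^(n div e) into a term carrying \<mu>^(n div e), which
      is divided out in advance.\<close>
    have "T $ n * inverse (\<mu> ^ (n div e)) \<in> L" for n
      using L T \<mu> by (intro ac_subfield_mult ac_subfield_inverse ac_subfield_power)
    then have "\<exists>\<kappa> :: nat \<Rightarrow> 'k. T $ n * inverse (\<mu> ^ (n div e)) = (\<Sum>a<f. to_ac (\<kappa> a) * \<omega> a)" for n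
      using span by blast
    then obtain \<kappa> :: "nat \<Rightarrow> nat \<Rightarrow> 'k" where
      \<kappa>: "\<And>n. T $ n * inverse (\<mu> ^ (n div e)) = (\<Sum>a<f. to_ac (\<kappa> n a) * \<omega> a)"
      by metis
    have T': "T $ n = (\<Sum>a<f. to_ac (\<kappa> n a) * \<omega> a) * \<mu> ^ (n div e)" for n
      unfolding \<kappa>[symmetric] using \<mu> by simp
    have "T = (\<Sum>(a, b)\<in>?I. fps_const (\<omega> a) * fps_X ^ b * (fps_ac (Abs_fps (\<lambda>j. \<kappa> (j * e + b) a)) oo u))"
      (is "T = ?R")
    proof (rule fps_ext)
      fix n
      have "(fps_const (\<omega> a) * fps_X ^ b * (fps_ac (Abs_fps (\<lambda>j. \<kappa> (j * e + b) a)) oo u)) $ n =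
          (if b = n mod e then \<omega> a * (to_ac (\<kappa> n a) * \<mu> ^ (n div e)) else 0)" if b: "b < e" for a b
      proof (cases "b \<le> n \<and> e dvd (n - b)")
        case True
        then obtain j where j: "n = b + e * j" by (metis dvd_def le_add_diff_inverse)
        have nb: "n mod e = b" "n div e = j" using b unfolding j by auto
        have "n - b = e * j" "j * e + b = n" "b \<le> n" using j by (auto simp: mult.commute)
        then show ?thesis unfolding nb using e
          by (simp add: mult.assoc fps_X_power_mult_nth u_def fps_compose_monom_nth[OF e])
      next
        case False
        have "b \<noteq> n mod e"
        proof
          assume "b = n mod e"
          then have "b \<le> n" "e dvd (n - b)" by (auto simp: dvd_minus_mod)
          then show False using False by blast
        qed
        then show ?thesis using False
          by (auto simp: mult.assoc fps_X_power_mult_nth u_def fps_compose_monom_nth[OF e])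
      qed
      then have "?R $ n = (\<Sum>(a, b)\<in>?I. if b = n mod e then \<omega> a * (to_ac (\<kappa> n a) * \<mu> ^ (n div e)) else 0)"
        unfolding fps_sum_nth by (intro sum.cong) auto
      also have "\<dots> = (\<Sum>a<f. \<omega> a * (to_ac (\<kappa> n a) * \<mu> ^ (n div e)))"
        unfolding sum.cartesian_product[symmetric] using e by simp
      also have "\<dots> = T $ n" unfolding T' by (simp add: sum_distrib_left mult_ac)
      finally show "T $ n = ?R $ n" ..
    qed
    then show ?thesis by (rule exI[of _ "\<lambda>a b. Abs_fps (\<lambda>j. \<kappa> (j * e + b) a)"])
  qed
  moreover have "(S ^ n) $ i \<in> L" for n i
  proof (induction n arbitrary: i)
    case 0
    show ?case using ac_subfield_0[OF L] ac_subfield_1[OF L] by simp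
  next
    case (Suc n)
    show ?case using Suc S L by (auto simp: fps_mult_nth intro!: ac_subfield_sum ac_subfield_mult)
  qed
  ultimately have "\<forall>n. \<exists>C :: nat \<Rightarrow> nat \<Rightarrow> 'k fps.
      S ^ n = (\<Sum>(a, b)\<in>?I. fps_const (\<omega> a) * fps_X ^ b * (fps_ac (C a b) oo u))"
    by blast
  from choice[OF this] obtain C :: "nat \<Rightarrow> nat \<Rightarrow> nat \<Rightarrow> 'k fps" where
    C: "\<forall>n. S ^ n = (\<Sum>(a, b)\<in>?I. fps_const (\<omega> a) * fps_X ^ b * (fps_ac (C n a b) oo u))"
    by (rule exE)
  note C = C[rule_format]
  \<comment> \<open>One equation for each of the f e generators, against f e + 1 unknowns.\<close>
  obtain c :: "nat \<Rightarrow> 'k fps" where c: "\<exists>n\<in>{..f * e}. c n \<noteq> 0"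
    "\<forall>i\<in>?I. (\<Sum>n\<in>{..f * e}. c n * (case i of (a, b) \<Rightarrow> C n a b)) = 0"
    using linear_dependence[of ?I "{..f * e}" "\<lambda>i n. case i of (a, b) \<Rightarrow> C n a b"]
    by (auto simp: card_cartesian_product)
  define H where "H = (\<Sum>n\<le>f * e. monom (c n) n)"
  have coeff_H: "coeff H n = (if n \<le> f * e then c n else 0)" for n
    by (simp add: H_def coeff_sum)
  have dH: "degree H \<le> f * e"
    by (rule degree_le) (simp add: coeff_H)
  have hom: "fps_ac (0 :: 'k fps) oo u = 0" by simp
  have "poly (map_poly (\<lambda>a. fps_ac a oo u) H) S = (\<Sum>n\<le>f * e. (fps_ac (c n) oo u) * S ^ n)"
  proof -
    have "map_poly (\<lambda>a. fps_ac a oo u) H = (\<Sum>n\<le>f * e. monom (fps_ac (c n) oo u) n)"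
      by (rule poly_eqI) (auto simp: coeff_map_poly coeff_H coeff_sum)
    then show ?thesis by (simp add: poly_sum poly_monom)
  qed
  also have "\<dots> = (\<Sum>n\<le>f * e. \<Sum>(a, b)\<in>?I. fps_const (\<omega> a) * fps_X ^ b * (fps_ac (c n * C n a b) oo u))"
    unfolding C sum_distrib_left
    by (intro sum.cong refl) (auto simp: fps_compose_mult_distrib[OF u0] mult_ac)
  also have "\<dots> = (\<Sum>(a, b)\<in>?I. \<Sum>n\<le>f * e. fps_const (\<omega> a) * fps_X ^ b * (fps_ac (c n * C n a b) oo u))"
    by (subst sum.swap) (simp add: case_prod_unfold)
  also have "\<dots> = (\<Sum>(a, b)\<in>?I. fps_const (\<omega> a) * fps_X ^ b * (fps_ac (\<Sum>n\<le>f * e. c n * C n a b) oo u))"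
  proof -
    have "fps_ac (\<Sum>n\<le>f * e. c n * C n a b) oo u = (\<Sum>n\<le>f * e. fps_ac (c n * C n a b) oo u)" for a b
      by (simp only: fps_ac_sum fps_compose_sum_distrib)
    then show ?thesis by (simp add: sum_distrib_left)
  qed
  also have "\<dots> = 0" using c(2) by (intro sum.neutral) auto
  finally have "poly (map_poly (\<lambda>a. fps_ac a oo u) H) S = 0" .
  moreover have "H \<noteq> 0" using c(1) coeff_H by (metis atMost_iff coeff_0)
  ultimately show ?thesis using dH unfolding u_def by blast
qed


subsection \<open>Supporting lines of Newton polygons\<close>

lemma weierstrass_newton_points:
  fixes H :: "'a::field fps poly"
  assumes "weierstrass H"
  shows "(real (degree H), 0) \<in> newton_points H"
    and "(x, y) \<in> newton_points H \<Longrightarrow> 0 \<le> x \<and> x \<le> real (degree H) \<and> 0 \<le> y \<and> (x < real (degree H) \<longrightarrow> 1 \<le> y)"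
proof -
  have lc: "lead_coeff H = 1" "\<And>n. n < degree H \<Longrightarrow> coeff H n $ 0 = 0"
    using assms by (auto simp: weierstrass_def)
  then show "(real (degree H), 0) \<in> newton_points H"
    unfolding newton_points_def by (auto intro!: exI[of _ "degree H"])
  assume "(x, y) \<in> newton_points H"
  then obtain n where n: "x = real n" "y = real (subdegree (coeff H n))" "coeff H n \<noteq> 0"
    unfolding newton_points_def by auto
  have "n \<le> degree H" using n(3) le_degree by blast
  moreover have "subdegree (coeff H n) \<noteq> 0" if "n < degree H"
    using lc(2)[OF that] n(3) by (simp add: subdegree_eq_0_iff)
  ultimately show "0 \<le> x \<and> x \<le> real (degree H) \<and> 0 \<le> y \<and> (x < real (degree H) \<longrightarrow> 1 \<le> y)"
    using n by auto
qed

lemma finite_newton_points: "finite (newton_points H)"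
proof (rule finite_subset)
  show "newton_points H \<subseteq> (\<lambda>i. (real i, real (subdegree (coeff H i)))) ` {..degree H}"
    unfolding newton_points_def using le_degree by fastforce
qed simp

lemma newton_polygon_subset: "newton_polygon H \<subseteq> convex hull (newton_points H)"
  by (auto simp: newton_polygon_def)

lemma finite_newton_polygon_nat: "finite {(i::nat, j::nat). (real i, real j) \<in> newton_polygon H}"
proof -
  have "bounded (convex hull (newton_points H))"
    by (intro bounded_convex_hull finite_imp_bounded finite_newton_points)
  then obtain B where B: "\<And>p. p \<in> convex hull (newton_points H) \<Longrightarrow> norm p \<le> B"
    unfolding bounded_iff by blast
  have "{(i::nat, j::nat). (real i, real j) \<in> newton_polygon H} \<subseteq> {..nat \<lceil>B\<rceil>} \<times> {..nat \<lceil>B\<rceil>}"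
  proof clarify
    fix i j assume "(real i, real j) \<in> newton_polygon H"
    then have "norm (real i, real j) \<le> B" using B newton_polygon_subset by blast
    then have "real i \<le> B" "real j \<le> B"
      using norm_fst_le[of "real i" "real j"] norm_snd_le[of "real j" "real i"] by auto
    then show "i \<in> {..nat \<lceil>B\<rceil>} \<and> j \<in> {..nat \<lceil>B\<rceil>}" by (auto simp: le_nat_iff le_ceiling_iff)
  qed
  then show ?thesis by (rule finite_subset) simp
qed

lemma convex_hull_halfplane:
  fixes S :: "(real \<times> real) set"
  assumes "\<And>x y. (x, y) \<in> S \<Longrightarrow> c \<le> a * x + y" "(u, v) \<in> convex hull S"
  shows "c \<le> a * u + v"
proof -
  have "convex hull S \<subseteq> {p. inner (a, 1) p \<ge> c}"
    using assms(1) by (intro hull_minimal convex_halfspace_ge) auto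
  then show ?thesis using assms(2) by auto
qed

text \<open>To the left of the vertex (N, 0), the steepest descent from (u, v) to a point further
  right gives the line. A point on the left below that line would span with the extremal point on
  the right a chord passing below (u, v).\<close>

lemma newton_polygon_supporting_line:
  fixes H :: "'a::field fps poly"
  assumes H: "weierstrass H" and p: "(u, v) \<in> newton_polygon H"
  obtains a where "a > 0" "\<And>x y. (x, y) \<in> newton_points H \<Longrightarrow> a * u + v \<le> a * x + y"
    "\<exists>x y. (x, y) \<in> newton_points H \<and> a * x + y = a * u + v"
proof -
  define S where "S = newton_points H"
  define N where "N = real (degree H)"
  have S: "(N, 0) \<in> S" "\<And>x y. (x, y) \<in> S \<Longrightarrow> 0 \<le> x \<and> x \<le> N \<and> 0 \<le> y \<and> (x < N \<longrightarrow> 1 \<le> y)"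
    using weierstrass_newton_points[OF H] unfolding S_def N_def by auto
  have hull: "(u, v) \<in> convex hull S" "\<And>v'. (u, v') \<in> convex hull S \<Longrightarrow> v \<le> v'"
    using p by (auto simp: newton_polygon_def S_def)
  have sub: "S \<subseteq> convex hull S" by (rule hull_subset)
  have N0: "N \<ge> 0" by (simp add: N_def)
  \<comment> \<open>So small that every point of height at least 1 stays above the line of slope -a0
    through (N, 0).\<close>
  define a0 where "a0 = 1 / (N + 1)"
  have a0: "a0 > 0" using N0 by (simp add: a0_def)
  have a0S: "a0 * N \<le> a0 * x + y" if "(x, y) \<in> S" for x y
  proof (cases "x = N")
    case False
    then have "1 \<le> y" "0 \<le> x" using S(2)[OF that] by auto
    moreover have "a0 * N \<le> 1" using N0 by (simp add: a0_def)
    ultimately show ?thesis using a0 by (smt (verit) mult_nonneg_nonneg)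
  qed (use S(2)[OF that] in auto)
  have uv: "a0 * N \<le> a0 * u + v" using convex_hull_halfplane[OF a0S hull(1)] .
  have "u \<le> N"
  proof -
    have "convex hull S \<subseteq> {p. inner (1, 0) p \<le> N}"
      using S(2) by (intro hull_minimal convex_halfspace_le) auto
    then show ?thesis using hull(1) by auto
  qed
  show ?thesis
  proof (cases "u = N")
    case True
    then have "v \<le> 0" using hull(2) S(1) sub by blast
    then have "v = 0" using uv True by simp
    then show ?thesis
      using that[of a0] a0 a0S S(1) True unfolding S_def by force
  next
    case False
    then have u: "u < N" using \<open>u \<le> N\<close> by simp
    then have v: "v > 0" using uv a0 by (smt (verit) mult_less_cancel_left_pos)
    define R where "R = {p \<in> S. fst p > u}"
    define sl where "sl = (\<lambda>p :: real \<times> real. (v - snd p) / (fst p - u))"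
    have R: "finite R" "(N, 0) \<in> R"
      using finite_newton_points[of H] S(1) u by (auto simp: R_def S_def)
    define a where "a = Max (sl ` R)"
    have "a \<in> sl ` R" unfolding a_def using R by (intro Max_in) auto
    then obtain x1 y1 where p1: "(x1, y1) \<in> R" "a = (v - y1) / (x1 - u)"
      by (auto simp: sl_def)
    have x1: "x1 > u" "(x1, y1) \<in> S" using p1 by (auto simp: R_def)
    have a1: "a * (x1 - u) = v - y1" using p1 x1 by simp
    have le_a: "sl p \<le> a" if "p \<in> R" for p unfolding a_def using that R by simp
    \<comment> \<open>The vertex (N, 0) lies to the lower right of (u, v), so it already gives a
      positive descent.\<close>
    have "a > 0" using le_a[OF R(2)] u v by (simp add: sl_def) (smt (verit) divide_pos_pos)
    moreover have "a * u + v \<le> a * x + y" if xy: "(x, y) \<in> S" for x y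
    proof -
      consider "x > u" | "x = u" | "x < u" by linarith
      then show ?thesis
      proof cases
        case 1
        then have "(v - y) / (x - u) \<le> a" using le_a[of "(x, y)"] xy by (simp add: R_def sl_def)
        then have "v - y \<le> a * (x - u)" using 1 by (simp add: field_simps)
        then show ?thesis by (simp add: algebra_simps)
      next
        case 2
        then have "v \<le> y" using hull(2) xy sub by blast
        then show ?thesis using 2 by simp
      next
        case 3
        \<comment> \<open>The parameter at which the chord from (x, y) to (x1, y1) has abscissa
          u.\<close>
        define t where "t = (u - x) / (x1 - x)"
        have t: "0 \<le> t" "t \<le> 1" "t * (x1 - x) = u - x" using 3 x1 by (auto simp: t_def)
        have "(1 - t) *\<^sub>R (x, y) + t *\<^sub>R (x1, y1) \<in> convex hull S"
          using t xy x1 sub by (intro convexD[OF convex_convex_hull]) auto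
        moreover have "(1 - t) *\<^sub>R (x, y) + t *\<^sub>R (x1, y1) = (u, (1 - t) * y + t * y1)"
          using t(3) by (simp add: algebra_simps)
        ultimately have "v \<le> (1 - t) * y + t * y1" using hull(2) by simp
        then have "v * (x1 - x) \<le> ((1 - t) * y + t * y1) * (x1 - x)"
          using 3 x1 by (intro mult_right_mono) auto
        also have "\<dots> = y * (x1 - x) + (t * (x1 - x)) * (y1 - y)" by (simp add: algebra_simps)
        also have "\<dots> = y * (x1 - u) + y1 * (u - x)" unfolding t(3) by (simp add: algebra_simps)
        finally have "(u - x) * (v - y1) \<le> (x1 - u) * (y - v)" by (simp add: algebra_simps)
        then have "(x1 - u) * (a * (u - x)) \<le> (x1 - u) * (y - v)"
          unfolding a1[symmetric] by (simp add: mult_ac)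
        then have "a * (u - x) \<le> y - v" using x1 by simp
        then show ?thesis by (simp add: algebra_simps)
      qed
    qed
    moreover have "a * x1 + y1 = a * u + v" using a1 by (simp add: algebra_simps)
    ultimately show ?thesis using that[of a] x1(2) unfolding S_def by blast
  qed
qed

text \<open>Any other exponent of H dividing x^m y^n has weight strictly below M, because a > 0, and
  H has no term there.\<close>

lemma weighted_mult_nth:
  fixes H U :: "'a::idom fps poly" and a M :: real
  assumes a: "a > 0" and H: "\<And>n m. coeff H n $ m \<noteq> 0 \<Longrightarrow> M \<le> a * real n + real m"
    and nm: "a * real n + real m \<le> M"
  shows "coeff (H * U) n $ m = coeff H n $ m * coeff U 0 $ 0"
proof -
  have z: "coeff H n' $ m' = 0" if "n' \<le> n" "m' \<le> m" "(n', m') \<noteq> (n, m)" for n' m'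
  proof (rule ccontr)
    assume "coeff H n' $ m' \<noteq> 0"
    then have "a * real n + real m \<le> a * real n' + real m'" using H nm by fastforce
    moreover have "a * real n' \<le> a * real n" "n' < n \<Longrightarrow> a * real n' < a * real n" using a that by auto
    ultimately show False using that by (cases "n' = n") auto
  qed
  have "coeff (H * U) n $ m = (\<Sum>n'\<le>n. \<Sum>m'=0..m. coeff H n' $ m' * coeff U (n - n') $ (m - m'))"
    by (simp add: coeff_mult fps_sum_nth fps_mult_nth)
  also have "\<dots> = (\<Sum>n'\<le>n. if n' = n then (\<Sum>m'=0..m. if m' = m then coeff H n $ m * coeff U 0 $ 0 else 0) else 0)"
  proof (intro sum.cong refl)
    fix n' assume n': "n' \<in> {..n}"
    have "coeff H n' $ m' * coeff U (n - n') $ (m - m') =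
        (if n' = n then if m' = m then coeff H n $ m * coeff U 0 $ 0 else 0 else 0)" if "m' \<in> {0..m}" for m'
      using z[of n' m'] n' that by auto
    then have "(\<Sum>m'=0..m. coeff H n' $ m' * coeff U (n - n') $ (m - m')) =
        (\<Sum>m'=0..m. if n' = n then if m' = m then coeff H n $ m * coeff U 0 $ 0 else 0 else 0)"
      by (rule sum.cong[OF refl])
    then show "(\<Sum>m'=0..m. coeff H n' $ m' * coeff U (n - n') $ (m - m')) =
        (if n' = n then \<Sum>m'=0..m. if m' = m then coeff H n $ m * coeff U 0 $ 0 else 0 else 0)"
      by (auto split: if_splits)
  qed
  also have "\<dots> = coeff H n $ m * coeff U 0 $ 0" by simp
  finally show ?thesis .
qed

text \<open>
  Initial forms are compared for the weight \<open>a i + j\<close> of a line that supports the Newton polygon at \<open>(i, j)\<close>.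
\<close>
lemma newton_polygon_nth:
  fixes H U :: "'a::field fps poly"
  assumes H: "weierstrass H" and U: "coeff U 0 $ 0 \<noteq> 0"
    and eq: "smult (fps_X ^ v) (H * U) = (\<Sum>b\<in>I. T b)"
    and I: "finite I" "\<And>b. b \<in> I \<Longrightarrow> monom_unit (T b) (W b) b (C b)" "\<And>b. b \<in> I \<Longrightarrow> C b \<noteq> 0"
    and ij: "(real i, real j) \<in> newton_polygon H"
  shows "coeff H i $ j * coeff U 0 $ 0 = (if i \<in> I \<and> W i = v + j then C i else 0)"
proof -
  obtain a where a: "a > 0" "\<And>x y. (x, y) \<in> newton_points H \<Longrightarrow> a * real i + real j \<le> a * x + y"
    "\<exists>x y. (x, y) \<in> newton_points H \<and> a * x + y = a * real i + real j"
    using newton_polygon_supporting_line[OF H ij] by metis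
  define M where "M = a * real i + real j"
  have HM: "M \<le> a * real n + real m" if "coeff H n $ m \<noteq> 0" for n m
  proof -
    have "coeff H n \<noteq> 0" "subdegree (coeff H n) \<le> m" using that by (auto intro: subdegree_leI)
    then have "(real n, real (subdegree (coeff H n))) \<in> newton_points H" "real (subdegree (coeff H n)) \<le> real m"
      unfolding newton_points_def by auto
    then show ?thesis using a(2) unfolding M_def by fastforce
  qed
  have wm: "coeff (H * U) n $ m = coeff H n $ m * coeff U 0 $ 0" if "a * real n + real m \<le> M" for n m
    by (rule weighted_mult_nth[OF a(1) _ that]) (rule HM)
  obtain n2 m2 where nm2: "coeff H n2 $ m2 \<noteq> 0" "a * real n2 + real m2 = M"
    using a(3) unfolding newton_points_def M_def by (force intro: nth_subdegree_nonzero)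
  define A where "A = smult (fps_X ^ v) (H * U)"
  have An: "coeff A n $ m = (if v \<le> m then coeff (H * U) n $ (m - v) else 0)" for n m
    by (simp add: A_def fps_X_power_mult_nth)
  have AT: "coeff A n $ m = (\<Sum>b\<in>I. coeff (T b) n $ m)" for n m
    by (simp add: A_def eq coeff_sum fps_sum_nth)
  have T0: "b \<le> n \<and> W b \<le> m" if "b \<in> I" "coeff (T b) n $ m \<noteq> 0" for b n m
    using monom_unit_nth(1)[OF I(2)] that by blast
  have TC: "coeff (T b) b $ W b = C b" if "b \<in> I" for b
    using monom_unit_nth(2)[OF I(2)] that by blast
  define wt where "wt = (\<lambda>b. a * real b + real (W b))"
  \<comment> \<open>H has a term on its supporting line, and the unit U preserves it. This bounds
    the least weight on the side of the sum from above.\<close>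
  have nz2: "coeff A n2 $ (m2 + v) \<noteq> 0"
    using nm2 U wm[of n2 m2] by (simp add: An)
  then obtain b2 where b2: "b2 \<in> I" "coeff (T b2) n2 $ (m2 + v) \<noteq> 0"
    unfolding AT by (rule sum.not_neutral_contains_not_neutral)
  have le2: "wt b2 \<le> M + real v"
  proof -
    have "a * real b2 \<le> a * real n2" "real (W b2) \<le> real (m2 + v)" using T0[OF b2] a(1) by auto
    then show ?thesis using nm2(2) by (simp add: wt_def)
  qed
  define M' where "M' = Min (wt ` I)"
  have M'_le: "M' \<le> wt b" if "b \<in> I" for b using that I(1) by (simp add: M'_def)
  \<comment> \<open>Each \<open>T b\<close> lives on exponents componentwise at least (b, W b). At
    weight at most M' only the corner itself can be met, and distinct b have distinct
    corners.\<close>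
  have atMin: "coeff A n $ m = (if n \<in> I \<and> W n = m then C n else 0)" if nm: "a * real n + real m \<le> M'" for n m
  proof -
    have "coeff (T b) n $ m = (if b = n then (if W n = m then C n else 0) else 0)" if b: "b \<in> I" for b
    proof (cases "coeff (T b) n $ m = 0")
      case True
      then show ?thesis using TC[OF b] by auto
    next
      case False
      then have le: "b \<le> n" "W b \<le> m" using T0[OF b] by auto
      moreover have "a * real n + real m \<le> a * real b + real (W b)" using nm M'_le[OF b] by (simp add: wt_def)
      moreover have "a * real b \<le> a * real n" "b < n \<Longrightarrow> a * real b < a * real n" using a(1) le by auto
      ultimately have "b = n" by fastforce
      then have "W b = m" using le \<open>a * real n + real m \<le> a * real b + real (W b)\<close> by simp
      then show ?thesis using \<open>b = n\<close> TC[OF b] by auto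
    qed
    then have "coeff A n $ m = (\<Sum>b\<in>I. if b = n then (if W n = m then C n else 0) else 0)"
      unfolding AT by (intro sum.cong) auto
    then show ?thesis using I(1) by (simp add: sum.delta)
  qed
  have "M' \<in> wt ` I" unfolding M'_def using I(1) b2(1) by (intro Min_in) auto
  then obtain b1 where b1: "b1 \<in> I" "M' = wt b1" by blast
  \<comment> \<open>A corner of least weight cannot cancel, so it occurs in x^v H U as well and has
    weight at least M + v.\<close>
  have "coeff A b1 $ (W b1) \<noteq> 0"
    using atMin[of b1 "W b1"] b1 I(3) by (simp add: wt_def)
  then have v1: "v \<le> W b1" and nz1: "coeff (H * U) b1 $ (W b1 - v) \<noteq> 0"
    unfolding An by (auto split: if_splits)
  have "M + real v \<le> M'"
  proof (rule ccontr)
    assume "\<not> M + real v \<le> M'"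
    then have lt: "a * real b1 + real (W b1 - v) < M" using b1(2) v1 by (simp add: wt_def of_nat_diff)
    then have "coeff (H * U) b1 $ (W b1 - v) = coeff H b1 $ (W b1 - v) * coeff U 0 $ 0"
      by (intro wm) auto
    then have "coeff H b1 $ (W b1 - v) \<noteq> 0" using nz1 by auto
    then show False using HM lt by fastforce
  qed
  then have M'_eq: "M' = M + real v" using le2 M'_le[OF b2(1)] by simp
  have "coeff A i $ (v + j) = coeff H i $ j * coeff U 0 $ 0"
    unfolding An using wm[of i j] by (simp add: M_def)
  moreover have "coeff A i $ (v + j) = (if i \<in> I \<and> W i = v + j then C i else 0)"
    by (rule atMin) (simp add: M'_eq M_def)
  ultimately show ?thesis by simp
qed


subsection \<open>Boundary polynomials\<close>

lemma coeff_sum_monom_fps_X: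
  fixes c :: "nat \<Rightarrow> nat \<Rightarrow> 'a::comm_ring_1"
  assumes "finite S"
  shows "coeff (\<Sum>(i, w)\<in>S. monom (fps_const (c i w) * fps_X ^ w) i) i $ j = (if (i, j) \<in> S then c i j else 0)"
proof -
  have "coeff (\<Sum>(i, w)\<in>S. monom (fps_const (c i w) * fps_X ^ w) i) i $ j =
      (\<Sum>p\<in>S. if p = (i, j) then c i j else 0)"
    unfolding coeff_sum fps_sum_nth
    by (intro sum.cong refl) (auto simp: coeff_monom fps_X_power_nth split: if_splits)
  then show ?thesis using assms by (simp only: sum.delta)
qed

lemma boundary_poly_nth:
  "coeff (boundary_poly H) i $ j = (if (real i, real j) \<in> newton_polygon H then coeff H i $ j else 0)"
  unfolding boundary_poly_def by (subst coeff_sum_monom_fps_X[OF finite_newton_polygon_nat]) auto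

lemma newton_polygon_degree:
  assumes "weierstrass (H :: 'a::field fps poly)"
  shows "(real (degree H), 0) \<in> newton_polygon H"
proof -
  have "0 \<le> v" if "(u, v) \<in> convex hull (newton_points H)" for u v
    using convex_hull_halfplane[of "newton_points H" 0 0 u v] that weierstrass_newton_points(2)[OF assms] by auto
  then show ?thesis
    unfolding newton_polygon_def using hull_inc[OF weierstrass_newton_points(1)[OF assms]] by auto
qed

text \<open>Setting x = 0 makes the degree readable from the boundary polynomial: the point (deg H,
  0) is on the polygon, and the other coefficients vanish at x = 0.\<close>

lemma weierstrass_boundary_poly_mod_x:
  assumes "weierstrass (H :: 'a::field fps poly)"
  shows "map_poly (\<lambda>a. a $ 0) (boundary_poly H) = monom 1 (degree H)"
proof (rule poly_eqI)
  fix i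
  have "i \<le> degree H" if "coeff H i $ 0 \<noteq> 0"
    using that by (metis coeff_eq_0 fps_zero_nth not_le)
  moreover have "coeff H i $ 0 = 0" if "i < degree H"
    using assms that by (simp add: weierstrass_def)
  moreover have "coeff H (degree H) $ 0 = 1" using assms by (simp add: weierstrass_def)
  ultimately show "coeff (map_poly (\<lambda>a. a $ 0) (boundary_poly H)) i = coeff (monom 1 (degree H)) i"
    using newton_polygon_degree[OF assms] boundary_poly_nth[of H i 0]
    by (auto simp: coeff_map_poly) (metis linorder_neqE_nat not_le)
qed

lemma coeff_homogenised:
  assumes "q > 0"
  shows "coeff (homogenised q m P) (q * a) = (if a \<le> degree P then fps_const (coeff P a) * fps_X ^ (m * (degree P - a)) else 0)"
    and "\<not> q dvd n \<Longrightarrow> coeff (homogenised q m P) n = 0"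
  using assms by (auto simp: homogenised_def coeff_sum coeff_monom intro!: sum.neutral)

text \<open>For m > 0 only the top term is free of x. For m = 0 nothing depends on x, and q = 1
  leaves P(y).\<close>

lemma homogenised_mod_x:
  fixes P :: "'a::field poly"
  assumes "q > 0" "m > 0 \<or> q = 1" "lead_coeff P = 1"
  shows "map_poly (\<lambda>a. a $ 0) (homogenised q m P) = (if m = 0 then P else monom 1 (q * degree P))"
proof (rule poly_eqI)
  fix n
  show "coeff (map_poly (\<lambda>a. a $ 0) (homogenised q m P)) n = coeff (if m = 0 then P else monom 1 (q * degree P)) n"
  proof (cases "q dvd n")
    case True
    then obtain a where "n = q * a" by blast
    then show ?thesis
      using assms coeff_homogenised(1)[OF assms(1), of m P a]
      by (cases "m = 0") (auto simp: coeff_map_poly coeff_monom coeff_eq_0)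
  next
    case False
    then have "q \<noteq> 1" "n \<noteq> q * degree P" by auto
    then show ?thesis using coeff_homogenised(2)[OF assms(1) False, of m P] assms
      by (auto simp: coeff_map_poly coeff_monom)
  qed
qed

lemma map_poly_hom_power:
  fixes h :: "'a::comm_ring_1 \<Rightarrow> 'b::comm_ring_1"
  assumes "h 0 = 0" "h 1 = 1" "\<And>a b. h (a + b) = h a + h b" "\<And>a b. h (a * b) = h a * h b"
  shows "map_poly h (p ^ n) = map_poly h p ^ n"
  by (induction n) (simp_all add: assms map_poly_hom_mult)

text \<open>Both sides of the boundary identity are compared at x = 0. The case m = 0 can occur,
  since a polygon consisting of one point satisfies the slope condition for every slope.\<close>

lemma edge_data_degree:
  fixes H :: "'a::field fps poly"
  assumes H: "weierstrass H" and E: "edge_data L H q m P N"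
  shows "degree H = q * degree P * N" and "m = 0 \<Longrightarrow> P ^ N = monom 1 (degree H)"
proof -
  have E': "q > 0" "coprime q m" "lead_coeff P = 1" "boundary_poly H = homogenised q m P ^ N"
    using E by (auto simp: edge_data_def)
  have qm: "m > 0 \<or> q = 1" using E'(2) by (cases "m = 0") auto
  have "monom 1 (degree H) = (if m = 0 then P else monom 1 (q * degree P)) ^ N"
    unfolding weierstrass_boundary_poly_mod_x[OF H, symmetric] E'(4)
    by (subst map_poly_hom_power) (auto simp: homogenised_mod_x[OF E'(1) qm E'(3)])
  then have *: "(if m = 0 then P else monom 1 (q * degree P)) ^ N = monom 1 (degree H)" by simp
  have "P \<noteq> 0" using E'(3) by auto
  then have "degree ((if m = 0 then P else monom 1 (q * degree P)) ^ N) = q * degree P * N"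
    using qm by (auto simp: degree_power_eq degree_monom_eq mult_ac)
  then show "degree H = q * degree P * N" unfolding * by (simp add: degree_monom_eq)
  show "m = 0 \<Longrightarrow> P ^ N = monom 1 (degree H)" using * by simp
qed

lemma irreducible_over_root_0:
  assumes L: "irreducible_over L P" "lead_coeff P = 1" "coeff P 0 = 0" and "0 \<in> L" "1 \<in> L"
  shows "P = [:0, 1 :: 'a::field:]"
proof -
  obtain A where A: "P = pCons 0 A" using L(3) by (cases P) auto
  then have eq: "P = [:0, 1:] * A" by simp
  have "coeff A i = coeff P (Suc i)" for i using A by simp
  then have "poly_over L A" using L(1) unfolding irreducible_over_def poly_over_def by simp
  moreover have "poly_over L [:0, 1:]"
    using assms(4,5) by (auto simp: poly_over_def coeff_pCons split: nat.splits)
  ultimately have "degree A = 0" using L(1) eq unfolding irreducible_over_def by fastforce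
  then obtain c where "A = [:c:]" by (rule degree_eq_zeroE)
  then show ?thesis using A L(2) by (auto split: if_splits)
qed

lemma homogenised_X: "homogenised q m [:0, 1:] = monom 1 q"
  by (simp add: homogenised_def)

text \<open>The line through this point whose descent per unit equals its own height reaches 0 one
  unit to the right. Abscissas are integers, so no point lies below it.\<close>

lemma newton_polygon_left_vertex:
  fixes H :: "'a::field fps poly"
  assumes "coeff H i \<noteq> 0" "\<And>n. n < i \<Longrightarrow> coeff H n = 0"
  shows "(real i, real (subdegree (coeff H i))) \<in> newton_polygon H"
proof -
  let ?s = "real (subdegree (coeff H i))"
  have i: "(real i, ?s) \<in> newton_points H" using assms(1) by (auto simp: newton_points_def)
  have "?s * real i + ?s \<le> ?s * x + y" if xy: "(x, y) \<in> newton_points H" for x y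
  proof -
    obtain n where n: "x = real n" "y = real (subdegree (coeff H n))" "coeff H n \<noteq> 0"
      using xy by (auto simp: newton_points_def)
    then have "i \<le> n" using assms(2) not_le by blast
    then consider "n = i" | "i + 1 \<le> n" by linarith
    then show ?thesis
    proof cases
      case 2
      then have "?s * (real i + 1) \<le> ?s * x" unfolding n by (intro mult_left_mono) auto
      then show ?thesis unfolding n by (simp add: algebra_simps)
    qed (use n in simp)
  qed
  note convex_hull_halfplane[OF this]
  then show ?thesis
    unfolding newton_polygon_def using hull_inc[OF i] by fastforce
qed

text \<open>Otherwise the left vertex would contribute a second term to the boundary
  polynomial.\<close>

lemma boundary_poly_eq_monom:
  fixes H :: "'a::field fps poly"
  assumes H: "weierstrass H" and b: "boundary_poly H = monom 1 (degree H)"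
  shows "H = monom 1 (degree H)"
proof -
  have "coeff H n = 0" if "n < degree H" for n
  proof (rule ccontr)
    assume n: "coeff H n \<noteq> 0"
    define i where "i = (LEAST n. coeff H n \<noteq> 0)"
    have i: "coeff H i \<noteq> 0" unfolding i_def by (rule LeastI) (rule n)
    have i_least: "coeff H n' = 0" if "n' < i" for n' using not_less_Least[of n'] that unfolding i_def by blast
    have "i \<le> n" unfolding i_def by (rule Least_le) (rule n)
    then have "i \<noteq> degree H" using that by simp
    then have "coeff (boundary_poly H) i $ subdegree (coeff H i) = 0" unfolding b by simp
    then show False
      using newton_polygon_left_vertex[OF i i_least] i unfolding boundary_poly_nth by simp
  qed
  then show ?thesis
    using H by (intro poly_eqI) (metis coeff_eq_0 coeff_monom linorder_neqE_nat weierstrass_def)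
qed

section \<open>Monomials in y, whose polygon is one point\<close>

lemma newton_polygon_monom: "newton_polygon (monom (1 :: 'a::field fps) n) = {(real n, 0)}"
proof -
  have "newton_points (monom (1 :: 'a fps) n) = {(real n, 0)}"
    by (auto simp: newton_points_def split: if_splits)
  then show ?thesis by (auto simp: newton_polygon_def)
qed

lemma boundary_poly_monom: "boundary_poly (monom (1 :: 'a::field fps) n) = monom 1 n"
  by (intro poly_eqI fps_ext) (auto simp: boundary_poly_nth newton_polygon_monom)

text \<open>A one-point polygon counts as degenerated, with edge data (1, 0, Z, n). So a tower
  cannot stop at a monomial of degree above 1, a fact used in \<open>not_monom\<close>.\<close>

lemma degenerated_monom:
  assumes "0 \<in> L" "1 \<in> L"
  shows "degenerated L (monom (1 :: 'a::field fps) n)"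
proof -
  have "degree a = 0 \<or> degree b = 0" if "[:0, 1 :: 'a:] = a * b" for a b
  proof -
    have "a \<noteq> 0" "b \<noteq> 0" using that by auto
    then have "degree [:0, 1 :: 'a:] = degree a + degree b" using that degree_mult_eq by metis
    then show ?thesis by auto
  qed
  then have "irreducible_over L [:0, 1 :: 'a:]"
    using assms by (auto simp: irreducible_over_def poly_over_def coeff_pCons split: nat.splits)
  then have "edge_data L (monom (1 :: 'a fps) n) 1 0 [:0, 1:] n"
    unfolding edge_data_def newton_polygon_monom boundary_poly_monom homogenised_X
    by (intro conjI exI[of _ "(real n, 0)"]) (auto simp: monom_power)
  then show ?thesis unfolding degenerated_def by blast
qed

lemma edge_data_monom:
  fixes H :: "'a::field fps poly"
  assumes H: "H = monom 1 n" "n > 0" and E: "edge_data L H q m P N" and L: "0 \<in> L" "1 \<in> L"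
  shows "P = [:0, 1:]"
proof -
  have E': "q > 0" "lead_coeff P = 1" "irreducible_over L P" "boundary_poly H = homogenised q m P ^ N"
    using E by (auto simp: edge_data_def)
  have "coeff (homogenised q m P ^ N) 0 = 0"
    unfolding E'(4)[symmetric] unfolding H(1) boundary_poly_monom using H(2) by simp
  then have "coeff (homogenised q m P) 0 = 0" by (simp add: coeff_0_power)
  then have "coeff P 0 = 0" using coeff_homogenised(1)[OF E'(1), of m P 0] by simp
  then show ?thesis using irreducible_over_root_0[OF E'(3,2)] L by blast
qed


subsection \<open>Weierstrass polynomials\<close>

lemma map_poly_hom_pcompose:
  fixes h :: "'a::comm_ring_1 \<Rightarrow> 'b::comm_ring_1"
  assumes "h 0 = 0" "\<And>a b. h (a + b) = h a + h b" "\<And>a b. h (a * b) = h a * h b"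
  shows "map_poly h (pcompose p q) = pcompose (map_poly h p) (map_poly h q)"
  by (induction p)
     (simp_all add: pcompose_pCons map_poly_pCons assms map_poly_hom_add map_poly_hom_mult)

lemma pcompose_shift_mod_x:
  assumes "c $ 0 = 0"
  shows "coeff (pcompose G [:c, 1 :: 'a::field fps:]) i $ 0 = coeff G i $ 0"
proof -
  have "map_poly (\<lambda>a. a $ 0) (pcompose G [:c, 1:]) = map_poly (\<lambda>a. a $ 0) G"
    using assms by (subst map_poly_hom_pcompose) (auto simp: map_poly_pCons)
  from arg_cong[OF this, of "\<lambda>p. coeff p i"] show ?thesis by (simp add: coeff_map_poly)
qed

lemma weierstrass_shift:
  assumes "weierstrass G" "c $ 0 = 0"
  shows "weierstrass (pcompose G [:c, 1 :: 'a::field fps:])" "degree (pcompose G [:c, 1:]) = degree G"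
proof -
  show d: "degree (pcompose G [:c, 1:]) = degree G" by (simp add: degree_pcompose)
  have "lead_coeff (pcompose G [:c, 1:]) = lead_coeff G" by (subst lead_coeff_comp) auto
  then show "weierstrass (pcompose G [:c, 1:])"
    using assms unfolding weierstrass_def by (auto simp: d pcompose_shift_mod_x)
qed

lemma monic_division:
  fixes A G :: "'a::idom poly"
  assumes "lead_coeff G = 1"
  shows "\<exists>Q R. A = G * Q + R \<and> (R = 0 \<or> degree R < degree G)"
proof -
  have "G \<noteq> 0" using assms by auto
  obtain Q R where QR: "pseudo_divmod A G = (Q, R)" by force
  show ?thesis using pseudo_divmod[OF \<open>G \<noteq> 0\<close> QR] assms by auto
qed

text \<open>The uniqueness part of Weierstrass division. If B is the quotient of A by G, then E = V
  - B satisfies G E = R with deg R < deg G. As G is a power of y modulo x, E vanishes, by induction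
  on the power of x.\<close>

lemma weierstrass_cofactor:
  fixes A G :: "'a::field fps poly" and V :: "'a fps fps"
  assumes G: "weierstrass G" and eq: "fps_of_poly A = fps_of_poly G * V"
  obtains B where "A = G * B" "V = fps_of_poly B"
proof -
  define N where "N = degree G"
  have G1: "coeff G N = 1" "\<And>a. a \<noteq> N \<Longrightarrow> coeff G a $ 0 = 0"
    using G coeff_eq_0[of G] unfolding weierstrass_def N_def by (auto, metis fps_zero_nth linorder_neqE_nat)
  obtain B R where BR: "A = G * B + R" "R = 0 \<or> degree R < degree G"
    using monic_division[of G A] G by (auto simp: weierstrass_def)
  define E where "E = V - fps_of_poly B"
  have E: "fps_of_poly G * E = fps_of_poly R"
    using eq unfolding BR(1) E_def fps_of_poly_add fps_of_poly_mult by (simp add: algebra_simps)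
  have "E $ i $ j = 0" for i j
  proof (induction j arbitrary: i rule: less_induct)
    case (less j)
    \<comment> \<open>All lower coefficients of E in x are 0 by induction, so only the constant term
      of G in x is left.\<close>
    have "(coeff G a * E $ b) $ j = coeff G a $ 0 * (E $ b $ j)" for a b
    proof -
      have "(\<Sum>j1=0..j. coeff G a $ j1 * E $ b $ (j - j1)) =
          (\<Sum>j1=0..j. if j1 = 0 then coeff G a $ 0 * (E $ b $ j) else 0)"
        using less by (intro sum.cong) auto
      then show ?thesis by (simp add: fps_mult_nth)
    qed
    then have "(fps_of_poly G * E) $ (N + i) $ j = (\<Sum>a=0..N + i. coeff G a $ 0 * (E $ (N + i - a) $ j))"
      by (simp add: fps_mult_nth[of "fps_of_poly G"] fps_sum_nth)
    also have "\<dots> = (\<Sum>a=0..N + i. if a = N then E $ i $ j else 0)"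
      using G1 by (intro sum.cong) auto
    also have "\<dots> = E $ i $ j" by simp
    finally have "E $ i $ j = coeff R (N + i) $ j" unfolding E by simp
    also have "coeff R (N + i) = 0" using BR(2) by (auto simp: N_def intro: coeff_eq_0)
    finally show "E $ i $ j = 0" by simp
  qed
  then have "E = 0" by (simp add: fps_eq_iff)
  then have "fps_of_poly R = 0" using E by simp
  then have "R = 0" by simp
  then show ?thesis using that[of B] BR \<open>E = 0\<close> by (simp add: E_def)
qed


subsection \<open>One step of the tower\<close>

lemma tower_c_0:
  assumes "weierstrass (GG D k)" "degree (GG D k) = NN D k"
  shows "tower_c D k $ 0 = 0"
proof (cases "of_nat (NN D k) = (0 :: 'a alg_closure)")
  case True
  \<comment> \<open>Here \<open>tower_c\<close> is a quotient by 0, which is 0 by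
    convention.\<close>
  then have "(of_nat (NN D k) :: 'a alg_closure fps) = 0" by (simp add: fps_of_nat[symmetric])
  then show ?thesis by (simp add: tower_c_def)
next
  case False
  then have "NN D k > 0" by (intro Nat.gr0I) auto
  then have "coeff (GG D k) (NN D k - 1) $ 0 = 0"
    using assms by (simp add: weierstrass_def)
  then show ?thesis using False
    by (simp add: tower_c_def fps_divide_nth_0 fps_of_nat[symmetric])
qed

lemma weierstrass_tower_H:
  assumes "weierstrass (GG D k)" "degree (GG D k) = NN D k"
  shows "weierstrass (tower_H D k)" "degree (tower_H D k) = NN D k"
  using weierstrass_shift[OF assms(1) tower_c_0[OF assms]] assms(2) by (simp_all add: tower_H_def)

lemma tower_stepD:
  assumes "tower_step D (Suc j)"
  shows "edge_data (tower_field D j) (tower_H D j) (qq D (Suc j)) (mm D (Suc j)) (PP D (Suc j)) (NN D (Suc j))"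
    "poly (PP D (Suc j)) (zz D (Suc j)) = 0"
    "int (qq D (Suc j)) * ss D (Suc j) - tt D (Suc j) * int (mm D (Suc j)) = 1"
    "0 \<le> tt D (Suc j)"
    "fps_poly_over (tower_field D (Suc j)) (GG D (Suc j))"
    "weierstrass (GG D (Suc j))" "degree (GG D (Suc j)) = NN D (Suc j)"
    "\<exists>V. V dvd 1 \<and> fps_of_poly (pullback (fps_const (zz D (Suc j) powi tt D (Suc j)) * fps_X ^ qq D (Suc j),
            smult (fps_X ^ mm D (Suc j)) [:fps_const (zz D (Suc j) powi ss D (Suc j)), 1:]) (tower_H D j))
       = fps_const (fps_X ^ (qq D (Suc j) * mm D (Suc j) * degree (PP D (Suc j)) * NN D (Suc j)))
          * fps_of_poly (GG D (Suc j)) * V"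
  using assms unfolding tower_step_def Let_def diff_Suc_1 by blast+

text \<open>The cofactor V is a polynomial by \<open>weierstrass_cofactor\<close>, so the shift by c
  can be applied to the whole identity in K[[x]][y].\<close>

lemma tower_step_factor:
  assumes step: "tower_step D (Suc j)"
  obtains B where "pullback (tower_sigma D (Suc j)) (tower_H D j) =
      smult (fps_X ^ (qq D (Suc j) * mm D (Suc j) * degree (PP D (Suc j)) * NN D (Suc j))) (tower_H D (Suc j) * B)"
    "coeff B 0 $ 0 \<noteq> 0"
proof -
  define n where "n = qq D (Suc j) * mm D (Suc j) * degree (PP D (Suc j)) * NN D (Suc j)"
  define X0 Y0 where "X0 = fps_const (zz D (Suc j) powi tt D (Suc j)) * fps_X ^ qq D (Suc j)"
    and "Y0 = smult (fps_X ^ mm D (Suc j)) [:fps_const (zz D (Suc j) powi ss D (Suc j)), 1:]"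
  note S = tower_stepD[OF step, folded n_def X0_def Y0_def]
  define A where "A = pullback (X0, Y0) (tower_H D j)"
  define G c where "G = GG D (Suc j)" "c = tower_c D (Suc j)"
  obtain V where V: "V dvd 1" "fps_of_poly A = fps_const (fps_X ^ n) * fps_of_poly G * V"
    using S(8) unfolding A_def G_c_def by blast
  define A' where "A' = map_poly (fps_shift n) A"
  have sh: "fps_shift n (fps_X ^ n * f) = f" for f :: "'a alg_closure fps"
    by (rule fps_ext) (simp add: fps_X_power_mult_nth)
  have "coeff A i = fps_X ^ n * (fps_of_poly G * V) $ i" for i
  proof -
    have "coeff A i = fps_of_poly A $ i" by simp
    also have "\<dots> = fps_X ^ n * (fps_of_poly G * V) $ i"
      unfolding V(2) mult.assoc by (simp only: fps_mult_left_const_nth)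
    finally show ?thesis .
  qed
  then have c': "coeff A i = fps_X ^ n * coeff A' i" "fps_of_poly A' $ i = (fps_of_poly G * V) $ i" for i
    by (simp_all add: A'_def coeff_map_poly sh)
  then have A: "A = smult (fps_X ^ n) A'" and "fps_of_poly A' = fps_of_poly G * V"
    by (auto intro!: poly_eqI fps_ext)
  with S(6) obtain B where B: "A' = G * B" "V = fps_of_poly B"
    using weierstrass_cofactor unfolding G_c_def by blast
  obtain W where "1 = V * W" using V(1) by (rule dvdE)
  then have "V $ 0 $ 0 * W $ 0 $ 0 = 1" by (metis fps_mult_nth_0 fps_one_nth)
  then have B0: "coeff B 0 $ 0 \<noteq> 0" unfolding B(2) by auto
  have c0: "c $ 0 = 0" using tower_c_0[OF S(6,7)] by (simp add: G_c_def)
  \<comment> \<open>The map \<sigma> is the substitution defining G followed by the shift y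
    \<mapsto> y + c.\<close>
  have "snd (tower_sigma D (Suc j)) = pcompose Y0 [:c, 1:]"
    by (simp add: tower_sigma_def Y0_def G_c_def pcompose_pCons pcompose_smult distrib_left)
  moreover have "fst (tower_sigma D (Suc j)) = X0" by (simp add: tower_sigma_def X0_def)
  ultimately have "pullback (tower_sigma D (Suc j)) (tower_H D j) = pcompose A [:c, 1:]"
    by (simp add: pullback_def A_def pcompose_assoc)
  also have "\<dots> = smult (fps_X ^ n) (tower_H D (Suc j) * pcompose B [:c, 1:])"
    unfolding A B(1) by (simp add: pcompose_smult pcompose_mult tower_H_def G_c_def)
  finally have "pullback (tower_sigma D (Suc j)) (tower_H D j) =
      smult (fps_X ^ n) (tower_H D (Suc j) * pcompose B [:c, 1:])" .
  moreover have "coeff (pcompose B [:c, 1:]) 0 $ 0 \<noteq> 0"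
    unfolding pcompose_shift_mod_x[OF c0] by (rule B0)
  ultimately show ?thesis using that unfolding n_def by blast
qed

text \<open>Here P = Z and z = 0, so y^n is pulled back to x^(m n) y^n. Cancelling leaves y^n = G V
  with V a unit, hence N \<ge> n, while n = q N gives N \<le> n.\<close>

lemma tower_step_monom:
  assumes step: "tower_step D (Suc j)" and H: "tower_H D j = monom 1 n" and n: "n > 0"
  shows "tower_H D (Suc j) = monom 1 n \<and> NN D (Suc j) = n"
proof -
  define q m N s where "q = qq D (Suc j)" "m = mm D (Suc j)" "N = NN D (Suc j)" "s = ss D (Suc j)"
  note S = tower_stepD[OF step, folded q_m_N_s_def]
  have q: "q > 0" using S(1) by (simp add: edge_data_def)
  have wH: "weierstrass (tower_H D j)" unfolding H
    by (auto simp: weierstrass_def degree_monom_eq)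
  have P: "PP D (Suc j) = [:0, 1:]"
    using edge_data_monom[OF H n S(1)] ac_subfield_0[OF ac_subfield_tower_field] ac_subfield_1[OF ac_subfield_tower_field]
    by blast
  have nqN: "n = q * N" using edge_data_degree(1)[OF wH S(1)] unfolding H P by (simp add: degree_monom_eq)
  have "tt D (Suc j) * int m \<ge> 0" using S(4) by simp
  \<comment> \<open>From q s = 1 + t m the exponent s is positive, and therefore z^s = 0 for z =
    0.\<close>
  then have "int q * s \<ge> 1" using S(3) by linarith
  then have "s > 0" using q by (smt (verit) mult_nonneg_nonpos of_nat_0_le_iff)
  then have zs: "zz D (Suc j) powi s = 0" using S(2) unfolding P by (simp add: power_int_0_left)
  obtain V where V: "V dvd 1" "fps_of_poly (pullback (fps_const (zz D (Suc j) powi tt D (Suc j)) * fps_X ^ q,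
            smult (fps_X ^ m) [:fps_const (zz D (Suc j) powi s), 1:]) (monom 1 n))
       = fps_const (fps_X ^ (q * m * degree (PP D (Suc j)) * N)) * fps_of_poly (GG D (Suc j)) * V"
    using S(8) unfolding H by blast
  have "pullback (fps_const (zz D (Suc j) powi tt D (Suc j)) * fps_X ^ q,
            smult (fps_X ^ m) [:fps_const (zz D (Suc j) powi s), 1:]) (monom 1 n) = smult (fps_X ^ (m * n)) (monom 1 n)"
  proof -
    have "[:0, fps_X ^ m :: 'a alg_closure fps:] ^ n = smult (fps_X ^ (m * n)) (monom 1 n)"
    proof -
      have "[:0, fps_X ^ m :: 'a alg_closure fps:] = smult (fps_X ^ m) [:0, 1:]" by simp
      then show ?thesis by (simp only: smult_power[symmetric] power_mult monom_altdef smult_1_left)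
    qed
    then show ?thesis
      unfolding zs pullback_def by (simp add: map_poly_monom pcompose_altdef poly_monom)
  qed
  then have "fps_const (fps_X ^ (m * n)) * fps_of_poly (monom 1 n) = fps_const (fps_X ^ (m * n)) * (fps_of_poly (GG D (Suc j)) * V)"
    using V(2) nqN unfolding P by (simp add: fps_of_poly_smult mult_ac)
  then have eq: "fps_of_poly (monom 1 n) = fps_of_poly (GG D (Suc j)) * V" by simp
  obtain W where W: "V * W = 1" using V(1) by (metis dvdE)
  then have "fps_of_poly (GG D (Suc j)) = fps_X ^ n * W"
    using arg_cong[OF eq, of "\<lambda>x. x * W"] W by (simp add: fps_of_poly_monom' mult.assoc)
  then have cG: "coeff (GG D (Suc j)) i = (if i < n then 0 else W $ (i - n))" for i
    by (simp flip: fps_of_poly_nth add: fps_X_power_mult_nth)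
  have lcG: "coeff (GG D (Suc j)) N = 1" using S(6,7) by (simp add: weierstrass_def)
  then have "n \<le> N" using cG[of N] by (auto split: if_splits)
  moreover have "N \<le> n" using nqN q by simp
  ultimately have [simp]: "N = n" by simp
  have G: "GG D (Suc j) = monom 1 n"
  proof (rule poly_eqI)
    fix i show "coeff (GG D (Suc j)) i = coeff (monom 1 n) i"
      using cG[of i] lcG S(7) coeff_eq_0[of "GG D (Suc j)" i] by (cases i n rule: linorder_cases) auto
  qed
  have "tower_c D (Suc j) = 0"
    using n q_m_N_s_def(3) by (simp add: tower_c_def G)
  then show ?thesis
    using q_m_N_s_def(3) by (simp add: tower_H_def G)
qed


subsection \<open>The tower of a Weierstrass polynomial\<close>

locale tower_run =
  fixes F :: "'k::field fps poly" and g :: nat and D :: "'k tower_data"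
  assumes char: "CHAR('k) = 0 \<or> CHAR('k) > degree F"
    and F: "weierstrass F" and tower: "tower F g D"
begin

lemma step: "j < g \<Longrightarrow> tower_step D (Suc j)"
  and NN_gt_1: "j < g \<Longrightarrow> NN D j > 1"
  using tower unfolding tower_def by (force simp: Ball_def)+

lemma GG_0: "weierstrass (GG D 0)" "degree (GG D 0) = NN D 0"
proof -
  have "fps_ac a = 0 \<longleftrightarrow> a = 0" for a :: "'k fps" by simp
  then have "degree (poly_ac F) = degree F"
    by (metis degree_map_poly)
  then show "weierstrass (GG D 0)" "degree (GG D 0) = NN D 0"
    using F tower by (auto simp: tower_def weierstrass_def coeff_map_poly)
qed

lemma GG: "j \<le> g \<Longrightarrow> weierstrass (GG D j)" "j \<le> g \<Longrightarrow> degree (GG D j) = NN D j"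
  using GG_0 tower_stepD(6,7)[OF step] by (cases j; auto)+

lemmas H = weierstrass_tower_H[OF GG]
lemmas c_0 = tower_c_0[OF GG]

lemma q_pos: "j < g \<Longrightarrow> qq D (Suc j) > 0"
  using tower_stepD(1)[OF step] by (simp add: edge_data_def)

lemma irreducible_PP: "j < g \<Longrightarrow> irreducible_over (tower_field D j) (PP D (Suc j))"
  and lead_coeff_PP: "j < g \<Longrightarrow> lead_coeff (PP D (Suc j)) = 1"
  using tower_stepD(1)[OF step] by (simp_all add: edge_data_def)

lemma NN_Suc: "j < g \<Longrightarrow> NN D j = qq D (Suc j) * degree (PP D (Suc j)) * NN D (Suc j)"
  using edge_data_degree(1)[OF H(1) tower_stepD(1)[OF step]] H(2) by simp

text \<open>A monomial reproduces itself in every later step. It would reach index g with degree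
  above 1 and still be degenerated, against the choice of g.\<close>

lemma not_monom:
  assumes "j < g"
  shows "tower_H D j \<noteq> monom 1 (NN D j)"
proof
  assume A: "tower_H D j = monom 1 (NN D j)"
  have "tower_H D (j + i) = monom 1 (NN D j) \<and> NN D (j + i) = NN D j" if "j + i \<le> g" for i
    using that
  proof (induction i)
    case (Suc i)
    then show ?case
      using tower_step_monom[OF step, of "j + i" "NN D j"] NN_gt_1[OF assms] by auto
  qed (simp add: A)
  from this[of "g - j"] assms have "tower_H D g = monom 1 (NN D j)" "NN D g = NN D j" by auto
  moreover have "degenerated (tower_field D g) (monom 1 (NN D j))"
    by (intro degenerated_monom ac_subfield_0 ac_subfield_1 ac_subfield_tower_field)
  ultimately show False
    using tower NN_gt_1[OF assms] unfolding tower_def by auto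
qed

text \<open>The root 0 forces P = Z by irreducibility. The boundary polynomial is then a power of y,
  which makes H a monomial.\<close>

lemma zz_nonzero:
  assumes "j < g"
  shows "zz D (Suc j) \<noteq> 0"
proof
  assume z: "zz D (Suc j) = 0"
  note S = tower_stepD[OF step[OF assms]]
  have "coeff (PP D (Suc j)) 0 = 0" using S(2) unfolding z poly_0_coeff_0 .
  then have P: "PP D (Suc j) = [:0, 1:]"
    by (intro irreducible_over_root_0[OF irreducible_PP lead_coeff_PP] assms
        ac_subfield_0 ac_subfield_1 ac_subfield_tower_field)
  have j: "j \<le> g" using assms by simp
  have "boundary_poly (tower_H D j) = monom 1 (qq D (Suc j)) ^ NN D (Suc j)"
    using S(1) unfolding edge_data_def P homogenised_X by blast
  then have "boundary_poly (tower_H D j) = monom 1 (degree (tower_H D j))"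
    unfolding H(2)[OF j j] NN_Suc[OF assms] P by (simp add: monom_power)
  then have "tower_H D j = monom 1 (NN D j)"
    using boundary_poly_eq_monom[OF H(1)[OF j j]] H(2)[OF j j] by simp
  then show False using not_monom[OF assms] by simp
qed

text \<open>For m = 0 some power of P would be a power of Z, whose only root is 0.\<close>

lemma m_pos:
  assumes "j < g"
  shows "mm D (Suc j) > 0"
proof (rule Nat.gr0I)
  assume m: "mm D (Suc j) = 0"
  have j: "j \<le> g" using assms by simp
  note S = tower_stepD[OF step[OF assms]]
  have "PP D (Suc j) ^ NN D (Suc j) = monom 1 (NN D j)"
    using edge_data_degree(2)[OF H(1)[OF j j] S(1) m] H(2)[OF j j] by simp
  then have "poly (PP D (Suc j)) (zz D (Suc j)) ^ NN D (Suc j) = zz D (Suc j) ^ NN D j"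
    by (metis mult_1 poly_monom poly_power)
  moreover have "NN D (Suc j) > 0" using NN_Suc[OF assms] NN_gt_1[OF assms] by (intro Nat.gr0I) auto
  ultimately show False using S(2) zz_nonzero[OF assms] by (auto simp: power_0_left)
qed

lemma PP_degree_pos: "j < g \<Longrightarrow> degree (PP D (Suc j)) > 0"
  using irreducible_PP by (simp add: irreducible_over_def)

text \<open>The number \<open>d\<^sub>k\<close>, shown to be the degree of the minimal polynomial in
  \<open>degree_\<phi>\<close>.\<close>

definition dd :: "nat \<Rightarrow> nat" where
  "dd k = (\<Prod>j<k. qq D (Suc j) * degree (PP D (Suc j)))"

lemma dd_Suc: "dd (Suc k) = dd k * (qq D (Suc k) * degree (PP D (Suc k)))"
  by (simp add: dd_def)

lemma dd_pos: "k \<le> g \<Longrightarrow> dd k > 0"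
  unfolding dd_def using q_pos PP_degree_pos by (intro prod_pos) auto

lemma degree_F: "k \<le> g \<Longrightarrow> degree F = NN D k * dd k"
proof (induction k)
  case 0
  then show ?case using tower by (simp add: dd_def tower_def)
next
  case (Suc k)
  then show ?case using NN_Suc[of k] by (simp add: dd_Suc)
qed

text \<open>Both numbers divide deg F > 0, whereas the characteristic is 0 or larger than deg
  F.\<close>

lemma char_not_dvd:
  assumes "j < g"
  shows "of_nat (qq D (Suc j)) \<noteq> (0 :: 'k)" "of_nat (degree (PP D (Suc j))) \<noteq> (0 :: 'k)"
proof -
  have eq: "degree F = NN D (Suc j) * (dd j * (qq D (Suc j) * degree (PP D (Suc j))))"
    using degree_F[of "Suc j"] assms by (simp add: dd_Suc)
  moreover have "degree F > 0"
    using degree_F[of j] NN_gt_1[OF assms] dd_pos[of j] assms by simp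
  ultimately have dvd: "qq D (Suc j) dvd degree F" "degree (PP D (Suc j)) dvd degree F" "degree F > 0"
    by (auto simp: mult_ac intro!: dvd_mult)
  have "of_nat n \<noteq> (0 :: 'k)" if n: "n dvd degree F" for n
  proof
    assume "of_nat n = (0 :: 'k)"
    then have "CHAR('k) dvd n" by (simp add: of_nat_eq_0_iff_char_dvd)
    then have "CHAR('k) dvd degree F" using n dvd_trans by blast
    then show False using char dvd(3) dvd_imp_le by fastforce
  qed
  then show "of_nat (qq D (Suc j)) \<noteq> (0 :: 'k)" "of_nat (degree (PP D (Suc j))) \<noteq> (0 :: 'k)"
    using dvd by blast+
qed

end

declare tower_field.simps(2) [simp del] tower_pi.simps(2) [simp del]

subsection \<open>The parametrisations\<close>

lemma fps_mult_nth_in_subfield: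
  assumes L: "ac_subfield L" and a: "\<And>n. a $ n \<in> L" and b: "\<And>n. b $ n \<in> L"
  shows "(a * b) $ n \<in> L"
  unfolding fps_mult_nth using a b by (intro ac_subfield_sum[OF L] ac_subfield_mult[OF L])

lemma fps_compose_nth_in_subfield:
  assumes L: "ac_subfield L" and a: "\<And>n. a $ n \<in> L" and "\<mu> \<in> L" "e > 0"
  shows "(a oo (fps_const \<mu> * fps_X ^ e)) $ n \<in> L"
  using assms by (simp add: fps_compose_monom_nth ac_subfield_0 ac_subfield_mult ac_subfield_power)

lemma fps_X_power_mult_nth_in_subfield:
  assumes "ac_subfield L" "\<And>n. a $ n \<in> L"
  shows "(fps_X ^ e * a) $ n \<in> L"
  using assms by (simp add: fps_X_power_mult_nth ac_subfield_0)

section \<open>Digits in powers of a monic polynomial, and the fields of the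
  parametrisations\<close>

lemma phi_adic_expansion:
  fixes \<phi> :: "'a::idom poly"
  assumes \<phi>: "lead_coeff \<phi> = 1" "degree \<phi> = n" "n > 0"
  shows "degree A < n * M \<Longrightarrow> \<exists>h. (\<forall>i. degree (h i) < n) \<and> A = (\<Sum>i<M. h i * \<phi> ^ i)"
proof (induction M arbitrary: A)
  case (Suc M)
  obtain Q R where QR: "A = \<phi> * Q + R" "R = 0 \<or> degree R < n"
    using monic_division[OF \<phi>(1)] \<phi>(2) by blast
  have dR: "degree R < n" using QR(2) \<phi>(3) by auto
  show ?case
  proof (cases "Q = 0")
    case True
    have "A = (\<Sum>i<Suc M. (if i = 0 then R else 0) * \<phi> ^ i)"
      using QR(1) True unfolding sum.lessThan_Suc_shift by simp
    then show ?thesis using dR \<phi>(3) by (intro exI[of _ "\<lambda>i. if i = 0 then R else 0"]) auto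
  next
    case False
    have "\<phi> \<noteq> 0" using \<phi> by auto
    then have "degree (\<phi> * Q) = n + degree Q" using False \<phi>(2) by (simp add: degree_mult_eq)
    then have "degree A = n + degree Q" unfolding QR(1) using dR by (subst degree_add_eq_left) auto
    then have "degree Q < n * M" using Suc.prems by simp
    from Suc.IH[OF this] obtain h where h: "\<forall>i. degree (h i) < n" "Q = (\<Sum>i<M. h i * \<phi> ^ i)" by blast
    let ?h = "\<lambda>i. case i of 0 \<Rightarrow> R | Suc j \<Rightarrow> h j"
    have "A = (\<Sum>i<Suc M. ?h i * \<phi> ^ i)"
      unfolding sum.lessThan_Suc_shift QR(1) h(2) by (simp add: sum_distrib_left mult_ac)
    moreover have "\<forall>i. degree (?h i) < n" using h(1) dR by (auto split: nat.splits)
    ultimately show ?thesis by (intro exI[of _ ?h] conjI)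
  qed
qed simp

context tower_run
begin

lemma GG_in_field: "k \<le> g \<Longrightarrow> coeff (GG D k) i $ n \<in> tower_field D k"
proof (cases k)
  case 0
  then show ?thesis using tower by (simp add: tower_def coeff_map_poly)
next
  case (Suc j)
  assume "k \<le> g"
  then show ?thesis using tower_stepD(5)[OF step, of j] Suc unfolding fps_poly_over_def by auto
qed

lemma tower_c_in_field:
  assumes "k \<le> g"
  shows "tower_c D k $ n \<in> tower_field D k"
proof (cases "of_nat (NN D k) = (0 :: 'k alg_closure)")
  case True
  then have "(of_nat (NN D k) :: 'k alg_closure fps) = 0" by (simp add: fps_of_nat[symmetric])
  then show ?thesis by (simp add: tower_c_def ac_subfield_0 ac_subfield_tower_field)
next
  case False
  then have "tower_c D k = fps_const (inverse (of_nat (NN D k))) * - coeff (GG D k) (NN D k - 1)"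
    by (simp add: tower_c_def fps_divide_unit fps_of_nat[symmetric] fps_const_inverse mult.commute)
  then show ?thesis
    using GG_in_field[OF assms] ac_subfield_tower_field[of D k]
    by (simp add: ac_subfield_mult ac_subfield_uminus ac_subfield_inverse ac_subfield_of_nat)
qed

definition ee :: "nat \<Rightarrow> nat" where
  "ee k = (\<Prod>j<k. qq D (Suc j))"

lemma ee_pos: "k \<le> g \<Longrightarrow> ee k > 0"
  unfolding ee_def using q_pos by (intro prod_pos) auto

lemma ee_Suc: "ee (Suc k) = ee k * qq D (Suc k)"
  by (simp add: ee_def)

lemma fst_tower_sigma: "fst (tower_sigma D k) = fps_const (zz D k powi tt D k) * fps_X ^ qq D k"
  by (simp add: tower_sigma_def)

lemma tower_pi_form:
  "k \<le> g \<Longrightarrow> \<exists>\<mu> S R. \<mu> \<in> tower_field D k \<and> \<mu> \<noteq> 0 \<and> (\<forall>n. S $ n \<in> tower_field D k \<and> R $ n \<in> tower_field D k) \<and>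
     tower_pi D k = (fps_const \<mu> * fps_X ^ ee k, [:S, R:])"
proof (induction k)
  case 0
  have "tower_pi D 0 = (fps_const 1 * fps_X ^ ee 0, [:tower_c D 0, 1:])"
    by (simp add: ee_def)
  then show ?case
    using tower_c_in_field[of 0] ac_subfield_tower_field[of D 0] ac_subfield_0 ac_subfield_1
    by (intro exI[of _ 1] exI[of _ "tower_c D 0"] conjI) auto
next
  case (Suc k)
  let ?L = "tower_field D (Suc k)"
  note L = ac_subfield_tower_field[of D "Suc k"]
  obtain \<mu> S R where k: "\<mu> \<in> tower_field D k" "\<mu> \<noteq> 0" "\<And>n. S $ n \<in> tower_field D k"
    "\<And>n. R $ n \<in> tower_field D k" "tower_pi D k = (fps_const \<mu> * fps_X ^ ee k, [:S, R:])"
    using Suc by auto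
  define u q where "u = zz D (Suc k) powi tt D (Suc k)" "q = qq D (Suc k)"
  define b where "b = fps_const (zz D (Suc k) powi ss D (Suc k)) + tower_c D (Suc k)"
  have q: "q > 0" using q_pos Suc.prems by (simp add: u_q_def)
  have z: "zz D (Suc k) \<in> ?L" by (rule tower_field_zz)
  have u: "u \<in> ?L" "u \<noteq> 0"
    using ac_subfield_powi[OF L z] zz_nonzero[of k] Suc.prems by (auto simp: u_q_def)
  have b: "b $ n \<in> ?L" for n
    using ac_subfield_powi[OF L z] tower_c_in_field[OF Suc.prems] ac_subfield_0[OF L]
    by (auto simp: b_def intro!: ac_subfield_add[OF L])
  have \<sigma>: "tower_sigma D (Suc k) = (fps_const u * fps_X ^ q, smult (fps_X ^ mm D (Suc k)) [:b, 1:])"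
    by (simp add: tower_sigma_def u_q_def b_def)
  define X' where "X' = fps_const u * fps_X ^ q"
  have X0: "X' $ 0 = 0" using q by (simp add: X'_def)
  have "fst (tower_pi D (Suc k)) = (fps_const \<mu> * fps_X ^ ee k) oo X'"
    by (simp add: tower_pi.simps xy_comp_def k(5) \<sigma> X'_def)
  also have "\<dots> = fps_const \<mu> * X' ^ ee k"
    using X0 by (simp add: fps_compose_mult_distrib fps_compose_power[symmetric] fps_X_fps_compose_startby0)
  also have "\<dots> = fps_const (\<mu> * u ^ ee k) * fps_X ^ ee (Suc k)"
    by (simp add: X'_def power_mult_distrib fps_const_power ee_Suc u_q_def power_mult[symmetric] mult.commute)
  finally have 1: "fst (tower_pi D (Suc k)) = fps_const (\<mu> * u ^ ee k) * fps_X ^ ee (Suc k)" .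
  have 2: "snd (tower_pi D (Suc k)) = [:(S oo X') + fps_X ^ mm D (Suc k) * (b * (R oo X')), fps_X ^ mm D (Suc k) * (R oo X'):]"
    by (simp add: tower_pi.simps xy_comp_def k(5) \<sigma> X'_def[symmetric] pullback_pCons mult_ac)
  have SR: "(S oo X') $ n \<in> ?L" "(R oo X') $ n \<in> ?L" for n
    unfolding X'_def
    by (rule fps_compose_nth_in_subfield[OF L tower_field_mono[OF k(3)] u(1) q],
        rule fps_compose_nth_in_subfield[OF L tower_field_mono[OF k(4)] u(1) q])
  show ?case
  proof (intro exI conjI allI)
    show "tower_pi D (Suc k) = (fps_const (\<mu> * u ^ ee k) * fps_X ^ ee (Suc k),
      [:(S oo X') + fps_X ^ mm D (Suc k) * (b * (R oo X')), fps_X ^ mm D (Suc k) * (R oo X'):])"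
      using 1 2 by (simp add: prod_eq_iff del: tower_pi.simps)
    show "\<mu> * u ^ ee k \<in> ?L" 
      by (intro ac_subfield_mult[OF L] ac_subfield_power[OF L] u(1) tower_field_mono[OF k(1)])
    show "\<mu> * u ^ ee k \<noteq> 0" using k(2) u(2) by simp
    fix n
    show "((S oo X') + fps_X ^ mm D (Suc k) * (b * (R oo X'))) $ n \<in> ?L"
      unfolding fps_add_nth using SR b
      by (intro ac_subfield_add[OF L] fps_X_power_mult_nth_in_subfield[OF L] fps_mult_nth_in_subfield[OF L])
    show "(fps_X ^ mm D (Suc k) * (R oo X')) $ n \<in> ?L"
      using SR by (intro fps_X_power_mult_nth_in_subfield[OF L])
  qed
qed

definition \<mu> :: "nat \<Rightarrow> 'k alg_closure" where
  "\<mu> k = fst (tower_pi D k) $ ee k"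

lemma tower_pi:
  assumes "k \<le> g"
  shows "\<mu> k \<in> tower_field D k" "\<mu> k \<noteq> 0" "fst (tower_pi D k) = fps_const (\<mu> k) * fps_X ^ ee k"
    "coeff (snd (tower_pi D k)) 0 $ n \<in> tower_field D k" "fst (tower_pi D k) $ 0 = 0"
  using tower_pi_form[OF assms] ee_pos[OF assms] by (auto simp: \<mu>_def simp del: tower_pi.simps)

section \<open>Pullback along the parametrisations\<close>

definition pb :: "nat \<Rightarrow> 'k fps poly \<Rightarrow> 'k alg_closure fps poly" where
  "pb k A = pullback (tower_pi D k) (poly_ac A)"

lemma poly_ac_hom:
  "poly_ac (A + B) = poly_ac A + poly_ac (B :: 'k fps poly)"
  "poly_ac (A * B) = poly_ac A * poly_ac (B :: 'k fps poly)"
  "poly_ac (A ^ n) = poly_ac (A :: 'k fps poly) ^ n"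
  by (simp_all add: map_poly_hom_add map_poly_hom_mult map_poly_hom_power)

lemma poly_ac_sum: "poly_ac (sum f I) = (\<Sum>i\<in>I. poly_ac (f i :: 'k fps poly))"
  by (simp add: map_poly_hom_sum)

lemma pb_0 [simp]: "pb k 0 = 0"
  by (simp add: pb_def)

lemma pb_sum: "pb k (sum f I) = (\<Sum>i\<in>I. pb k (f i))"
  by (simp add: pb_def poly_ac_sum pullback_sum)

lemma pb_mult: "k \<le> g \<Longrightarrow> pb k (A * B) = pb k A * pb k B"
  by (simp add: pb_def poly_ac_hom pullback_mult tower_pi(5))

lemma pb_power: "k \<le> g \<Longrightarrow> pb k (A ^ n) = pb k A ^ n"
  by (simp add: pb_def poly_ac_hom pullback_power tower_pi(5))

lemma pb_1 [simp]: "pb k 1 = 1"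
  by (simp add: pb_def)

lemma pb_prod: "k \<le> g \<Longrightarrow> pb k (prod f I) = (\<Prod>i\<in>I. pb k (f i))"
  by (induction I rule: infinite_finite_induct) (simp_all add: pb_mult)

lemma pb_const: "pb k [:a:] = [:fps_ac a oo fst (tower_pi D k):]"
  by (simp add: pb_def map_poly_pCons)

lemma pb_Suc:
  assumes "k < g"
  shows "pb (Suc k) A = pullback (tower_sigma D (Suc k)) (pb k A)"
  using tower_pi(5)[of k] q_pos[OF assms] assms
  by (simp add: pb_def pullback_comp fst_tower_sigma tower_pi.simps)

text \<open>Setting y = 0 restricts to the curve parametrised by the first component of the map and
  the constant coefficient of the second.\<close>

lemma coeff_pb_0: "coeff (pb k A) 0 = poly (map_poly (\<lambda>a. fps_ac a oo fst (tower_pi D k)) A) (coeff (snd (tower_pi D k)) 0)"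
  unfolding pb_def coeff_pullback_0 by (subst map_poly_map_poly) (auto simp: o_def)

lemma minimal_poly_pb: "minimal_poly D k \<psi> \<Longrightarrow> coeff (pb k \<psi>) 0 = 0"
  unfolding minimal_poly_def pb_def coeff_pullback_0 by simp

lemma monom_unit_val_lambda:
  assumes "monom_unit (pb k A) w i c" "c \<noteq> 0"
  shows "val_k D k A = enat w" "lambda_k D k A = c"
proof -
  show v: "val_k D k A = enat w"
    using monom_unit_v_x_poly[OF assms] by (simp add: val_k_def pb_def)
  have "A \<noteq> 0" using monom_unit_nonzero[OF assms] by auto
  then show "lambda_k D k A = c"
    using monom_unit_trailing_coeff[OF assms] by (simp add: lambda_k_def v pb_def)
qed

lemma monom_unit_const:
  assumes k: "k \<le> g" and a: "a \<noteq> 0"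
  shows "monom_unit (pb k [:a:]) (ee k * subdegree a) 0 (to_ac (a $ subdegree a) * \<mu> k ^ subdegree a)"
proof -
  let ?w = "ee k * subdegree a"
  let ?b = "fps_ac a oo (fps_const (\<mu> k) * fps_X ^ ee k)"
  have b: "?b $ n = (if ee k dvd n then to_ac (a $ (n div ee k)) * \<mu> k ^ (n div ee k) else 0)" for n
    by (subst fps_compose_monom_nth[OF ee_pos[OF k]]) simp
  have "?b = fps_X ^ ?w * fps_shift ?w ?b"
  proof (rule fps_ext)
    fix n
    have "?b $ n = 0" if "n < ?w"
    proof (cases "ee k dvd n")
      case True
      then obtain j where j: "n = ee k * j" by blast
      then have "j < subdegree a" using that by simp
      then have "a $ j = 0" by (rule nth_less_subdegree_zero)
      then show ?thesis unfolding b using j ee_pos[OF k] by simp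
    qed (simp add: b)
    then show "?b $ n = (fps_X ^ ?w * fps_shift ?w ?b) $ n"
      by (simp add: fps_X_power_mult_nth)
  qed
  then have "pb k [:a:] = monom (fps_X ^ ?w) 0 * [:fps_shift ?w ?b:]"
    using tower_pi(3)[OF k] by (simp add: pb_const monom_0 mult.commute)
  moreover have "coeff [:fps_shift ?w ?b:] 0 $ 0 = to_ac (a $ subdegree a) * \<mu> k ^ subdegree a"
    using ee_pos[OF k] by (simp add: b)
  ultimately show ?thesis unfolding monom_unit_def by blast
qed

text \<open>Each \<sigma> turns one H into a power of x times the next H and a unit, and a cofactor
  with nonzero constant term keeps that property under pullback.\<close>

lemma pb_F:
  "k \<le> g \<Longrightarrow> \<exists>v U. pb k F = smult (fps_X ^ v) (tower_H D k * U) \<and> coeff U 0 $ 0 \<noteq> 0"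
proof (induction k)
  case 0
  have "pb 0 F = tower_H D 0"
    using tower by (simp add: pb_def tower_H_def tower_def pullback_def)
  then show ?case by (intro exI[of _ 0] exI[of _ 1]) simp
next
  case (Suc k)
  then have k: "k < g" by simp
  obtain v U where U: "pb k F = smult (fps_X ^ v) (tower_H D k * U)" "coeff U 0 $ 0 \<noteq> 0"
    using Suc by auto
  define \<sigma> where "\<sigma> = tower_sigma D (Suc k)"
  define u q where "u = zz D (Suc k) powi tt D (Suc k)" "q = qq D (Suc k)"
  obtain n B where B: "pullback \<sigma> (tower_H D k) = smult (fps_X ^ n) (tower_H D (Suc k) * B)" "coeff B 0 $ 0 \<noteq> 0"
    unfolding \<sigma>_def using tower_step_factor[OF step[OF k]] by metis
  have \<sigma>1: "fst \<sigma> = fps_const u * fps_X ^ q" by (simp add: \<sigma>_def u_q_def fst_tower_sigma)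
  have s0: "fst \<sigma> $ 0 = 0" unfolding \<sigma>1 using q_pos[OF k] by (simp add: u_q_def)
  have u: "u \<noteq> 0" using zz_nonzero[OF k] by (simp add: u_q_def)
  have X': "fps_X ^ v oo fst \<sigma> = fps_const (u ^ v) * fps_X ^ (q * v)"
    using fps_compose_power[OF s0, of fps_X v] fps_X_fps_compose_startby0[OF s0]
    by (simp add: \<sigma>1 power_mult_distrib power_mult)
  have "monom_unit U 0 0 (coeff U 0 $ 0)" unfolding monom_unit_def by (intro exI[of _ U]) simp
  then have "low_coeffs (pullback \<sigma> U) 0 (coeff U 0 $ 0) 0"
    using low_coeffs_pullback[where T = U and w = 0 and i = 0 and u = u and q = q and m = "mm D (Suc k)"
        and b = "fps_const (zz D (Suc k) powi ss D (Suc k)) + tower_c D (Suc k)"] q_pos[OF k] m_pos[OF k]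
    by (simp add: \<sigma>_def tower_sigma_def u_q_def)
  then have U': "coeff (pullback \<sigma> U) 0 $ 0 \<noteq> 0" using U(2) by (auto simp: low_coeffs_def)
  have "pb (Suc k) F = smult (fps_X ^ v oo fst \<sigma>) (pullback \<sigma> (tower_H D k) * pullback \<sigma> U)"
    unfolding pb_Suc[OF k] U(1) \<sigma>_def[symmetric] by (simp add: pullback_smult[OF s0] pullback_mult[OF s0])
  also have "\<dots> = smult (fps_X ^ (q * v + n)) (tower_H D (Suc k) * smult (fps_const (u ^ v)) (B * pullback \<sigma> U))"
    unfolding B(1) X' by (simp add: power_add mult_ac)
  finally show ?case
    using B(2) U' u by (intro exI[of _ "q * v + n"] exI[of _ "smult (fps_const (u ^ v)) (B * pullback \<sigma> U)"])
      (simp add: coeff_mult_0)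
qed

end


subsection \<open>Minimal polynomials\<close>

text \<open>Brings the coefficients of \<open>low_coeffs_pullback\<close> into the form of
  \<open>edge_sum\<close>. The factor z^(-s) in the second comes from differentiating (y + z^s)^i at
  0; for i = 0 both sides are 0.\<close>

lemma powi_edge:
  fixes z :: "'a::field"
  assumes "z \<noteq> 0"
  shows "(z powi t) ^ w * (z powi s) ^ i = z powi (t * int w + s * int i)"
    and "(z powi t) ^ w * (of_nat i * (z powi s) ^ (i - 1)) =
      z powi (- s) * (of_nat i * z powi (t * int w + s * int i))"
proof -
  have 1: "(z powi t) ^ w * (z powi s) ^ i = z powi (t * int w + s * int i)" for i
    using assms by (simp add: power_int_add power_int_mult)
  show "(z powi t) ^ w * (z powi s) ^ i = z powi (t * int w + s * int i)" by (rule 1)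
  show "(z powi t) ^ w * (of_nat i * (z powi s) ^ (i - 1)) =
      z powi (- s) * (of_nat i * z powi (t * int w + s * int i))"
  proof (cases i)
    case (Suc j)
    have "t * int w + s * int (Suc j) = s + (t * int w + s * int j)" by (simp add: algebra_simps)
    then have "z powi (- s) * z powi (t * int w + s * int (Suc j)) = z powi (t * int w + s * int j)"
      using assms by (simp add: power_int_add power_int_minus)
    then show ?thesis using Suc 1[of j] by (simp add: mult_ac del: of_nat_Suc)
  qed simp
qed

locale tower_min = tower_run F g D
  for F :: "'k::field fps poly" and g :: nat and D :: "'k tower_data" +
  fixes \<phi> :: "nat \<Rightarrow> 'k fps poly" and K :: nat
  assumes K: "K \<le> g" and \<phi>: "\<And>i. i \<le> K \<Longrightarrow> minimal_poly D i (\<phi> i)"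
begin

text \<open>The constant coefficient S of the second component has a nonzero annihilator of degree
  at most \<open>dd k\<close> by \<open>exists_annihilator\<close>, and \<phi> has least degree
  among the annihilators.\<close>

lemma degree_\<phi>_le:
  assumes k: "k \<le> K"
  shows "degree (\<phi> k) \<le> dd k"
proof -
  have kg: "k \<le> g" using k K by simp
  define u S where "u = fst (tower_pi D k)" and "S = coeff (snd (tower_pi D k)) 0"
  have u: "u = fps_const (\<mu> k) * fps_X ^ ee k" using tower_pi(3)[OF kg] by (simp add: u_def)
  have u0: "u $ 0 = 0" using tower_pi(5)[OF kg] by (simp add: u_def)
  let ?f = "\<Prod>j<k. degree (PP D (Suc j))"
  have "irreducible_over (tower_field D j) (PP D (Suc j)) \<and> PP D (Suc j) \<noteq> 0
      \<and> poly (PP D (Suc j)) (zz D (Suc j)) = 0" if "j < k" for j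
    using PP_degree_pos[of j] irreducible_PP[of j] tower_stepD(2)[OF step, of j] that kg by auto
  from tower_field_span[OF this] obtain \<omega> where
    \<omega>: "\<forall>c\<in>tower_field D k. \<exists>\<kappa> :: nat \<Rightarrow> 'k. c = (\<Sum>a<?f. to_ac (\<kappa> a) * \<omega> a)"
    by (rule exE)
  note \<omega> = bspec[OF \<omega>]
  obtain A :: "'k fps poly" where A: "A \<noteq> 0" "degree A \<le> ?f * ee k"
    "poly (map_poly (\<lambda>a. fps_ac a oo u) A) S = 0"
    using exists_annihilator[OF ac_subfield_tower_field \<omega> tower_pi(1,2)[OF kg] ee_pos[OF kg] tower_pi(4)[OF kg]]
    unfolding u S_def by blast
  have "poly (map_poly (\<lambda>a. fps_ac a oo u) (\<phi> k)) S = 0"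
    using minimal_poly_pb[OF \<phi>[OF k]] unfolding coeff_pb_0 u_def S_def .
  moreover have "a = 0" if "fps_ac a oo u = 0" for a :: "'k fps"
    using that tower_pi(2)[OF kg] unfolding fps_compose_eq_0_iff[OF u0] by (auto simp: u)
  moreover have "irreducible (\<phi> k)" using \<phi>[OF k] by (simp add: minimal_poly_def)
  ultimately have "degree (\<phi> k) \<le> degree A"
    by (intro degree_le_annihilator[where h = "\<lambda>a. fps_ac a oo u" and S = S])
       (auto simp: fps_compose_add_distrib fps_compose_mult_distrib u0 A)
  also have "\<dots> \<le> dd k" using A(2) by (simp add: dd_def ee_def prod.distrib mult.commute)
  finally show ?thesis .
qed

text \<open>Together with \<open>simple_root\<close> this is the statement proved by induction on k.
  Coefficients are kept in the k-th field because the root minimality of the next step is relative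
  to it.\<close>

definition short_unit :: "nat \<Rightarrow> bool" where
  "short_unit k \<longleftrightarrow> (\<forall>A. A \<noteq> 0 \<longrightarrow> degree A < dd k \<longrightarrow>
     (\<exists>w c. c \<in> tower_field D k \<and> c \<noteq> 0 \<and> monom_unit (pb k A) w 0 c))"

text \<open>The pullback of \<phi> has constant coefficient 0 in y, which is excluded for nonzero
  polynomials of degree below \<open>dd k\<close>.\<close>

lemma short_unit_degree:
  assumes k: "k \<le> K" and s: "short_unit k"
  shows "degree (\<phi> k) = dd k"
proof (rule antisym[OF degree_\<phi>_le[OF k]], rule ccontr)
  assume "\<not> dd k \<le> degree (\<phi> k)"
  moreover have "\<phi> k \<noteq> 0" using \<phi>[OF k] by (auto simp: minimal_poly_def)
  ultimately obtain w c where "c \<noteq> 0" "monom_unit (pb k (\<phi> k)) w 0 c"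
    using s unfolding short_unit_def by (meson not_le)
  then have "coeff (pb k (\<phi> k)) 0 $ w \<noteq> 0" using monom_unit_nth(2) by metis
  then show False using minimal_poly_pb[OF \<phi>[OF k]] by simp
qed

definition simple_root :: "nat \<Rightarrow> bool" where
  "simple_root k \<longleftrightarrow> (\<exists>v c. c \<in> tower_field D k \<and> c \<noteq> 0 \<and> monom_unit (pb k (\<phi> k)) v 1 c)"

text \<open>In the \<phi>-adic expansion of A, the term with exponent b is pulled back to
  x^(\<omega> b) y^b times a unit. The next \<sigma> gives it order q \<omega> b + m b in x, and I
  collects the b for which this is least.\<close>

lemma step_low_coeffs:
  assumes k: "k < K" and short: "short_unit k" and root: "simple_root k"
    and A: "A \<noteq> 0" "degree A < dd k * M"
  obtains I \<omega> \<kappa> W where "finite I" "I \<noteq> {}"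
    "\<And>b. b \<in> I \<Longrightarrow> b < M \<and> \<kappa> b \<in> tower_field D k \<and> \<kappa> b \<noteq> 0 \<and> qq D (Suc k) * \<omega> b + mm D (Suc k) * b = W"
    "low_coeffs (pb (Suc k) A) W
       (\<Sum>b\<in>I. \<kappa> b * zz D (Suc k) powi (tt D (Suc k) * int (\<omega> b) + ss D (Suc k) * int b))
       (zz D (Suc k) powi (- ss D (Suc k)) *
         (\<Sum>b\<in>I. \<kappa> b * of_nat b * zz D (Suc k) powi (tt D (Suc k) * int (\<omega> b) + ss D (Suc k) * int b)))"
proof -
  have kg: "k < g" using k K by simp
  have kK: "k \<le> K" using k by simp
  define q m s t z where "q = qq D (Suc k)" "m = mm D (Suc k)" "s = ss D (Suc k)" "t = tt D (Suc k)" "z = zz D (Suc k)"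
  note L = ac_subfield_tower_field[of D k]
  have z: "z \<noteq> 0" using zz_nonzero[OF kg] by (simp add: q_m_s_t_z_def)
  have lc: "lead_coeff (\<phi> k) = 1" using \<phi>[OF kK] by (simp add: minimal_poly_def)
  obtain v \<rho> where \<rho>: "\<rho> \<in> tower_field D k" "\<rho> \<noteq> 0" "monom_unit (pb k (\<phi> k)) v 1 \<rho>"
    using root unfolding simple_root_def by blast
  obtain h where h: "\<And>i. degree (h i) < dd k" "A = (\<Sum>i<M. h i * \<phi> k ^ i)"
    using phi_adic_expansion[OF lc short_unit_degree[OF kK short] dd_pos A(2)] kg by auto
  define I0 where "I0 = {i \<in> {..<M}. h i \<noteq> 0}"
  have I0: "finite I0" by (simp add: I0_def)
  have A': "A = (\<Sum>i\<in>I0. h i * \<phi> k ^ i)"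
    unfolding h(2) I0_def by (rule sum.mono_neutral_right) auto
  then have "I0 \<noteq> {}" using A(1) by auto
  have "\<exists>w c. c \<in> tower_field D k \<and> c \<noteq> 0 \<and> monom_unit (pb k (h i)) w 0 c" if "i \<in> I0" for i
    using short h(1)[of i] that unfolding short_unit_def I0_def by blast
  then obtain w c where wc: "\<And>i. i \<in> I0 \<Longrightarrow> c i \<in> tower_field D k \<and> c i \<noteq> 0 \<and> monom_unit (pb k (h i)) (w i) 0 (c i)"
    by metis
  define \<omega> \<kappa> where "\<omega> = (\<lambda>i. w i + i * v)" and "\<kappa> = (\<lambda>i. c i * \<rho> ^ i)"
  have "monom_unit (pb k (h i * \<phi> k ^ i)) (\<omega> i) i (\<kappa> i)" if "i \<in> I0" for i
    using monom_unit_mult[of "pb k (h i)" "w i" 0 "c i"] monom_unit_power[OF \<rho>(3), of i] wc[OF that] kg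
    by (simp add: pb_mult pb_power \<omega>_def \<kappa>_def)
  note MU = this
  define W where "W = Min ((\<lambda>i. q * \<omega> i + m * i) ` I0)"
  define I where "I = {i \<in> I0. q * \<omega> i + m * i = W}"
  have W_le: "W \<le> q * \<omega> i + m * i" if "i \<in> I0" for i using that I0 by (simp add: W_def)
  have "W \<in> (\<lambda>i. q * \<omega> i + m * i) ` I0" unfolding W_def using I0 \<open>I0 \<noteq> {}\<close> by (intro Min_in) auto
  then have I: "finite I" "I \<noteq> {}" using I0 by (auto simp: I_def)
  have c0: "tower_c D (Suc k) $ 0 = 0" using c_0[of "Suc k"] kg by simp
  have low: "low_coeffs (pb (Suc k) (h i * \<phi> k ^ i)) (q * \<omega> i + m * i)
      (\<kappa> i * z powi (t * int (\<omega> i) + s * int i))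
      (z powi (- s) * (\<kappa> i * of_nat i * z powi (t * int (\<omega> i) + s * int i)))" if "i \<in> I0" for i
  proof -
    have "low_coeffs (pb (Suc k) (h i * \<phi> k ^ i)) (q * \<omega> i + m * i)
      (\<kappa> i * (z powi t) ^ \<omega> i * (z powi s) ^ i)
      (\<kappa> i * (z powi t) ^ \<omega> i * (of_nat i * (z powi s) ^ (i - 1)))"
      using low_coeffs_pullback[OF MU[OF that] q_pos[OF kg] m_pos[OF kg], where u = "z powi t"
          and b = "fps_const (z powi s) + tower_c D (Suc k)"] c0
      unfolding pb_Suc[OF kg] tower_sigma_def q_m_s_t_z_def by simp
    then show ?thesis
      unfolding mult.assoc powi_edge[OF z] by (simp add: mult_ac)
  qed
  have "pb (Suc k) A = (\<Sum>i\<in>I0. pb (Suc k) (h i * \<phi> k ^ i))"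
    unfolding A' pb_sum ..
  then have "low_coeffs (pb (Suc k) A) W
     (\<Sum>b\<in>I. \<kappa> b * z powi (t * int (\<omega> b) + s * int b))
     (\<Sum>b\<in>I. z powi (- s) * (\<kappa> b * of_nat b * z powi (t * int (\<omega> b) + s * int b)))"
    unfolding I_def using low_coeffs_sum[OF I0 low W_le] by simp
  then show ?thesis
    using that[OF I, of \<kappa> \<omega> W] wc \<rho>(1,2) L
    unfolding q_m_s_t_z_def sum_distrib_left
    by (force simp: I_def I0_def \<kappa>_def q_m_s_t_z_def intro: ac_subfield_mult ac_subfield_power)
qed

lemma tower_field_powi:
  "x \<in> tower_field D k \<Longrightarrow> x * zz D (Suc k) powi i \<in> tower_field D (Suc k)"
  "x \<in> tower_field D (Suc k) \<Longrightarrow> zz D (Suc k) powi i * x \<in> tower_field D (Suc k)"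
  using ac_subfield_tower_field[of D "Suc k"] tower_field_zz[of D k]
  by (auto intro: ac_subfield_mult ac_subfield_powi tower_field_mono)

text \<open>Below degree \<open>dd (Suc k)\<close> only exponents b < q deg P occur, so
  \<open>edge_sum_eq_0\<close> forbids the leading sum to vanish.\<close>

lemma short_unit_Suc:
  assumes k: "k < K" and short: "short_unit k" and root: "simple_root k"
  shows "short_unit (Suc k)"
  unfolding short_unit_def
proof (intro allI impI)
  fix A :: "'k fps poly" assume A: "A \<noteq> 0" "degree A < dd (Suc k)"
  have kg: "k < g" using k K by simp
  note S = tower_stepD[OF step[OF kg]]
  let ?q = "qq D (Suc k)" and ?m = "mm D (Suc k)" and ?z = "zz D (Suc k)" and ?t = "tt D (Suc k)" and ?s = "ss D (Suc k)"
  obtain I \<omega> \<kappa> W where I: "finite I" "I \<noteq> {}"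
    "\<And>b. b \<in> I \<Longrightarrow> b < ?q * degree (PP D (Suc k)) \<and> \<kappa> b \<in> tower_field D k \<and> \<kappa> b \<noteq> 0 \<and> ?q * \<omega> b + ?m * b = W"
    and low: "low_coeffs (pb (Suc k) A) W (\<Sum>b\<in>I. \<kappa> b * ?z powi (?t * int (\<omega> b) + ?s * int b))
       (?z powi (- ?s) * (\<Sum>b\<in>I. \<kappa> b * of_nat b * ?z powi (?t * int (\<omega> b) + ?s * int b)))"
    by (rule step_low_coeffs[OF k short root A(1) A(2)[unfolded dd_Suc]]) (rule that)
  let ?c = "\<Sum>b\<in>I. \<kappa> b * ?z powi (?t * int (\<omega> b) + ?s * int b)"
  obtain b where b: "b \<in> I" using I(2) by blast
  have "?c \<noteq> 0"
    using edge_sum_eq_0[OF ac_subfield_tower_field irreducible_PP[OF kg] S(2) zz_nonzero[OF kg] q_pos[OF kg] S(3) I(1)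
        _ _ _ _ b, of \<omega> W \<kappa>] I(3) b by blast
  moreover have "?c \<in> tower_field D (Suc k)"
    using I(3) tower_field_powi by (intro ac_subfield_sum ac_subfield_tower_field) auto
  ultimately show "\<exists>w c. c \<in> tower_field D (Suc k) \<and> c \<noteq> 0 \<and> monom_unit (pb (Suc k) A) w 0 c"
    using low_coeffs_0_monom_unit[OF low] by blast
qed

text \<open>The pullback vanishes at y = 0, hence so does the leading sum. By
  \<open>edge_sum_deriv_nonzero\<close> the coefficient of y does not, so exactly one factor y
  splits off.\<close>

lemma simple_root_Suc:
  assumes k: "k < K" and short: "short_unit k" and root: "simple_root k"
  shows "simple_root (Suc k)"
proof -
  have kg: "k < g" and kK: "Suc k \<le> K" using k K by simp_all
  note S = tower_stepD[OF step[OF kg]]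
  let ?q = "qq D (Suc k)" and ?m = "mm D (Suc k)" and ?z = "zz D (Suc k)" and ?t = "tt D (Suc k)" and ?s = "ss D (Suc k)"
  let ?A = "\<phi> (Suc k)"
  have dpos: "dd k > 0" using dd_pos kg by simp
  \<comment> \<open>One more digit than in \<open>short_unit_Suc\<close>: the degree may equal
    \<open>dd (Suc k)\<close>, and then the exponent b = q deg P occurs.\<close>
  have dA: "degree ?A < dd k * (?q * degree (PP D (Suc k)) + 1)"
    using degree_\<phi>_le[OF kK] dpos unfolding dd_Suc by simp
  have A0: "?A \<noteq> 0" using \<phi>[OF kK] by (auto simp: minimal_poly_def)
  obtain I \<omega> \<kappa> W where I: "finite I" "I \<noteq> {}"
    "\<And>b. b \<in> I \<Longrightarrow> b < ?q * degree (PP D (Suc k)) + 1 \<and> \<kappa> b \<in> tower_field D k \<and> \<kappa> b \<noteq> 0 \<and> ?q * \<omega> b + ?m * b = W"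
    and low: "low_coeffs (pb (Suc k) ?A) W (\<Sum>b\<in>I. \<kappa> b * ?z powi (?t * int (\<omega> b) + ?s * int b))
       (?z powi (- ?s) * (\<Sum>b\<in>I. \<kappa> b * of_nat b * ?z powi (?t * int (\<omega> b) + ?s * int b)))"
    by (rule step_low_coeffs[OF k short root A0 dA]) (rule that)
  let ?c = "\<Sum>b\<in>I. \<kappa> b * ?z powi (?t * int (\<omega> b) + ?s * int b)"
  let ?c' = "?z powi (- ?s) * (\<Sum>b\<in>I. \<kappa> b * of_nat b * ?z powi (?t * int (\<omega> b) + ?s * int b))"
  have pb0: "coeff (pb (Suc k) ?A) 0 = 0" using minimal_poly_pb[OF \<phi>[OF kK]] .
  then have c0: "?c = 0" using low unfolding low_coeffs_def by (auto simp del: of_nat_Suc)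
  obtain b where b: "b \<in> I" using I(2) by blast
  have I': "b \<le> ?q * degree (PP D (Suc k))" "?q * \<omega> b + ?m * b = W" "\<kappa> b \<in> tower_field D k" if "b \<in> I" for b
    using I(3)[OF that] by auto
  have "(\<Sum>b\<in>I. \<kappa> b * of_nat b * ?z powi (?t * int (\<omega> b) + ?s * int b)) \<noteq> 0"
    using edge_sum_deriv_nonzero[OF ac_subfield_tower_field irreducible_PP[OF kg] S(2) zz_nonzero[OF kg] q_pos[OF kg]
       S(3) I(1) I'(2,3,1) char_not_dvd[OF kg] c0 b] I(3)[OF b] by blast
  then have "?c' \<noteq> 0" using zz_nonzero[OF kg] by simp
  moreover have "?c' \<in> tower_field D (Suc k)"
    using I(3) by (intro tower_field_powi(2) ac_subfield_sum[OF ac_subfield_tower_field] tower_field_powi(1)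
        ac_subfield_mult[OF ac_subfield_tower_field] ac_subfield_of_nat[OF ac_subfield_tower_field]) auto
  ultimately show ?thesis
    using low_coeffs_1_monom_unit[OF low pb0] unfolding simple_root_def by blast
qed

lemma short_unit_0: "short_unit 0"
  unfolding short_unit_def
proof (intro allI impI)
  fix A :: "'k fps poly" assume A: "A \<noteq> 0" "degree A < dd 0"
  then have "degree A = 0" by (simp add: dd_def)
  then obtain a where a: "A = [:a:]" by (rule degree_eq_zeroE)
  then have "a \<noteq> 0" using A by auto
  have L: "ac_subfield (tower_field D 0)" by (rule ac_subfield_tower_field)
  have "to_ac (a $ subdegree a) * \<mu> 0 ^ subdegree a \<in> tower_field D 0"
    by (intro ac_subfield_mult[OF L] ac_subfield_power[OF L] ac_subfield_to_ac[OF L] tower_pi(1)) simp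
  moreover have "to_ac (a $ subdegree a) * \<mu> 0 ^ subdegree a \<noteq> 0"
    using \<open>a \<noteq> 0\<close> tower_pi(2)[of 0] by simp
  ultimately show "\<exists>w c. c \<in> tower_field D 0 \<and> c \<noteq> 0 \<and> monom_unit (pb 0 A) w 0 c"
    using monom_unit_const[of 0 a] \<open>a \<noteq> 0\<close> unfolding a by blast
qed

text \<open>Here \<phi> is y - c with c = \<open>tower_c D 0\<close>, and its pullback is y.\<close>

lemma simple_root_0: "simple_root 0"
proof -
  have d: "degree (\<phi> 0) = 1" using short_unit_degree[OF _ short_unit_0] by (simp add: dd_def)
  have lc: "lead_coeff (\<phi> 0) = 1" using \<phi>[of 0] by (simp add: minimal_poly_def)
  obtain a where "\<phi> 0 = [:a, 1:]"
  proof (cases "\<phi> 0")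
    case (pCons a p)
    then have "degree p = 0" using d by (auto split: if_splits)
    then obtain b where "p = [:b:]" by (rule degree_eq_zeroE)
    then show ?thesis using that[of a] pCons lc d by (auto split: if_splits)
  qed
  then have pb: "pb 0 (\<phi> 0) = [:fps_ac a + tower_c D 0, 1:]"
    by (simp add: pb_def map_poly_pCons pullback_pCons)
  then have "fps_ac a + tower_c D 0 = 0" using minimal_poly_pb[OF \<phi>[of 0]] by simp
  then have "monom_unit (pb 0 (\<phi> 0)) 0 1 1"
    unfolding pb monom_unit_def by (intro exI[of _ 1]) (simp add: monom_altdef)
  moreover have "1 \<in> tower_field D 0" by (rule ac_subfield_1[OF ac_subfield_tower_field])
  ultimately show ?thesis unfolding simple_root_def by (metis zero_neq_one)
qed

lemma short_unit_simple_root: "k \<le> K \<Longrightarrow> short_unit k \<and> simple_root k"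
  by (induction k) (auto intro: short_unit_0 simple_root_0 short_unit_Suc simple_root_Suc)

lemma degree_\<phi>: "k \<le> K \<Longrightarrow> degree (\<phi> k) = dd k"
  using short_unit_degree short_unit_simple_root by blast

lemma lead_coeff_\<phi>: "k \<le> K \<Longrightarrow> lead_coeff (\<phi> k) = 1"
  using \<phi> by (auto simp: minimal_poly_def)

end


subsection \<open>Linear independence of the leading coefficients\<close>

context tower_min
begin

text \<open>Position r carries the index r - 1, as in \<open>Phi_list\<close>.\<close>

definition Ph :: "nat \<Rightarrow> 'k fps poly" where
  "Ph r = (case r of 0 \<Rightarrow> [:fps_X:] | Suc j \<Rightarrow> \<phi> j)"

definition vv :: "nat \<Rightarrow> nat \<Rightarrow> nat" where
  "vv k r = the_enat (val_k D k (Ph r))"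

definition LL :: "nat \<Rightarrow> nat \<Rightarrow> 'k alg_closure" where
  "LL k r = lambda_k D k (Ph r)"

lemma vv_LL_eqI:
  assumes "monom_unit (pb k (Ph r)) w i c" "c \<noteq> 0"
  shows "vv k r = w" "LL k r = c" "val_k D k (Ph r) = enat (vv k r)"
  using monom_unit_val_lambda[OF assms] by (simp_all add: vv_def LL_def)

text \<open>Under \<sigma> the variable y becomes x^m times y + z^s + ..., a unit since z is
  nonzero. The factor y^i is absorbed into the power of x and the constant.\<close>

lemma monom_unit_Ph_Suc:
  assumes k: "k < K" and c: "monom_unit (pb k (Ph r)) w i c" "c \<noteq> 0"
  shows "monom_unit (pb (Suc k) (Ph r)) (qq D (Suc k) * w + mm D (Suc k) * i) 0
     (c * zz D (Suc k) powi (tt D (Suc k) * int w + ss D (Suc k) * int i))"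
proof -
  have kg: "k < g" using k K by simp
  have c0: "tower_c D (Suc k) $ 0 = 0" using c_0[of "Suc k"] kg by simp
  have "monom_unit (pb (Suc k) (Ph r)) (qq D (Suc k) * w + mm D (Suc k) * i) 0
      (c * (zz D (Suc k) powi tt D (Suc k)) ^ w * (zz D (Suc k) powi ss D (Suc k)) ^ i)"
    using low_coeffs_0_monom_unit[OF low_coeffs_pullback[OF c(1) q_pos[OF kg] m_pos[OF kg],
          where u = "zz D (Suc k) powi tt D (Suc k)"
          and b = "fps_const (zz D (Suc k) powi ss D (Suc k)) + tower_c D (Suc k)"]] c0
    unfolding pb_Suc[OF kg] tower_sigma_def by simp
  then show ?thesis unfolding mult.assoc powi_edge(1)[OF zz_nonzero[OF kg]] .
qed

lemma monom_unit_Ph: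
  "k \<le> K \<Longrightarrow> r \<le> Suc k \<Longrightarrow> \<exists>w c. c \<in> tower_field D k \<and> c \<noteq> 0 \<and>
     monom_unit (pb k (Ph r)) w (if r = Suc k then 1 else 0) c"
proof (induction k)
  case 0
  consider "r = 0" | "r = 1" using 0(2) by linarith
  then show ?case
  proof cases
    case 1
    have "monom_unit (pb 0 (Ph 0)) (ee 0 * 1) 0 (to_ac 1 * \<mu> 0 ^ 1)"
      using monom_unit_const[of 0 fps_X] by (simp add: Ph_def)
    then show ?thesis using 1 tower_pi(1,2)[of 0]
      by (intro exI[of _ "ee 0 * 1"] exI[of _ "to_ac 1 * \<mu> 0 ^ 1"]) simp
  next
    case 2
    then show ?thesis using simple_root_0 unfolding simple_root_def Ph_def by simp
  qed
next
  case (Suc k)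
  show ?case
  proof (cases "r = Suc (Suc k)")
    case True
    then show ?thesis
      using short_unit_simple_root[OF Suc.prems(1)] unfolding simple_root_def Ph_def by simp
  next
    case False
    then obtain w c where c: "c \<in> tower_field D k" "c \<noteq> 0"
      "monom_unit (pb k (Ph r)) w (if r = Suc k then 1 else 0) c"
      using Suc.IH Suc.prems by auto
    have kK: "k < K" using Suc.prems by simp
    have "zz D (Suc k) \<noteq> 0" using zz_nonzero[of k] kK K by simp
    then have nz: "c * zz D (Suc k) powi i \<noteq> 0" for i using c(2) by simp
    have r: "(if r = Suc (Suc k) then 1 else 0) = (0 :: nat)" using False by simp
    show ?thesis
      unfolding r by (rule exI, rule exI, rule conjI, rule tower_field_powi(1)[OF c(1)], rule conjI, rule nz,
          rule monom_unit_Ph_Suc[OF kK c(3,2)])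
  qed
qed

lemma
  assumes "k \<le> K" "r \<le> Suc k"
  shows LL_in_field: "LL k r \<in> tower_field D k" and LL_nonzero: "LL k r \<noteq> 0"
    and monom_unit_vv_LL: "monom_unit (pb k (Ph r)) (vv k r) (if r = Suc k then 1 else 0) (LL k r)"
    and val_k_Ph: "val_k D k (Ph r) = enat (vv k r)"
  using monom_unit_Ph[OF assms] vv_LL_eqI by metis+

lemma
  assumes "k < K" "r \<le> Suc k"
  shows vv_Suc: "vv (Suc k) r = qq D (Suc k) * vv k r + mm D (Suc k) * (if r = Suc k then 1 else 0)"
    and LL_Suc: "LL (Suc k) r = LL k r *
      zz D (Suc k) powi (tt D (Suc k) * int (vv k r) + ss D (Suc k) * int (if r = Suc k then 1 else 0))"
proof -
  have k: "k \<le> K" using assms by simp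
  have "zz D (Suc k) \<noteq> 0" using zz_nonzero[of k] assms K by simp
  then have "LL k r * zz D (Suc k) powi (tt D (Suc k) * int (vv k r) + ss D (Suc k) * int (if r = Suc k then 1 else 0)) \<noteq> 0"
    using LL_nonzero[OF k assms(2)] by simp
  from vv_LL_eqI[OF monom_unit_Ph_Suc[OF assms(1) monom_unit_vv_LL[OF k assms(2)] LL_nonzero[OF k assms(2)]] this]
  show "vv (Suc k) r = qq D (Suc k) * vv k r + mm D (Suc k) * (if r = Suc k then 1 else 0)"
    and "LL (Suc k) r = LL k r *
      zz D (Suc k) powi (tt D (Suc k) * int (vv k r) + ss D (Suc k) * int (if r = Suc k then 1 else 0))"
    by auto
qed

lemma vv_LL_0:
  assumes "k \<le> K"
  shows "vv k 0 = ee k" "LL k 0 = \<mu> k"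
proof -
  have kg: "k \<le> g" using assms K by simp
  have "monom_unit (pb k (Ph 0)) (ee k * 1) 0 (to_ac 1 * \<mu> k ^ 1)"
    using monom_unit_const[OF kg, of fps_X] by (simp add: Ph_def)
  then show "vv k 0 = ee k" "LL k 0 = \<mu> k" using vv_LL_eqI[of k 0] tower_pi(2)[OF kg] by simp_all
qed

text \<open>With \<open>Lam\<close> and \<open>expo\<close>, the counterpart in natural numbers of
  the scalar product with V, of the powers of \<Lambda> and of the sets of exponents; linked to them
  in \<open>scalar_V_list\<close>, \<open>powi_vec_Lambda\<close> and
  \<open>exponents_at_eq\<close>.\<close>

definition wt :: "nat \<Rightarrow> nat list \<Rightarrow> nat" where
  "wt k B = (\<Sum>r<k + 2. B ! r * vv k r)"

definition Lam :: "nat \<Rightarrow> nat list \<Rightarrow> 'k alg_closure" where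
  "Lam k B = (\<Prod>r<k + 2. LL k r ^ (B ! r))"

definition expo :: "nat \<Rightarrow> nat \<Rightarrow> nat \<Rightarrow> nat list set" where
  "expo k i w = {B \<in> exponents D k. B ! (k + 1) = i \<and> wt k B = w}"

text \<open>The exponent of x is bounded by w because x has positive valuation, the middle entries
  are bounded digits, and the last entry is i.\<close>

lemma finite_expo:
  assumes k: "k \<le> K"
  shows "finite (expo k i w)"
proof -
  define M where "M = w + i + (\<Sum>j=1..k. qq D j * degree (PP D j))"
  have "expo k i w \<subseteq> {B. set B \<subseteq> {..M} \<and> length B = k + 2}"
  proof
    fix B assume B: "B \<in> expo k i w"
    then have len: "length B = k + 2" by (simp add: expo_def exponents_def)
    have "B ! r \<le> M" if r: "r < k + 2" for r
    proof -
      consider "r = 0" | "r \<in> {1..k}" | "r = k + 1" using r by fastforce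
      then show ?thesis
      proof cases
        case 1
        have "vv k 0 > 0" using vv_LL_0(1)[OF k] ee_pos[of k] k K by simp
        then have "B ! 0 \<le> B ! 0 * vv k 0" by simp
        also have "\<dots> \<le> wt k B" unfolding wt_def by (rule member_le_sum) auto
        also have "\<dots> = w" using B by (simp add: expo_def)
        finally show ?thesis using 1 by (simp add: M_def)
      next
        case 2
        have "B ! r < qq D r * degree (PP D r)" using B 2 by (auto simp: expo_def exponents_def)
        also have "\<dots> \<le> (\<Sum>j=1..k. qq D j * degree (PP D j))" using 2 by (intro member_le_sum) auto
        finally show ?thesis by (simp add: M_def)
      next
        case 3
        then show ?thesis using B by (simp add: expo_def M_def)
      qed
    qed
    then show "B \<in> {B. set B \<subseteq> {..M} \<and> length B = k + 2}" using len by (auto simp: set_conv_nth)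
  qed
  moreover have "finite {B. set B \<subseteq> {..M} \<and> length B = k + 2}" by (rule finite_lists_length_eq) simp
  ultimately show ?thesis by (rule finite_subset)
qed

lemma Lam_in_field: "k \<le> K \<Longrightarrow> Lam k B \<in> tower_field D k"
proof -
  assume k: "k \<le> K"
  have L: "ac_subfield (tower_field D k)" by (rule ac_subfield_tower_field)
  have "(\<Prod>r<n. LL k r ^ (B ! r)) \<in> tower_field D k" if "n \<le> k + 2" for n
    using that by (induction n) (auto intro: ac_subfield_1[OF L] ac_subfield_mult[OF L] ac_subfield_power[OF L] LL_in_field[OF k])
  then show ?thesis unfolding Lam_def by blast
qed

lemma Lam_nonzero: "k \<le> K \<Longrightarrow> Lam k B \<noteq> 0"
  unfolding Lam_def using LL_nonzero[of k] by auto

lemma exponents_Suc_iff: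
  "B @ [i] \<in> exponents D (Suc k) \<longleftrightarrow> B \<in> exponents D k \<and> B ! (k + 1) < qq D (Suc k) * degree (PP D (Suc k))"
proof -
  have "(\<forall>r\<in>{1..Suc k}. (B @ [i]) ! r < qq D r * degree (PP D r)) \<longleftrightarrow>
      (\<forall>r\<in>{1..k}. B ! r < qq D r * degree (PP D r)) \<and> B ! (k + 1) < qq D (Suc k) * degree (PP D (Suc k))"
    if "length B = k + 2"
  proof -
    have "{1..Suc k} = insert (Suc k) {1..k}" by auto
    moreover have "(B @ [i]) ! r = B ! r" if "r \<le> Suc k" for r
      using that \<open>length B = k + 2\<close> by (simp add: nth_append)
    ultimately show ?thesis by auto
  qed
  then show ?thesis by (auto simp: exponents_def)
qed

text \<open>Apart from the new last entry, weight and coefficient change like those of the monomial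
  x^(wt) y^b under \<sigma>, where b is the exponent of \<open>\<phi> k\<close>.\<close>

lemma wt_Lam_Suc:
  assumes k: "k < K" and B: "length B = k + 2"
  shows "wt (Suc k) (B @ [i]) = qq D (Suc k) * wt k B + mm D (Suc k) * (B ! (k + 1)) + i * vv (Suc k) (k + 2)"
    "Lam (Suc k) (B @ [i]) = Lam k B * zz D (Suc k) powi (tt D (Suc k) * int (wt k B) + ss D (Suc k) * int (B ! (k + 1)))
       * LL (Suc k) (k + 2) ^ i"
proof -
  let ?z = "zz D (Suc k)" and ?t = "tt D (Suc k)" and ?s = "ss D (Suc k)"
  have z: "?z \<noteq> 0" using zz_nonzero[of k] k K by simp
  have app: "(B @ [i]) ! r = (if r < k + 2 then B ! r else i)" if "r < k + 3" for r
    using that B by (auto simp: nth_append nth_Cons')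
  let ?\<delta> = "\<lambda>r. if r = Suc k then 1 else 0 :: nat"
  have delta: "(\<Sum>r<k + 2. B ! r * ?\<delta> r) = B ! (k + 1)"
    by (simp add: if_distrib[of "\<lambda>x. _ * x"] cong: if_cong)
  have "wt (Suc k) (B @ [i]) = (\<Sum>r<k + 2. B ! r * (qq D (Suc k) * vv k r + mm D (Suc k) * ?\<delta> r)) + i * vv (Suc k) (k + 2)"
  proof -
    have "(\<Sum>r<k + 2. (B @ [i]) ! r * vv (Suc k) r) = (\<Sum>r<k + 2. B ! r * (qq D (Suc k) * vv k r + mm D (Suc k) * ?\<delta> r))"
      by (intro sum.cong refl) (simp add: app vv_Suc[OF k])
    then show ?thesis using app[of "k + 2"] by (simp add: wt_def)
  qed
  also have "(\<Sum>r<k + 2. B ! r * (qq D (Suc k) * vv k r + mm D (Suc k) * ?\<delta> r)) =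
      qq D (Suc k) * wt k B + mm D (Suc k) * (\<Sum>r<k + 2. B ! r * ?\<delta> r)"
    unfolding wt_def sum_distrib_left sum.distrib[symmetric] by (intro sum.cong refl) (simp add: algebra_simps)
  finally show "wt (Suc k) (B @ [i]) = qq D (Suc k) * wt k B + mm D (Suc k) * (B ! (k + 1)) + i * vv (Suc k) (k + 2)"
    unfolding delta .
  have "Lam (Suc k) (B @ [i]) = (\<Prod>r<k + 2. LL k r ^ (B ! r) * ?z powi (int (B ! r) * (?t * int (vv k r) + ?s * int (?\<delta> r)))) * LL (Suc k) (k + 2) ^ i"
  proof -
    have "(\<Prod>r<k + 2. LL (Suc k) r ^ ((B @ [i]) ! r)) =
        (\<Prod>r<k + 2. LL k r ^ (B ! r) * ?z powi (int (B ! r) * (?t * int (vv k r) + ?s * int (?\<delta> r))))"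
      by (intro prod.cong refl) (simp add: app LL_Suc[OF k] power_mult_distrib power_int_mult mult.commute[of "int _"])
    then show ?thesis using app[of "k + 2"] by (simp add: Lam_def)
  qed
  also have "(\<Prod>r<k + 2. LL k r ^ (B ! r) * ?z powi (int (B ! r) * (?t * int (vv k r) + ?s * int (?\<delta> r)))) =
      Lam k B * ?z powi (\<Sum>r<k + 2. int (B ! r) * (?t * int (vv k r) + ?s * int (?\<delta> r)))"
  proof -
    have "(\<Prod>r<n. ?z powi (h r)) = ?z powi (\<Sum>r<n. h r)" for h :: "nat \<Rightarrow> int" and n
      using z by (induction n) (simp_all add: power_int_add)
    then show ?thesis by (simp add: prod.distrib Lam_def)
  qed
  also have "(\<Sum>r<k + 2. int (B ! r) * (?t * int (vv k r) + ?s * int (?\<delta> r))) =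
      ?t * int (wt k B) + ?s * int (\<Sum>r<k + 2. B ! r * ?\<delta> r)"
    unfolding wt_def of_nat_sum sum_distrib_left sum.distrib[symmetric]
    by (intro sum.cong refl) (simp add: algebra_simps)
  finally show "Lam (Suc k) (B @ [i]) = Lam k B * ?z powi (?t * int (wt k B) + ?s * int (B ! (k + 1)))
       * LL (Suc k) (k + 2) ^ i"
    unfolding delta .
qed

text \<open>By induction on k, grouping the B by their exponent b of the preceding minimal
  polynomial. The groups lie on one line and have b < q deg P, so \<open>edge_sum_eq_0\<close> makes
  each group sum 0, and a group sum is a relation one level below.\<close>

lemma Lam_independent:
  "k \<le> K \<Longrightarrow> (\<Sum>B\<in>expo k i w. to_ac (f B) * Lam k B) = 0 \<Longrightarrow> B \<in> expo k i w \<Longrightarrow> f B = 0"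
proof (induction k arbitrary: i w f B)
  case 0
  have v0: "vv 0 0 > 0" using vv_LL_0(1)[of 0] by (simp add: ee_def)
  have "B' = B" if B': "B' \<in> expo 0 i w" for B'
  proof (rule nth_equalityI)
    have len: "length B = 2" "length B' = 2" using 0(3) B' by (auto simp: expo_def exponents_def)
    then show "length B' = length B" by simp
    fix r assume "r < length B'"
    then consider "r = 0" | "r = 1" using len by linarith
    then show "B' ! r = B ! r"
      using 0(3) B' v0 by cases (auto simp: expo_def wt_def numeral_2_eq_2)
  qed
  then have "expo 0 i w = {B}" using 0(3) by blast
  then show ?case using 0(2) Lam_nonzero[of 0 B] by simp
next
  case (Suc k)
  have k: "k < K" "k \<le> K" "k < g" using Suc.prems(1) K by simp_all
  note S = tower_stepD[OF step[OF k(3)]]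
  let ?z = "zz D (Suc k)" and ?t = "tt D (Suc k)" and ?s = "ss D (Suc k)" and ?q = "qq D (Suc k)" and ?m = "mm D (Suc k)"
  let ?l = "degree (PP D (Suc k))" and ?v = "vv (Suc k) (k + 2)"
  note L = ac_subfield_tower_field[of D k]
  \<comment> \<open>The weight left for the other entries; \<open>vw\<close> shows that the
    subtraction is exact.\<close>
  define W where "W = w - i * ?v"
  define I where "I = {b \<in> {..<?q * ?l}. ?m * b \<le> W \<and> ?q dvd (W - ?m * b)}"
  define \<omega> where "\<omega> = (\<lambda>b. (W - ?m * b) div ?q)"
  define \<kappa> where "\<kappa> = (\<lambda>b. \<Sum>B'\<in>expo k b (\<omega> b). to_ac (f (B' @ [i])) * Lam k B')"
  have q: "?q > 0" using q_pos[OF k(3)] .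
  have snoc: "\<exists>B'. B = B' @ [i] \<and> length B' = k + 2" if "B \<in> expo (Suc k) i w" for B
  proof -
    have len: "length B = k + 3" and i: "B ! (k + 2) = i" using that by (auto simp: expo_def exponents_def)
    then have "B = butlast B @ [last B]" by (metis append_butlast_last_id length_0_conv add_is_0 zero_neq_numeral)
    moreover have "last B = i" using len i by (subst last_conv_nth) auto
    ultimately show ?thesis using len by (intro exI[of _ "butlast B"]) auto
  qed
  have vw: "i * ?v \<le> w"
  proof -
    obtain B' where B': "B = B' @ [i]" "length B' = k + 2" using snoc[OF Suc.prems(3)] by blast
    have "wt (Suc k) B = w" using Suc.prems(3) by (simp add: expo_def)
    then show ?thesis using wt_Lam_Suc(1)[OF k(1) B'(2), of i] unfolding B'(1) by simp
  qed
  have expo_iff: "B' @ [i] \<in> expo (Suc k) i w \<longleftrightarrow> B' ! (k + 1) \<in> I \<and> B' \<in> expo k (B' ! (k + 1)) (\<omega> (B' ! (k + 1)))"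
    if "length B' = k + 2" for B'
  proof -
    define b where "b = B' ! (k + 1)"
    have "?q * wt k B' + ?m * b + i * ?v = w \<longleftrightarrow> ?q * wt k B' + ?m * b = W"
      using vw unfolding W_def by linarith
    also have "\<dots> \<longleftrightarrow> ?m * b \<le> W \<and> ?q dvd (W - ?m * b) \<and> wt k B' = \<omega> b"
      unfolding \<omega>_def using q by (auto simp: dvd_def)
    finally have *: "?q * wt k B' + ?m * b + i * ?v = w \<longleftrightarrow> ?m * b \<le> W \<and> ?q dvd (W - ?m * b) \<and> wt k B' = \<omega> b" .
    have "(B' @ [i]) ! (Suc k + 1) = i" using that by (simp add: nth_append)
    then have "B' @ [i] \<in> expo (Suc k) i w \<longleftrightarrow> B' \<in> exponents D k \<and> b < ?q * ?l \<and> wt (Suc k) (B' @ [i]) = w"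
      unfolding expo_def b_def exponents_Suc_iff[symmetric] by (simp add: exponents_Suc_iff)
    also have "wt (Suc k) (B' @ [i]) = w \<longleftrightarrow> ?m * b \<le> W \<and> ?q dvd (W - ?m * b) \<and> wt k B' = \<omega> b"
      unfolding wt_Lam_Suc(1)[OF k(1) that] b_def[symmetric] by (rule *)
    finally have "B' @ [i] \<in> expo (Suc k) i w \<longleftrightarrow> B' \<in> exponents D k \<and> b < ?q * ?l \<and>
      ?m * b \<le> W \<and> ?q dvd (W - ?m * b) \<and> wt k B' = \<omega> b" .
    moreover have "B' \<in> expo k b (\<omega> b) \<longleftrightarrow> B' \<in> exponents D k \<and> wt k B' = \<omega> b"
      by (simp add: expo_def b_def)
    ultimately show ?thesis unfolding b_def[symmetric] I_def by blast
  qed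
  have I: "finite I" "\<And>b. b \<in> I \<Longrightarrow> ?q * \<omega> b + ?m * b = W" "\<And>b. b \<in> I \<Longrightarrow> b < ?q * ?l"
    by (auto simp: I_def \<omega>_def)
  have \<kappa>: "\<kappa> b \<in> tower_field D k" if "b \<in> I" for b
    unfolding \<kappa>_def by (intro ac_subfield_sum[OF L] ac_subfield_mult[OF L] ac_subfield_to_ac[OF L] Lam_in_field k)
  have "(\<Sum>B\<in>expo (Suc k) i w. to_ac (f B) * Lam (Suc k) B) =
      (\<Sum>(b, B')\<in>Sigma I (\<lambda>b. expo k b (\<omega> b)). to_ac (f (B' @ [i])) * Lam (Suc k) (B' @ [i]))"
  proof (rule sum.reindex_bij_witness[of _ "\<lambda>(b, B'). B' @ [i]" "\<lambda>B. (B ! (k + 1), butlast B)"], goal_cases)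
    case (1 B)
    then show ?case using snoc[OF 1] by auto
  next
    case (2 B)
    then obtain B' where B': "B = B' @ [i]" "length B' = k + 2" using snoc by blast
    then show ?case using 2 expo_iff[OF B'(2)] by (simp add: nth_append)
  next
    case (3 p)
    then show ?case by (auto simp: expo_def exponents_def nth_append)
  next
    case (4 p)
    then obtain b B' where p: "p = (b, B')" "b \<in> I" "B' \<in> expo k b (\<omega> b)" by auto
    then have "length B' = k + 2" "B' ! (k + 1) = b" by (auto simp: expo_def exponents_def)
    then show ?case using p expo_iff[of B'] by simp
  next
    case (5 B)
    then show ?case using snoc[OF 5] by auto
  qed
  also have "\<dots> = (\<Sum>b\<in>I. \<Sum>B'\<in>expo k b (\<omega> b). to_ac (f (B' @ [i])) * Lam (Suc k) (B' @ [i]))"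
    using I(1) finite_expo[OF k(2)] by (subst sum.Sigma) auto
  also have "\<dots> = (\<Sum>b\<in>I. \<Sum>B'\<in>expo k b (\<omega> b). LL (Suc k) (k + 2) ^ i * (?z powi (?t * int (\<omega> b) + ?s * int b) * (to_ac (f (B' @ [i])) * Lam k B')))"
  proof (intro sum.cong refl)
    fix b B' assume "B' \<in> expo k b (\<omega> b)"
    then have "length B' = k + 2" "B' ! (k + 1) = b" "wt k B' = \<omega> b" by (auto simp: expo_def exponents_def)
    then show "to_ac (f (B' @ [i])) * Lam (Suc k) (B' @ [i]) =
        LL (Suc k) (k + 2) ^ i * (?z powi (?t * int (\<omega> b) + ?s * int b) * (to_ac (f (B' @ [i])) * Lam k B'))"
      by (simp add: wt_Lam_Suc(2)[OF k(1)] mult_ac)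
  qed
  also have "\<dots> = LL (Suc k) (k + 2) ^ i * (\<Sum>b\<in>I. \<kappa> b * ?z powi (?t * int (\<omega> b) + ?s * int b))"
    unfolding \<kappa>_def by (simp add: sum_distrib_left sum_distrib_right mult_ac)
  finally have "(\<Sum>b\<in>I. \<kappa> b * ?z powi (?t * int (\<omega> b) + ?s * int b)) = 0"
    using Suc.prems(2) LL_nonzero[OF Suc.prems(1), of "k + 2"] by simp
  from edge_sum_eq_0[OF L irreducible_PP[OF k(3)] S(2) zz_nonzero[OF k(3)] q S(3) I(1,2) \<kappa> I(3) this]
  have \<kappa>0: "\<kappa> b = 0" if "b \<in> I" for b using that by blast
  obtain B' where B': "B = B' @ [i]" "length B' = k + 2" using snoc[OF Suc.prems(3)] by blast
  then have "B' ! (k + 1) \<in> I" "B' \<in> expo k (B' ! (k + 1)) (\<omega> (B' ! (k + 1)))"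
    using expo_iff[OF B'(2)] Suc.prems(3) by auto
  then show ?case
    using Suc.IH[OF k(2), where i = "B' ! (k + 1)" and w = "\<omega> (B' ! (k + 1))" and f = "\<lambda>B'. f (B' @ [i])" and B = B'] \<kappa>0 B'(1)
    unfolding \<kappa>_def by blast
qed

end


subsection \<open>Leading terms of expansions\<close>

text \<open>The polynomial \<phi> divides the lowest digit, which has smaller degree and so is 0;
  then one factor \<phi> cancels.\<close>

lemma phi_adic_unique:
  fixes \<phi> :: "'a::idom poly"
  assumes \<phi>: "lead_coeff \<phi> = 1" "degree \<phi> = n" "n > 0"
  shows "(\<Sum>i<M. h i * \<phi> ^ i) = 0 \<Longrightarrow> (\<And>i. degree (h i) < n) \<Longrightarrow> i < M \<Longrightarrow> h i = 0"
proof (induction M arbitrary: h i)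
  case (Suc M)
  have \<phi>0: "\<phi> \<noteq> 0" using \<phi>(1) by auto
  have eq: "h 0 + \<phi> * (\<Sum>i<M. h (Suc i) * \<phi> ^ i) = 0"
    using Suc.prems(1) unfolding sum.lessThan_Suc_shift by (simp add: sum_distrib_left mult_ac)
  have "h 0 = 0"
  proof (rule ccontr)
    assume "h 0 \<noteq> 0"
    moreover have "\<phi> dvd h 0" using eq by (metis dvd_add_times_triv_right_iff dvd_0_right mult.commute)
    ultimately have "n \<le> degree (h 0)" using \<phi>(2) dvd_imp_degree_le by blast
    then show False using Suc.prems(2)[of 0] by simp
  qed
  moreover from this have "(\<Sum>i<M. h (Suc i) * \<phi> ^ i) = 0" using eq \<phi>0 by simp
  from Suc.IH[of "\<lambda>i. h (Suc i)", OF this] Suc.prems(2) have "h (Suc i) = 0" if "i < M" for i using that by blast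
  ultimately show ?case using Suc.prems(3) by (cases i) auto
qed simp

lemma lessThan_add_2: "{..<k + 2} = insert 0 (Suc ` {..k})"
  using lessThan_Suc_eq_insert_0[of "Suc k"] by (simp only: lessThan_Suc_atMost add_2_eq_Suc')

context tower_min
begin

lemma exponents_Cons:
  "b # C \<in> exponents D k \<longleftrightarrow> length C = k + 1 \<and> (\<forall>j<k. C ! j < qq D (Suc j) * degree (PP D (Suc j)))"
proof -
  have "(\<forall>i\<in>{1..k}. (b # C) ! i < qq D i * degree (PP D i)) \<longleftrightarrow> (\<forall>j<k. (b # C) ! Suc j < qq D (Suc j) * degree (PP D (Suc j)))"
    unfolding image_Suc_lessThan[symmetric] by auto
  then show ?thesis by (auto simp: exponents_def)
qed

text \<open>Only \<open>\<phi> k\<close> contributes a factor y, so the power of y is the last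
  exponent.\<close>

lemma monom_unit_term:
  assumes k: "k \<le> K" and C: "length C = k + 1" and a: "a \<noteq> 0"
  shows "monom_unit (pb k (smult a (\<Prod>j\<le>k. \<phi> j ^ (C ! j)))) (wt k (subdegree a # C)) (C ! k)
     (to_ac (a $ subdegree a) * Lam k (subdegree a # C))"
proof -
  have kg: "k \<le> g" using k K by simp
  let ?n = "subdegree a"
  note set = lessThan_add_2[of k]
  have wt: "wt k (?n # C) = ee k * ?n + (\<Sum>j\<le>k. C ! j * vv k (Suc j))"
    unfolding wt_def set by (simp add: sum.reindex vv_LL_0[OF k])
  have Lam: "Lam k (?n # C) = \<mu> k ^ ?n * (\<Prod>j\<le>k. LL k (Suc j) ^ (C ! j))"
    unfolding Lam_def set by (simp add: prod.reindex vv_LL_0[OF k])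
  have MU: "monom_unit (pb k (\<phi> j)) (vv k (Suc j)) (if Suc j = Suc k then 1 else 0) (LL k (Suc j))"
    if "j \<in> {..k}" for j
    using monom_unit_vv_LL[OF k, of "Suc j"] that by (simp add: Ph_def)
  have prod: "monom_unit (\<Prod>j\<le>k. pb k (\<phi> j) ^ (C ! j)) (\<Sum>j\<le>k. C ! j * vv k (Suc j))
      (\<Sum>j\<le>k. C ! j * (if Suc j = Suc k then 1 else 0)) (\<Prod>j\<le>k. LL k (Suc j) ^ (C ! j))"
    by (intro monom_unit_prod monom_unit_power MU) auto
  have Ck: "(\<Sum>j\<le>k. C ! j * (if Suc j = Suc k then 1 else 0)) = C ! k"
    by (simp add: if_distrib[of "\<lambda>x. _ * x"] cong: if_cong)
  note monom_unit_mult[OF monom_unit_const[OF kg a] prod, unfolded Ck]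
  moreover have "pb k (smult a (\<Prod>j\<le>k. \<phi> j ^ (C ! j))) = pb k [:a:] * (\<Prod>j\<le>k. pb k (\<phi> j) ^ (C ! j))"
    using pb_mult[OF kg, of "[:a:]" "\<Prod>j\<le>k. \<phi> j ^ (C ! j)"] by (simp add: pb_prod[OF kg] pb_power[OF kg])
  ultimately show ?thesis by (simp add: wt Lam mult_ac)
qed

text \<open>For each C the lowest term of its power series has the least weight, and W is the
  minimum over C. All terms share the power y^i, and \<open>Lam_independent\<close> prevents those
  of weight W from cancelling.\<close>

lemma slice_leading_term:
  fixes f :: "nat list \<Rightarrow> 'k"
  assumes k: "k \<le> K" and S: "finite S" "S \<noteq> {}"
    "\<And>C. C \<in> S \<Longrightarrow> C ! k = i \<and> (\<exists>b. b # C \<in> exponents D k \<and> f (b # C) \<noteq> 0)"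
    and f: "\<And>B. B \<in> exponents D k \<Longrightarrow> B ! (k + 1) = i \<Longrightarrow> f B \<noteq> 0 \<Longrightarrow> tl B \<in> S"
  obtains W where "W \<in> wt k ` {B \<in> exponents D k. B ! (k + 1) = i \<and> f B \<noteq> 0}"
    "\<And>B. B \<in> exponents D k \<Longrightarrow> B ! (k + 1) = i \<Longrightarrow> f B \<noteq> 0 \<Longrightarrow> W \<le> wt k B"
    "(\<Sum>B\<in>expo k i W. to_ac (f B) * Lam k B) \<noteq> 0"
    "monom_unit (pb k (\<Sum>C\<in>S. smult (Abs_fps (\<lambda>b. f (b # C))) (\<Prod>j\<le>k. \<phi> j ^ (C ! j)))) W i
       (\<Sum>B\<in>expo k i W. to_ac (f B) * Lam k B)"
proof -
  define a where "a = (\<lambda>C. Abs_fps (\<lambda>b. f (b # C)))"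
  define n where "n = (\<lambda>C. subdegree (a C))"
  define W where "W = Min ((\<lambda>C. wt k (n C # C)) ` S)"
  have a0: "a C \<noteq> 0" if "C \<in> S" for C
    using S(3)[OF that] by (auto simp: a_def fps_eq_iff)
  have fn: "f (n C # C) \<noteq> 0" if "C \<in> S" for C
    using nth_subdegree_nonzero[OF a0[OF that]] by (simp add: a_def n_def)
  have ex: "b # C \<in> exponents D k" "length C = k + 1" "(b # C) ! (k + 1) = i" if "C \<in> S" for b C
    using S(3)[OF that] by (auto simp: exponents_Cons)
  have vpos: "vv k 0 > 0" using vv_LL_0(1)[OF k] ee_pos[of k] k K by simp
  have wt_Cons: "wt k (b # C) = b * vv k 0 + (\<Sum>j\<le>k. C ! j * vv k (Suc j))" for b C
  proof -
    show ?thesis unfolding wt_def lessThan_add_2 by (simp add: sum.reindex)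
  qed
  have n_le: "n C \<le> b" if "f (b # C) \<noteq> 0" for b C
    unfolding n_def a_def by (rule subdegree_leI) (use that in simp)
  have W_in: "W \<in> (\<lambda>C. wt k (n C # C)) ` S" unfolding W_def using S by (intro Min_in) auto
  have W_le: "W \<le> wt k (n C # C)" if "C \<in> S" for C unfolding W_def using S that by simp
  have split: "\<exists>b C. B = b # C \<and> C \<in> S" if "B \<in> exponents D k" "B ! (k + 1) = i" "f B \<noteq> 0" for B
  proof -
    have "B \<noteq> []" using that(1) by (auto simp: exponents_def)
    then have "B = hd B # tl B" by simp
    then show ?thesis using f[OF that] by metis
  qed
  define S' where "S' = {C \<in> S. wt k (n C # C) = W}"
  have "inj_on (\<lambda>C. n C # C) S'" by (auto simp: inj_on_def)
  then have "(\<Sum>C\<in>S'. to_ac (f (n C # C)) * Lam k (n C # C)) =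
      (\<Sum>B\<in>(\<lambda>C. n C # C) ` S'. to_ac (f B) * Lam k B)"
    by (simp add: sum.reindex)
  also have "\<dots> = (\<Sum>B\<in>expo k i W. to_ac (f B) * Lam k B)"
  proof (intro sum.mono_neutral_left finite_expo[OF k] ballI)
    show "(\<lambda>C. n C # C) ` S' \<subseteq> expo k i W" using ex by (auto simp: S'_def expo_def)
    \<comment> \<open>Such a B with nonzero coefficient would sit above the lowest term of its
      series and, since x has positive weight, could have weight W only by being that lowest
      term.\<close>
    fix B assume B: "B \<in> expo k i W - (\<lambda>C. n C # C) ` S'"
    have "f B = 0"
    proof (rule ccontr)
      assume fB: "f B \<noteq> 0"
      obtain b C where C: "B = b # C" "C \<in> S" using split[OF _ _ fB] B by (auto simp: expo_def)
      have "n C \<le> b" using n_le fB C by simp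
      moreover have "W = b * vv k 0 + (\<Sum>j\<le>k. C ! j * vv k (Suc j))" using B C by (simp add: expo_def wt_Cons)
      moreover have "W \<le> n C * vv k 0 + (\<Sum>j\<le>k. C ! j * vv k (Suc j))" using W_le[OF C(2)] by (simp add: wt_Cons)
      ultimately have "b * vv k 0 \<le> n C * vv k 0" by linarith
      then have "b \<le> n C" using vpos by simp
      then have "b = n C" using \<open>n C \<le> b\<close> by simp
      then show False using B C by (auto simp: S'_def expo_def)
    qed
    then show "to_ac (f B) * Lam k B = 0" by simp
  qed
  finally have c: "(\<Sum>C\<in>S'. to_ac (f (n C # C)) * Lam k (n C # C)) = (\<Sum>B\<in>expo k i W. to_ac (f B) * Lam k B)" .
  obtain C0 where C0: "C0 \<in> S" "W = wt k (n C0 # C0)" using W_in by blast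
  show ?thesis
  proof
    show "W \<in> wt k ` {B \<in> exponents D k. B ! (k + 1) = i \<and> f B \<noteq> 0}"
      using C0 ex(1,3)[OF C0(1), of "n C0"] fn[OF C0(1)] by blast
    show "W \<le> wt k B" if B: "B \<in> exponents D k" "B ! (k + 1) = i" "f B \<noteq> 0" for B
    proof -
      obtain b C where C: "B = b # C" "C \<in> S" using split[OF B] by blast
      have "n C \<le> b" using n_le B C by simp
      then have "wt k (n C # C) \<le> wt k B" unfolding C wt_Cons by simp
      then show ?thesis using W_le[OF C(2)] by simp
    qed
    show "(\<Sum>B\<in>expo k i W. to_ac (f B) * Lam k B) \<noteq> 0"
    proof
      assume "(\<Sum>B\<in>expo k i W. to_ac (f B) * Lam k B) = 0"
      moreover have "n C0 # C0 \<in> expo k i W" using C0 ex(1,3)[OF C0(1), of "n C0"] by (simp add: expo_def)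
      ultimately show False using Lam_independent[OF k] fn[OF C0(1)] by blast
    qed
    have "monom_unit (pb k (smult (a C) (\<Prod>j\<le>k. \<phi> j ^ (C ! j)))) (wt k (n C # C)) i
        (to_ac (f (n C # C)) * Lam k (n C # C))" if "C \<in> S" for C
      using monom_unit_term[OF k ex(2)[OF that] a0[OF that]] S(3)[OF that] by (simp add: a_def n_def)
    note tm = this
    have "monom_unit (\<Sum>C\<in>S. pb k (smult (a C) (\<Prod>j\<le>k. \<phi> j ^ (C ! j)))) W i
        (\<Sum>C\<in>S'. to_ac (f (n C # C)) * Lam k (n C # C))"
      unfolding S'_def by (rule monom_unit_sum[OF S(1)], rule tm, assumption, rule W_le, assumption)
    then show "monom_unit (pb k (\<Sum>C\<in>S. smult (Abs_fps (\<lambda>b. f (b # C))) (\<Prod>j\<le>k. \<phi> j ^ (C ! j)))) W i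
       (\<Sum>B\<in>expo k i W. to_ac (f B) * Lam k B)"
      unfolding pb_sum c a_def .
  qed
qed

text \<open>A number in mixed radix, with place values \<open>dd j\<close> and admissible digits, is
  below the next place value.\<close>

lemma degree_prod_\<phi>:
  assumes "k \<le> K" "\<And>j. j < k \<Longrightarrow> C ! j < qq D (Suc j) * degree (PP D (Suc j))"
  shows "degree (\<Prod>j<k. \<phi> j ^ (C ! j)) < dd k"
  using assms
proof (induction k)
  case (Suc k)
  have \<phi>0: "\<phi> j \<noteq> 0" if "j \<le> k" for j using lead_coeff_\<phi>[of j] that Suc.prems(1) by auto
  have "degree (\<Prod>j<Suc k. \<phi> j ^ (C ! j)) = degree (\<Prod>j<k. \<phi> j ^ (C ! j)) + C ! k * dd k"
    using \<phi>0 Suc.prems(1) degree_\<phi>[of k] by (simp add: degree_mult_eq degree_power_eq)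
  also have "\<dots> < dd k + C ! k * dd k" using Suc by simp
  also have "\<dots> = dd k * (C ! k + 1)" by simp
  also have "\<dots> \<le> dd k * (qq D (Suc k) * degree (PP D (Suc k)))"
    using Suc.prems(2)[of k] by (intro mult_left_mono) auto
  finally show ?case by (simp add: dd_Suc)
qed (simp add: dd_def)

section \<open>Translation of the vectors given as lists\<close>

lemma scalar_V_list:
  assumes k: "k \<le> K" and B: "length B = k + 2"
  shows "scalar B (V_list D \<phi> k) = enat (wt k B)"
proof -
  have V: "V_list D \<phi> k ! r = enat (vv k r)" if "r < k + 2" for r
  proof -
    have "Phi_list \<phi> k ! r = Ph r"
      using that by (cases r) (simp_all add: Phi_list_def Ph_def del: upt_Suc)
    moreover have "length (Phi_list \<phi> k) = k + 2" by (simp add: Phi_list_def)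
    ultimately show ?thesis using val_k_Ph[OF k, of r] that by (simp add: V_list_def)
  qed
  have "scalar B (V_list D \<phi> k) = (\<Sum>r<k + 2. enat (B ! r * vv k r))"
    unfolding scalar_def B by (intro sum.cong refl) (simp add: V)
  also have "\<dots> = enat (wt k B)"
    unfolding wt_def by (induction "k + 2" arbitrary: k) (simp_all add: of_nat_eq_enat[symmetric])
  finally show ?thesis .
qed

lemma exponents_at_eq:
  assumes k: "k \<le> K"
  shows "exponents_at D \<phi> k i (enat w) = expo k i w"
  unfolding exponents_at_def expo_def using scalar_V_list[OF k] by (auto simp: exponents_def)

lemma powi_vec_Lambda:
  assumes k: "k \<le> K" and B: "length B = k + 2"
  shows "powi_vec (Lambda_list D \<phi> k) (diff_vec B (replicate (k + 1) 0 @ [N])) = Lam k B / LL k (k + 1) ^ N"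
proof -
  let ?B0 = "replicate (k + 1) 0 @ [N]"
  have Ll: "Lambda_list D \<phi> k ! r = LL k r" if "r < k + 2" for r
  proof -
    have "Phi_list \<phi> k ! r = Ph r"
      using that by (cases r) (simp_all add: Phi_list_def Ph_def del: upt_Suc)
    moreover have "length (Phi_list \<phi> k) = k + 2" by (simp add: Phi_list_def)
    ultimately show ?thesis using that by (simp add: Lambda_list_def LL_def)
  qed
  have B0: "?B0 ! r = (if r = k + 1 then N else 0)" if "r < k + 2" for r
    using that by (auto simp: nth_append nth_Cons')
  have len: "length (diff_vec B ?B0) = k + 2" using B by (simp add: diff_vec_def)
  have "powi_vec (Lambda_list D \<phi> k) (diff_vec B ?B0) =
      (\<Prod>r<k + 2. LL k r ^ (B ! r) / LL k r ^ (if r = k + 1 then N else 0))"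
    unfolding powi_vec_def len
  proof (intro prod.cong refl)
    fix r assume "r \<in> {..<k + 2}"
    then have r: "r < k + 2" by simp
    have "diff_vec B ?B0 ! r = int (B ! r) - int (?B0 ! r)" using r B by (simp add: diff_vec_def del: replicate_Suc)
    then show "(Lambda_list D \<phi> k ! r) powi (diff_vec B ?B0 ! r) = LL k r ^ (B ! r) / LL k r ^ (if r = k + 1 then N else 0)"
      using r B0[OF r] LL_nonzero[OF k, of r] by (simp add: Ll power_int_diff)
  qed
  also have "\<dots> = Lam k B / (\<Prod>r<k + 2. LL k r ^ (if r = k + 1 then N else 0))"
    by (simp add: prod_dividef Lam_def)
  also have "(\<Prod>r<k + 2. LL k r ^ (if r = k + 1 then N else 0)) = LL k (k + 1) ^ N"
    by (simp add: if_distrib[of "\<lambda>x. _ ^ x"] cong: if_cong)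
  finally show ?thesis .
qed

end

section \<open>Comparison of initial forms and the boundary polynomial\<close>

theorem theorem3:
  fixes F :: "'k::field fps poly" and D :: "'k tower_data" and \<phi> :: "nat \<Rightarrow> 'k fps poly"
    and f :: "nat list \<Rightarrow> 'k" and g k :: nat
  assumes "perfect_field TYPE('k)"
    and "CHAR('k) = 0 \<or> CHAR('k) > degree F"
    and "weierstrass F" and "squarefree F"
    and "tower F g D"
    and "k \<le> g" and "NN D k > 1"
    and "\<And>i. i \<le> k \<Longrightarrow> minimal_poly D i (\<phi> i)"
    and "is_expansion D \<phi> k F f"
  defines "B0 \<equiv> replicate (k + 1) 0 @ [NN D k]"
  shows "boundary_poly (tower_H D k) =
    (\<Sum>(i, w) \<in> {(i::nat, w::nat). w_exp D \<phi> k F f i = ereal (real w) \<and>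
                    (real i, real w) \<in> newton_polygon (tower_H D k)}.
       monom (fps_const (\<Sum>B \<in> exponents_at D \<phi> k i (enat w + val_k D k F).
                to_ac (f B) * powi_vec (Lambda_list D \<phi> k) (diff_vec B B0)) * fps_X ^ w) i)"
proof -
  interpret tower_min F g D \<phi> k
    using assms by unfold_locales auto
  define N where "N = NN D k"
  define Hk where "Hk = tower_H D k"
  have wH: "weierstrass Hk" and dH: "degree Hk = N"
    using H[OF \<open>k \<le> g\<close> \<open>k \<le> g\<close>] by (simp_all add: Hk_def N_def)
  define \<C> where "\<C> = {tl B | B. B \<in> exponents D k \<and> f B \<noteq> 0}"
  define tm where "tm = (\<lambda>C. smult (Abs_fps (\<lambda>b. f (b # C))) (\<Prod>j\<le>k. \<phi> j ^ (C ! j)))"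
  have fin: "finite \<C>" and F_eq: "F = sum tm \<C>"
    using assms(9) unfolding is_expansion_def Let_def \<C>_def tm_def by blast+
  \<comment> \<open>F is cut into slices \<open>T i\<close> according to the exponent i of
    \<open>\<phi> k\<close>; in each slice all terms have the same power of y.\<close>
  define S where "S = (\<lambda>i. {C \<in> \<C>. C ! k = i})"
  define I where "I = (\<lambda>C. C ! k) ` \<C>"
  define T where "T = (\<lambda>i. sum tm (S i))"
  define E where "E = (\<lambda>i. {B \<in> exponents D k. B ! (k + 1) = i \<and> f B \<noteq> 0})"
  define cc where "cc = (\<lambda>i W. \<Sum>B\<in>expo k i W. to_ac (f B) * Lam k B)"
  have finI: "finite I" using fin by (simp add: I_def)
  have F_T: "F = (\<Sum>i\<in>I. T i)"
    unfolding F_eq T_def S_def I_def using sum.image_gen[OF fin] .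
  have in_\<C>: "\<exists>b. b # C \<in> exponents D k \<and> f (b # C) \<noteq> 0" if C: "C \<in> \<C>" for C
  proof -
    obtain B where B: "C = tl B" "B \<in> exponents D k" "f B \<noteq> 0" using C by (auto simp: \<C>_def)
    then have "B = hd B # C" by (cases B) (auto simp: exponents_def)
    then show ?thesis using B by metis
  qed
  have tl_nth: "tl B ! k = B ! (k + 1)" if "B \<in> exponents D k" for B
    using that by (simp add: exponents_def nth_tl)
  have E_iff: "E i \<noteq> {} \<longleftrightarrow> i \<in> I" for i
    unfolding E_def I_def \<C>_def using tl_nth by (auto simp: image_iff)
  have "\<exists>W. W \<in> wt k ` E i \<and> (\<forall>B\<in>E i. W \<le> wt k B) \<and> cc i W \<noteq> 0 \<and> monom_unit (pb k (T i)) W i (cc i W)"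
    if i: "i \<in> I" for i
  proof (rule slice_leading_term[of k "S i" i f])
    show "finite (S i)" using fin by (simp add: S_def)
    show "S i \<noteq> {}" using i by (auto simp: S_def I_def)
    show "C ! k = i \<and> (\<exists>b. b # C \<in> exponents D k \<and> f (b # C) \<noteq> 0)" if "C \<in> S i" for C
      using that in_\<C> by (simp add: S_def)
    show "tl B \<in> S i" if "B \<in> exponents D k" "B ! (k + 1) = i" "f B \<noteq> 0" for B
      using that tl_nth by (auto simp: S_def \<C>_def)
  next
    fix W
    assume W: "W \<in> wt k ` {B \<in> exponents D k. B ! (k + 1) = i \<and> f B \<noteq> 0}"
      "\<And>B. B \<in> exponents D k \<Longrightarrow> B ! (k + 1) = i \<Longrightarrow> f B \<noteq> 0 \<Longrightarrow> W \<le> wt k B"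
      "(\<Sum>B\<in>expo k i W. to_ac (f B) * Lam k B) \<noteq> 0"
      "monom_unit (pb k (\<Sum>C\<in>S i. smult (Abs_fps (\<lambda>b. f (b # C))) (\<Prod>j\<le>k. \<phi> j ^ (C ! j)))) W i
       (\<Sum>B\<in>expo k i W. to_ac (f B) * Lam k B)"
    show ?thesis
    proof (intro exI[of _ W] conjI ballI)
      show "W \<in> wt k ` E i" using W(1) by (simp add: E_def)
      show "W \<le> wt k B" if "B \<in> E i" for B using W(2)[of B] that by (simp add: E_def)
      show "cc i W \<noteq> 0" using W(3) by (simp add: cc_def)
      show "monom_unit (pb k (T i)) W i (cc i W)" using W(4) by (simp add: cc_def T_def tm_def)
    qed
  qed simp
  then have "\<forall>i\<in>I. \<exists>W. W \<in> wt k ` E i \<and> (\<forall>B\<in>E i. W \<le> wt k B) \<and> cc i W \<noteq> 0 \<and> monom_unit (pb k (T i)) W i (cc i W)"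
    by blast
  from bchoice[OF this] obtain W where W: "\<And>i. i \<in> I \<Longrightarrow> W i \<in> wt k ` E i"
    "\<And>i B. i \<in> I \<Longrightarrow> B \<in> E i \<Longrightarrow> W i \<le> wt k B" "\<And>i. i \<in> I \<Longrightarrow> cc i (W i) \<noteq> 0"
    "\<And>i. i \<in> I \<Longrightarrow> monom_unit (pb k (T i)) (W i) i (cc i (W i))" by blast
  obtain v U where U: "pb k F = smult (fps_X ^ v) (Hk * U)" "coeff U 0 $ 0 \<noteq> 0"
    using pb_F[OF \<open>k \<le> g\<close>] unfolding Hk_def by blast
  have sum_eq: "smult (fps_X ^ v) (Hk * U) = (\<Sum>i\<in>I. pb k (T i))"
    unfolding U(1)[symmetric] by (subst F_T) (rule pb_sum)
  have np: "coeff Hk i $ j * coeff U 0 $ 0 = (if i \<in> I \<and> W i = v + j then cc i (W i) else 0)"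
    if "(real i, real j) \<in> newton_polygon Hk" for i j
    using newton_polygon_nth[OF wH U(2) sum_eq finI W(4,3) that] .
  have HN: "coeff Hk N $ 0 = 1" using wH dH by (simp add: weierstrass_def)
  \<comment> \<open>At the vertex (N, 0) the coefficient of \<open>Hk\<close> is 1, so U(0, 0) is
    the leading coefficient of the slice N.\<close>
  have N: "N \<in> I" "cc N (W N) = coeff U 0 $ 0"
    using np[of N 0] newton_polygon_degree[OF wH] HN U(2) dH by (auto split: if_splits)
  have dd: "dd k > 0" using dd_pos[OF \<open>k \<le> g\<close>] .
  have lc: "lead_coeff (\<phi> k) = 1" and d\<phi>: "degree (\<phi> k) = dd k"
    using lead_coeff_\<phi>[of k] degree_\<phi>[of k] by simp_all
  \<comment> \<open>The digit of F at the i-th power of \<open>\<phi> k\<close>.\<close>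
  define h where "h = (\<lambda>i. \<Sum>C\<in>S i. smult (Abs_fps (\<lambda>b. f (b # C))) (\<Prod>j<k. \<phi> j ^ (C ! j)))"
  have T_h: "T i = h i * \<phi> k ^ i" for i
    unfolding T_def h_def sum_distrib_right tm_def
    by (intro sum.cong refl) (simp add: S_def lessThan_Suc_atMost[symmetric])
  have dh: "degree (h i) < dd k" for i
  proof -
    have "degree (h i) \<le> dd k - 1"
      unfolding h_def
    proof (intro degree_sum_le)
      show "finite (S i)" using fin by (simp add: S_def)
      fix C assume "C \<in> S i"
      then obtain b where "b # C \<in> exponents D k" using in_\<C>[of C] by (auto simp: S_def)
      then have "degree (\<Prod>j<k. \<phi> j ^ (C ! j)) < dd k" by (intro degree_prod_\<phi>) (auto simp: exponents_Cons)
      then show "degree (smult (Abs_fps (\<lambda>b. f (b # C))) (\<Prod>j<k. \<phi> j ^ (C ! j))) \<le> dd k - 1"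
        using degree_smult_le[of "Abs_fps (\<lambda>b. f (b # C))" "\<Prod>j<k. \<phi> j ^ (C ! j)"] by linarith
    qed
    then show ?thesis using dd by linarith
  qed
  \<comment> \<open>F and the N-th power of \<open>\<phi> k\<close> are monic of the same degree, so
    their difference has only digits below N. Uniqueness of digits then fixes the digit at
    N.\<close>
  have hN: "h N = 1"
  proof -
    define M where "M = Suc (Max (insert N I))"
    have M: "N < M" "I \<subseteq> {..<M}" using finI by (auto simp: M_def less_Suc_eq_le)
    have "h i = 0" if "i \<notin> I" for i
    proof -
      have "S i = {}" using that by (auto simp: S_def I_def)
      then show ?thesis by (simp add: h_def)
    qed
    then have F_h: "F = (\<Sum>i<M. h i * \<phi> k ^ i)"
      unfolding F_T T_h using M by (intro sum.mono_neutral_left) auto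
    have dF: "degree F = dd k * N" using degree_F[OF \<open>k \<le> g\<close>] by (simp add: N_def mult.commute)
    have "\<phi> k \<noteq> 0" using lc by auto
    then have dP: "degree (\<phi> k ^ N) = dd k * N" by (simp add: degree_power_eq d\<phi> mult.commute)
    have pos: "dd k * N > 0" using dd assms(7) by (simp add: N_def)
    have "coeff (F - \<phi> k ^ N) (dd k * N) = lead_coeff F - lead_coeff (\<phi> k ^ N)" by (simp add: dF dP)
    also have "\<dots> = 0" using assms(3) lc by (simp add: weierstrass_def lead_coeff_power)
    finally have "degree (F - \<phi> k ^ N) < dd k * N"
      using pos degree_diff_le[of F "dd k * N" "\<phi> k ^ N"] dF dP
      by (metis le_neq_implies_less le_refl leading_coeff_0_iff degree_0)
    from phi_adic_expansion[OF lc d\<phi> dd this]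
    obtain h' where h': "\<And>i. degree (h' i) < dd k" "F - \<phi> k ^ N = (\<Sum>i<N. h' i * \<phi> k ^ i)" by blast
    define h2 where "h2 = (\<lambda>i. if i < N then h' i else if i = N then 1 else 0)"
    have "(\<Sum>i<M. h2 i * \<phi> k ^ i) = (\<Sum>i<Suc N. h2 i * \<phi> k ^ i)"
      using M by (intro sum.mono_neutral_right) (auto simp: h2_def)
    also have "\<dots> = F" using h'(2) by (simp add: h2_def algebra_simps)
    finally have "(\<Sum>i<M. (h i - h2 i) * \<phi> k ^ i) = 0"
      using F_h by (simp add: left_diff_distrib sum_subtractf)
    moreover have "degree (h i - h2 i) < dd k" for i
      using dh[of i] h'(1)[of i] dd by (intro degree_diff_less) (auto simp: h2_def)
    ultimately have "h N - h2 N = 0" using phi_adic_unique[OF lc d\<phi> dd _ _ M(1), of "\<lambda>i. h i - h2 i"] by blast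
    then show ?thesis by (simp add: h2_def)
  qed
  \<comment> \<open>The slice N is a pure power of \<open>\<phi> k\<close>, so its trailing
    coefficient is known in two ways.\<close>
  have U00: "coeff U 0 $ 0 = LL k (k + 1) ^ N"
  proof -
    have "monom_unit (pb k (\<phi> k ^ N)) (N * vv k (k + 1)) (N * 1) (LL k (k + 1) ^ N)"
      unfolding pb_power[OF \<open>k \<le> g\<close>] using monom_unit_vv_LL[of k "k + 1"]
      by (intro monom_unit_power) (simp add: Ph_def)
    from monom_unit_val_lambda(2)[OF this] have "lambda_k D k (\<phi> k ^ N) = LL k (k + 1) ^ N"
      using LL_nonzero[of k "k + 1"] by simp
    moreover have "T N = \<phi> k ^ N" by (simp add: T_h hN)
    ultimately show ?thesis using monom_unit_val_lambda(2)[OF W(4)[OF N(1)] W(3)[OF N(1)]] N(2) by simp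
  qed
  \<comment> \<open>At x = 0 the lower coefficients of \<open>Hk\<close> vanish, so the coefficient
    of y^N in \<open>Hk * U\<close> is U(0, 0), which is nonzero.\<close>
  have valF: "val_k D k F = enat v"
  proof -
    have "coeff (Hk * U) N $ 0 = (\<Sum>i\<le>N. coeff Hk i $ 0 * coeff U (N - i) $ 0)"
      by (simp add: coeff_mult fps_sum_nth)
    also have "\<dots> = (\<Sum>i\<le>N. if i = N then coeff U 0 $ 0 else 0)"
      using wH HN dH by (intro sum.cong) (auto simp: weierstrass_def)
    finally have "coeff (Hk * U) N $ 0 \<noteq> 0" using U(2) by simp
    then show ?thesis unfolding val_k_def using v_x_poly_eqI[OF U(1)[unfolded pb_def]] by blast
  qed
  have w_exp: "w_exp D \<phi> k F f i = ereal (real w) \<longleftrightarrow> i \<in> I \<and> W i = v + w" for i w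
  proof (cases "i \<in> I")
    case True
    have sc: "scalar B (V_list D \<phi> k) = enat (wt k B)" if "B \<in> E i" for B
      using that by (intro scalar_V_list) (auto simp: E_def exponents_def)
    have "(INF B \<in> E i. ereal_of_enat (scalar B (V_list D \<phi> k))) = ereal (real (W i))"
    proof (rule antisym)
      obtain B where B: "B \<in> E i" "W i = wt k B" using W(1)[OF True] by blast
      then show "(INF B \<in> E i. ereal_of_enat (scalar B (V_list D \<phi> k))) \<le> ereal (real (W i))"
        using sc[OF B(1)] by (intro INF_lower2[OF B(1)]) simp
      show "ereal (real (W i)) \<le> (INF B \<in> E i. ereal_of_enat (scalar B (V_list D \<phi> k)))"
        using W(2)[OF True] sc by (intro INF_greatest) simp
    qed
    then have "w_exp D \<phi> k F f i = ereal (real (W i)) - ereal (real v)"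
      unfolding w_exp_def valF E_def by simp
    then show ?thesis using True by (auto simp: algebra_simps) 
  next
    case False
    then have "E i = {}" using E_iff by blast
    \<comment> \<open>The infimum over the empty set is \<infinity>, and subtracting the finite
      valuation of F leaves it unchanged.\<close>
    then have "w_exp D \<phi> k F f i = \<infinity>" unfolding w_exp_def valF E_def by (simp only: image_empty Inf_empty) (simp add: top_ereal_def)
    then show ?thesis using False by simp
  qed
  let ?S2 = "{(i::nat, w::nat). w_exp D \<phi> k F f i = ereal (real w) \<and> (real i, real w) \<in> newton_polygon Hk}"
  have fin2: "finite ?S2"
    by (rule finite_subset[OF _ finite_newton_polygon_nat[of Hk]]) auto
  let ?co = "\<lambda>i w. \<Sum>B \<in> exponents_at D \<phi> k i (enat w + val_k D k F).
                to_ac (f B) * powi_vec (Lambda_list D \<phi> k) (diff_vec B B0)"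
  have co: "?co i w = coeff Hk i $ w" if iw: "(i, w) \<in> ?S2" for i w
  proof -
    have i: "i \<in> I" "W i = v + w" "(real i, real w) \<in> newton_polygon Hk" using iw w_exp by auto
    have ex: "exponents_at D \<phi> k i (enat w + val_k D k F) = expo k i (W i)"
      using exponents_at_eq[of k i "W i"] i(2) by (simp add: valF add.commute)
    have "?co i w = (\<Sum>B\<in>expo k i (W i). to_ac (f B) * (Lam k B / LL k (k + 1) ^ N))"
      unfolding ex B0_def N_def
      by (intro sum.cong refl) (subst powi_vec_Lambda, auto simp: expo_def exponents_def)
    also have "\<dots> = cc i (W i) / LL k (k + 1) ^ N" by (simp add: cc_def sum_divide_distrib)
    also have "\<dots> = coeff Hk i $ w"
      using np[OF i(3)] i(1,2) U(2) unfolding U00[symmetric] by (simp add: field_simps)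
    finally show ?thesis .
  qed
  show ?thesis
    unfolding Hk_def[symmetric]
  proof (intro poly_eqI fps_ext)
    fix i j
    \<comment> \<open>A lattice point of the polygon outside the index set has coefficient 0 in
      \<open>Hk\<close>, by \<open>np\<close> and U(0, 0) \<noteq> 0.\<close>
    have "coeff (boundary_poly Hk) i $ j = (if (i, j) \<in> ?S2 then ?co i j else 0)"
    proof (cases "(i, j) \<in> ?S2")
      case True
      then show ?thesis using co[OF True] by (simp add: boundary_poly_nth)
    next
      case False
      then have "(real i, real j) \<in> newton_polygon Hk \<Longrightarrow> coeff Hk i $ j = 0"
        using np[of i j] w_exp[of i j] U(2) by auto
      then show ?thesis using False by (simp add: boundary_poly_nth del: mem_Collect_eq)
    qed
    then show "coeff (boundary_poly Hk) i $ j =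
       coeff (\<Sum>(i, w) \<in> ?S2. monom (fps_const (?co i w) * fps_X ^ w) i) i $ j"
      unfolding coeff_sum_monom_fps_X[OF fin2] .
  qed
qed

end
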